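(* Let $W$ be a weight satisfying $(C_1)$, $(C_2)$ and $(C_3)$, and let $\{\omega(n)\}_{n\geq 0}$ be its associated moment sequence. If a compact set $E\subset \mathbb{T}$ supports a non-trivial distribution $S$ with $$\sum_{n\in \mathbb{Z}} |\widehat{S}(n)|^2 \omega(|n|) < \infty,$$ then $E$ also supports a probability measure $\mu$ with $\{\widehat{\mu}(n)\}_{n\in \mathbb{Z}} \in \ell^2(\omega)$, i.e. with $\sum_{n\in\mathbb{Z}}|\widehat\mu(n)|^2\omega(|n|)<\infty$.
   Context: $\mathbb{T}$ is the unit circle. A weight is a non-negative continuously differentiable function $W$ on $(0,1]$ which is integrable on $[0,1]$ with respect to Lebesgue measure. Its associated moment sequence is $\omega(n)=\int_0^1 r^n W(1-r)\,dr$, $n=0,1,2,\dots$. The conditions on $W$ are: $(C_1)$ $W$ is either monotone non-decreasing or monotone non-increasing; $(C_2)$ $\int_0^1 \frac{W(t)}{t}\,dt=+\infty$; $(C_3)$ there is a constant $0<c<2$, depending only on $W$, such that $W(t)\leq c\,W(t/2)$ for all $0<t<1$. The Fourier coefficients of a distribution $S$ on $\mathbb{T}$ are $\widehat S(n)=S(e^{it}\mapsto e^{-int})$, and those of a finite Borel measure $\mu$ are $\widehat\mu(n)=\int_{\mathbb{T}}\zeta^{-n}d\mu(\zeta)$. A set $E$ supports a distribution or a measure if the support of that object is contained in $E$. $\ell^2(\omega)$ denotes the space of two-sided sequences $\{a_n\}_{n\in\mathbb{Z}}$ with $\sum_n|a_n|^2\omega(|n|)<\infty$. *)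

theory Defs
  imports "HOL-Probability.Probability"
begin

abbreviation circle :: "complex set" where
  "circle \<equiv> sphere 0 1"

section \<open>Weights\<close>

text \<open>A weight lives on \<open>(0,1]\<close>; its values elsewhere are irrelevant. At the end point \<open>1\<close> the
  derivative is one-sided.\<close>

definition weight :: "(real \<Rightarrow> real) \<Rightarrow> bool" where
  "weight W \<longleftrightarrow>
     (\<forall>t\<in>{0<..1}. 0 \<le> W t) \<and>
     (\<exists>W'. continuous_on {0<..1} W' \<and>
        (\<forall>t\<in>{0<..1}. (W has_real_derivative W' t) (at t within {0<..1}))) \<and>
     set_integrable lborel {0<..1} W"

definition moment :: "(real \<Rightarrow> real) \<Rightarrow> nat \<Rightarrow> real" where
  "moment W n = (LINT r:{0..<1}|lborel. r ^ n * W (1 - r))"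

definition cond_C1 :: "(real \<Rightarrow> real) \<Rightarrow> bool" where
  "cond_C1 W \<longleftrightarrow> mono_on {0<..1} W \<or> antimono_on {0<..1} W"

definition cond_C2 :: "(real \<Rightarrow> real) \<Rightarrow> bool" where
  "cond_C2 W \<longleftrightarrow> (\<integral>\<^sup>+t\<in>{0<..1}. ennreal (W t / t) \<partial>lborel) = \<infinity>"

definition cond_C3 :: "(real \<Rightarrow> real) \<Rightarrow> bool" where
  "cond_C3 W \<longleftrightarrow> (\<exists>c. 0 < c \<and> c < 2 \<and> (\<forall>t\<in>{0<..<1}. W t \<le> c * W (t / 2)))"

section \<open>Distributions on the circle\<close>

text \<open>\<open>circle_deriv k \<phi> t\<close> is the \<open>k\<close>-th derivative of \<open>t \<mapsto> \<phi> (e\<^sup>i\<^sup>t)\<close>.\<close>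

definition circle_deriv :: "nat \<Rightarrow> (complex \<Rightarrow> complex) \<Rightarrow> real \<Rightarrow> complex" where
  "circle_deriv k \<phi> = ((\<lambda>g t. vector_derivative g (at t)) ^^ k) (\<lambda>t. \<phi> (cis t))"

text \<open>The space \<open>C\<^sup>\<infinity>(\<T>)\<close>. A function on the circle is represented by a function on the
  complex plane; only its values on the circle matter.\<close>

definition test_functions :: "(complex \<Rightarrow> complex) set" where
  "test_functions = {\<phi>. \<forall>k t. circle_deriv k \<phi> differentiable (at t)}"

text \<open>Continuous linear functionals on \<open>C\<^sup>\<infinity>(\<T>)\<close>, whose topology is given by the norms
  \<open>\<phi> \<mapsto> (\<Sum>k\<le>N. sup \<bar>\<phi>\<^sup>(\<^sup>k\<^sup>)\<bar>)\<close>. The estimate forces \<open>S \<phi> = S \<psi>\<close> whenever \<open>\<phi>\<close> and \<open>\<psi>\<close>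
  agree on the circle.\<close>

definition distribution :: "((complex \<Rightarrow> complex) \<Rightarrow> complex) \<Rightarrow> bool" where
  "distribution S \<longleftrightarrow>
     (\<forall>\<phi>\<in>test_functions. \<forall>\<psi>\<in>test_functions. S (\<lambda>z. \<phi> z + \<psi> z) = S \<phi> + S \<psi>) \<and>
     (\<forall>c. \<forall>\<phi>\<in>test_functions. S (\<lambda>z. c * \<phi> z) = c * S \<phi>) \<and>
     (\<exists>C N. \<forall>\<phi>\<in>test_functions.
        norm (S \<phi>) \<le> C * (\<Sum>k\<le>N. SUP t. norm (circle_deriv k \<phi> t)))"

definition nontrivial_distribution :: "((complex \<Rightarrow> complex) \<Rightarrow> complex) \<Rightarrow> bool" where
  "nontrivial_distribution S \<longleftrightarrow> (\<exists>\<phi>\<in>test_functions. S \<phi> \<noteq> 0)"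

definition function_support :: "(complex \<Rightarrow> complex) \<Rightarrow> complex set" where
  "function_support \<phi> = closure {z \<in> circle. \<phi> z \<noteq> 0}"

definition distribution_support :: "((complex \<Rightarrow> complex) \<Rightarrow> complex) \<Rightarrow> complex set" where
  "distribution_support S =
     circle - \<Union>{U. open U \<and> (\<forall>\<phi>\<in>test_functions. function_support \<phi> \<subseteq> U \<longrightarrow> S \<phi> = 0)}"

definition distribution_fourier :: "((complex \<Rightarrow> complex) \<Rightarrow> complex) \<Rightarrow> int \<Rightarrow> complex" where
  "distribution_fourier S n = S (\<lambda>z. z powi (- n))"

section \<open>Measures on the circle\<close>

definition circle_borel :: "complex measure" where
  "circle_borel = restrict_space borel circle"

definition measure_support :: "complex measure \<Rightarrow> complex set" where
  "measure_support \<mu> = circle - \<Union>{U. open U \<and> emeasure \<mu> (U \<inter> circle) = 0}"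

definition measure_fourier :: "complex measure \<Rightarrow> int \<Rightarrow> complex" where
  "measure_fourier \<mu> n = (LINT z|\<mu>. z powi (- n))"

section \<open>Weighted sequence spaces\<close>

definition weighted_l2 :: "(nat \<Rightarrow> real) \<Rightarrow> (int \<Rightarrow> complex) set" where
  "weighted_l2 w = {a. (\<lambda>n. (norm (a n))\<^sup>2 * w (nat \<bar>n\<bar>)) summable_on UNIV}"

end

theory Submission
  imports Defs
begin

text \<open>Put \<open>\<omega> = moment W\<close>. By \<open>(C\<^sub>3)\<close> and \<open>1 - 2 t \<le> (1 - t)\<^sup>2\<close>, \<open>\<omega>(n) \<le> 2 c \<omega>(2 n)\<close> with \<open>2 c < 4\<close>.
  This growth bound makes \<open>1 / \<omega>(\<bar>n\<bar>)\<close> comparable to \<open>1 + \<lambda>(n)\<close>, where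
  \<open>\<lambda>(n) = \<integral> k(x) \<bar>e\<^sup>i\<^sup>n\<^sup>x - 1\<bar>\<^sup>2 dx\<close> for a suitable kernel \<open>k \<ge> 0\<close>. Hence the norm dual to
  \<open>\<Sum> \<bar>S(z\<^sup>-\<^sup>n)\<bar>\<^sup>2 \<omega>(\<bar>n\<bar>)\<close> is a Dirichlet energy, and it is decreased by Lipschitz maps up to a constant.

  If \<open>Re p \<ge> 1\<close> on \<open>E\<close> for trigonometric polynomials \<open>p\<close> of small energy, then \<open>F (Re p)\<close>, with a
  smooth cutoff \<open>F\<close> that vanishes at \<open>0\<close> and is \<open>1\<close> on \<open>[1/2, \<infinity>)\<close>, is \<open>1\<close> near \<open>E\<close> and has small
  energy; testing \<open>S\<close> against \<open>z\<^sup>-\<^sup>n F (Re p)\<close> shows that every Fourier coefficient of \<open>S\<close> vanishes.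
  So for nontrivial \<open>S\<close> the convex set of all \<open>p\<close> with \<open>Re p \<ge> 1\<close> on \<open>E\<close> has positive distance
  from \<open>0\<close>. Its element of least norm (in the completion) defines a functional that is nonnegative
  on the \<open>p\<close> with \<open>Re p \<ge> 0\<close> on \<open>E\<close>, and Herglotz' theorem turns it into the required measure.\<close>

section \<open>Smooth functions\<close>

text \<open>The condition defining \<open>weighted_l2\<close> is read off single coefficients, and
  composing a polynomial with a cutoff destroys control of its coefficients. Differences survive:
  \<bar>F(u) - F(v)\<bar> \<le> K \<bar>u - v\<bar>. This is why the dual norm is rewritten as a
  difference energy before any cutoff is applied. The bound \<open>2 c < 4\<close> pays for it:
  \<bar>e^(inx) - 1\<bar>^2 has a zero of order two at x = 0, so the fine scales of the kernel are
  dominated by a geometric series of ratio 2c/4. A second obstacle is that \<open>S\<close> accepts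
  only smooth functions while the assumption on it concerns exponentials. Hence the cutoff is
  smooth, and the bound for \<bar>S p\<bar>^2 is carried from trigonometric polynomials to test
  functions by an approximation in which finitely many derivatives converge uniformly. Duality then
  closes the circle: the functional defined by the minimal element has coefficients b(n) with \<Sum>
  \<bar>b(n)\<bar>^2 / (1 + \<lambda>(n)) finite, and 1 / (1 + \<lambda>(n)) is again comparable to
  \<omega>(\<bar>n\<bar>).\<close>

fun n_differentiable :: "nat \<Rightarrow> (real \<Rightarrow> 'a::real_normed_vector) \<Rightarrow> bool" where
  "n_differentiable 0 f \<longleftrightarrow> True"
| "n_differentiable (Suc k) f \<longleftrightarrow>
     (\<exists>f'. (\<forall>t. (f has_vector_derivative f' t) (at t)) \<and> n_differentiable k f')"

lemma n_differentiable_Suc_D: "n_differentiable (Suc k) f \<Longrightarrow> n_differentiable k f"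
proof (induction k arbitrary: f)
  case (Suc k)
  then obtain f' where "\<forall>t. (f has_vector_derivative f' t) (at t)" "n_differentiable (Suc k) f'"
    by auto
  then show ?case using Suc.IH[of f'] by (auto simp del: n_differentiable.simps(2)
    simp: n_differentiable.simps(2)[of k f])
qed simp

lemma n_differentiable_const [simp]: "n_differentiable k (\<lambda>_. c)"
proof (induction k arbitrary: c)
  case (Suc k)
  then show ?case by (auto intro!: exI[of _ "\<lambda>_. 0"])
qed simp

lemma n_differentiable_add:
  "n_differentiable k f \<Longrightarrow> n_differentiable k g \<Longrightarrow> n_differentiable k (\<lambda>t. f t + g t)"
proof (induction k arbitrary: f g)
  case (Suc k)
  then obtain f' g' where "\<forall>t. (f has_vector_derivative f' t) (at t)" "n_differentiable k f'"
    "\<forall>t. (g has_vector_derivative g' t) (at t)" "n_differentiable k g'"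
    by auto
  then show ?case using Suc.IH
    by (auto intro!: exI[of _ "\<lambda>t. f' t + g' t"] has_vector_derivative_add)
qed simp

lemma n_differentiable_sum:
  "(\<And>i. i \<in> A \<Longrightarrow> n_differentiable k (f i)) \<Longrightarrow> n_differentiable k (\<lambda>t. \<Sum>i\<in>A. f i t)"
  by (induction A rule: infinite_finite_induct) (auto intro: n_differentiable_add)

lemma n_differentiable_linear:
  assumes "bounded_linear h"
  shows "n_differentiable k f \<Longrightarrow> n_differentiable k (\<lambda>t. h (f t))"
proof (induction k arbitrary: f)
  case (Suc k)
  then obtain f' where "\<forall>t. (f has_vector_derivative f' t) (at t)" "n_differentiable k f'"
    by auto
  then show ?case using Suc.IH[of f'] bounded_linear.has_vector_derivative[OF assms]
    by (auto intro!: exI[of _ "\<lambda>t. h (f' t)"])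
qed simp

lemma n_differentiable_bilinear:
  assumes "bounded_bilinear h"
  shows "n_differentiable k f \<Longrightarrow> n_differentiable k g \<Longrightarrow> n_differentiable k (\<lambda>t. h (f t) (g t))"
proof (induction k arbitrary: f g)
  case (Suc k)
  then obtain f' g' where d: "\<forall>t. (f has_vector_derivative f' t) (at t)" "n_differentiable k f'"
    "\<forall>t. (g has_vector_derivative g' t) (at t)" "n_differentiable k g'"
    by auto
  have "n_differentiable k (\<lambda>t. h (f t) (g' t) + h (f' t) (g t))"
    by (intro n_differentiable_add Suc.IH d Suc.prems[THEN n_differentiable_Suc_D])
  then show ?case using bounded_bilinear.has_vector_derivative[OF assms] d
    by (auto intro!: exI[of _ "\<lambda>t. h (f t) (g' t) + h (f' t) (g t)"])
qed simp

lemma n_differentiable_compose: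
  fixes g :: "real \<Rightarrow> real"
  shows "n_differentiable k f \<Longrightarrow> n_differentiable k g \<Longrightarrow> n_differentiable k (\<lambda>t. f (g t))"
proof (induction k arbitrary: f)
  case (Suc k)
  then obtain f' g' where d: "\<forall>t. (f has_vector_derivative f' t) (at t)" "n_differentiable k f'"
    "\<forall>t. (g has_vector_derivative g' t) (at t)" "n_differentiable k g'"
    by auto
  have "n_differentiable k (\<lambda>t. g' t *\<^sub>R f' (g t))"
    by (intro n_differentiable_bilinear[OF bounded_bilinear_scaleR] Suc.IH d
        Suc.prems[THEN n_differentiable_Suc_D])
  moreover have "((\<lambda>t. f (g t)) has_vector_derivative g' t *\<^sub>R f' (g t)) (at t)" for t
    using d vector_diff_chain_at[of g "g' t" t f "f' (g t)"] by (simp add: o_def)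
  ultimately show ?case by (auto intro!: exI[of _ "\<lambda>t. g' t *\<^sub>R f' (g t)"])
qed simp

text \<open>Products and compositions are handled by induction on \<open>k\<close> for
  \<open>n_differentiable\<close>, whose existential derivative can be supplied as a formula,
  whereas \<open>circle_deriv\<close> is an iterated \<open>vector_derivative\<close>. In the
  converse \<open>k\<close> derivatives are spent and \<open>j\<close> remain, and uniqueness of
  derivatives identifies the witness with \<open>vector_derivative\<close>.\<close>

lemma test_functions_iff: "\<phi> \<in> test_functions \<longleftrightarrow> (\<forall>k. n_differentiable k (\<lambda>t. \<phi> (cis t)))"
proof
  assume "\<phi> \<in> test_functions"
  then have "((circle_deriv j \<phi>) has_vector_derivative circle_deriv (Suc j) \<phi> t) (at t)" for j t
    by (simp add: test_functions_def circle_deriv_def vector_derivative_works[symmetric])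
  then have "n_differentiable k (circle_deriv j \<phi>)" for k j
    by (induction k arbitrary: j) auto
  from this[of _ 0] show "\<forall>k. n_differentiable k (\<lambda>t. \<phi> (cis t))" by (simp add: circle_deriv_def)
next
  assume *: "\<forall>k. n_differentiable k (\<lambda>t. \<phi> (cis t))"
  have "n_differentiable j (((\<lambda>g t. vector_derivative g (at t)) ^^ k) f)"
    if "n_differentiable (k + j) f" for k j and f :: "real \<Rightarrow> complex"
    using that
  proof (induction k arbitrary: j)
    case (Suc k)
    let ?f = "((\<lambda>g t. vector_derivative g (at t)) ^^ k) f"
    have "n_differentiable (Suc j) ?f" using Suc.prems by (intro Suc.IH) simp
    then obtain f' where f': "\<And>t. (?f has_vector_derivative f' t) (at t)" "n_differentiable j f'" by auto
    then have "(\<lambda>t. vector_derivative ?f (at t)) = f'" by (auto intro: vector_derivative_at)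
    then show ?case using f' by simp
  qed simp
  then have "n_differentiable 1 (circle_deriv k \<phi>)" for k
    using * by (auto simp: circle_deriv_def simp del: n_differentiable.simps)
  then show "\<phi> \<in> test_functions"
    by (auto simp: test_functions_def intro: differentiableI_vector)
qed

lemma test_functions_add:
  "\<phi> \<in> test_functions \<Longrightarrow> \<psi> \<in> test_functions \<Longrightarrow> (\<lambda>z. \<phi> z + \<psi> z) \<in> test_functions"
  by (simp add: test_functions_iff n_differentiable_add)

lemma test_functions_mult:
  "\<phi> \<in> test_functions \<Longrightarrow> \<psi> \<in> test_functions \<Longrightarrow> (\<lambda>z. \<phi> z * \<psi> z) \<in> test_functions"
  by (simp add: test_functions_iff n_differentiable_bilinear[OF bounded_bilinear_mult])

lemma test_functions_const [simp]: "(\<lambda>z. c) \<in> test_functions"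
  by (simp add: test_functions_iff)

lemma test_functions_diff:
  "\<phi> \<in> test_functions \<Longrightarrow> \<psi> \<in> test_functions \<Longrightarrow> (\<lambda>z. \<phi> z - \<psi> z) \<in> test_functions"
  using test_functions_add[of \<phi> "\<lambda>z. -1 * \<psi> z"] test_functions_mult[of "\<lambda>z. -1" \<psi>] by simp

lemma test_functions_sum:
  "(\<And>i. i \<in> A \<Longrightarrow> \<phi> i \<in> test_functions) \<Longrightarrow> (\<lambda>z. \<Sum>i\<in>A. \<phi> i z) \<in> test_functions"
  by (simp add: test_functions_iff n_differentiable_sum)

lemma test_functions_compose:
  assumes "\<And>k. n_differentiable k (F :: real \<Rightarrow> real)" "\<phi> \<in> test_functions"
  shows "(\<lambda>z. complex_of_real (F (Re (\<phi> z)))) \<in> test_functions"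
  unfolding test_functions_iff
proof
  fix k
  have "n_differentiable k (\<lambda>t. Re (\<phi> (cis t)))"
    using assms(2) n_differentiable_linear[OF bounded_linear_Re, of k "\<lambda>t. \<phi> (cis t)"]
    by (simp add: test_functions_iff)
  from n_differentiable_compose[OF assms(1) this]
  show "n_differentiable k (\<lambda>t. complex_of_real (F (Re (\<phi> (cis t)))))"
    by (rule n_differentiable_linear[OF bounded_linear_of_real])
qed

lemma has_vector_derivative_cis_mult:
  "((\<lambda>t. cis (c * t)) has_vector_derivative \<i> * of_real c * cis (c * t)) (at t)"
proof -
  have "((\<lambda>z. exp (\<i> * of_real c * z)) has_field_derivative
      \<i> * of_real c * exp (\<i> * of_real c * of_real t)) (at (of_real t))"
    by (rule derivative_eq_intros refl)+ simp
  from has_vector_derivative_real_field[OF this] show ?thesis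
    by (simp add: cis_conv_exp mult.assoc)
qed

lemma test_functions_powi [simp]: "(\<lambda>z. z powi n) \<in> test_functions"
proof -
  have "n_differentiable k (\<lambda>t. a * cis (c * t))" for k c a
  proof (induction k arbitrary: a)
    case (Suc k)
    have "((\<lambda>t. a * cis (c * t)) has_vector_derivative (a * (\<i> * of_real c)) * cis (c * t)) (at t)" for t
      using has_vector_derivative_mult_right[OF has_vector_derivative_cis_mult[of c t], of a]
      by (simp add: mult.assoc)
    then show ?case using Suc by (auto intro!: exI[of _ "\<lambda>t. a * (\<i> * of_real c) * cis (c * t)"])
  qed simp
  from this[of _ 1] show ?thesis by (simp add: test_functions_iff cis_power_int)
qed

section \<open>A smooth cutoff built from exp(-1/x)\<close>

definition flat :: "real poly \<Rightarrow> real \<Rightarrow> real" where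
  "flat P x = (if 0 < x then poly P (1 / x) * exp (- (1 / x)) else 0)"

lemma flat_tendsto_0: "((\<lambda>x. flat P x / x) \<longlongrightarrow> 0) (at 0)"
proof -
  define Q where "Q = pCons 0 P"
  have "((\<lambda>y. \<Sum>i\<le>degree Q. coeff Q i * (y ^ i / exp y)) \<longlongrightarrow> (\<Sum>i\<le>degree Q. coeff Q i * 0)) at_top"
    by (intro tendsto_intros tendsto_power_div_exp_0)
  moreover have "(\<Sum>i\<le>degree Q. coeff Q i * (y ^ i / exp y)) = poly Q y * exp (- y)" for y :: real
    unfolding poly_altdef sum_distrib_right by (simp add: exp_minus field_simps)
  ultimately have "((\<lambda>y. poly Q y * exp (- y)) \<longlongrightarrow> 0) at_top" by simp
  from filterlim_compose[OF this filterlim_inverse_at_top_right]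
  have "((\<lambda>x. poly Q (inverse x) * exp (- inverse x)) \<longlongrightarrow> 0) (at_right 0)" .
  then have "((\<lambda>x. flat P x / x) \<longlongrightarrow> 0) (at_right 0)"
    by (rule Lim_transform_eventually)
       (auto simp: flat_def Q_def field_simps eventually_at_right_less intro!: eventually_mono[OF eventually_at_right_less[of 0]])
  moreover have "((\<lambda>x. flat P x / x) \<longlongrightarrow> 0) (at_left 0)"
    by (rule tendsto_eventually) (auto simp: flat_def eventually_at_left_field intro!: exI[of _ "-1"])
  ultimately show ?thesis by (simp add: filterlim_split_at)
qed

text \<open>The polynomial factor closes the family under differentiation: for x > 0 the derivative
  of P(1/x) exp(-1/x) is (1/x^2) (P - P')(1/x) exp(-1/x), and X^2 (P - P') is again a polynomial.
  Smoothness follows by induction with \<open>P\<close> arbitrary.\<close>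

lemma flat_deriv: "(flat P has_real_derivative flat ([:0,0,1:] * (P - pderiv P)) x) (at x)"
proof (cases x "0::real" rule: linorder_cases)
  case less
  have "\<forall>\<^sub>F y in nhds x. flat P y = 0"
    using less eventually_nhds_in_open[of "{..<0}" x] by (auto elim!: eventually_mono simp: flat_def)
  then have "(flat P has_real_derivative 0) (at x)"
    by (subst DERIV_cong_ev[OF refl _ refl]) auto
  then show ?thesis using less by (simp add: flat_def)
next
  case equal
  have "((\<lambda>h. (flat P (0 + h) - flat P 0) / h) \<longlongrightarrow> 0) (at 0)"
    using flat_tendsto_0[of P] by (simp add: flat_def)
  then show ?thesis using equal by (simp add: DERIV_def flat_def)
next
  case greater
  have "((\<lambda>x. poly P (1 / x) * exp (- (1 / x))) has_real_derivative
     flat ([:0,0,1:] * (P - pderiv P)) x) (at x)"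
    using greater
    by (auto intro!: derivative_eq_intros poly_DERIV[THEN DERIV_chain2] simp: flat_def field_simps power2_eq_square)
  moreover have "\<forall>\<^sub>F y in nhds x. flat P y = poly P (1 / y) * exp (- (1 / y))"
    using greater eventually_nhds_in_open[of "{0<..}" x] by (auto elim!: eventually_mono simp: flat_def)
  ultimately show ?thesis by (subst DERIV_cong_ev[OF refl _ refl]) auto
qed

lemma n_differentiable_flat: "n_differentiable k (flat P)"
proof (induction k arbitrary: P)
  case (Suc k)
  then show ?case using flat_deriv[of P]
    by (auto simp: has_real_derivative_iff_has_vector_derivative)
qed simp

text \<open>\<open>F\<close> is the normalised primitive of a bump \<open>B\<close> that is positive
  exactly on (0, 1/2). Since 0 \<le> B \<le> 1, the primitive is 1-Lipschitz, and dividing by its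
  total mass G(1/2) gives the constant \<open>K\<close>.\<close>

lemma smooth_cutoff:
  obtains F :: "real \<Rightarrow> real" and K where "\<And>k. n_differentiable k F" "\<And>t. t \<le> 0 \<Longrightarrow> F t = 0"
    "\<And>t. 1/2 \<le> t \<Longrightarrow> F t = 1" "\<And>s t. \<bar>F s - F t\<bar> \<le> K * \<bar>s - t\<bar>" "0 < K"
proof -
  define B where "B = (\<lambda>s. flat 1 s * flat 1 (1/2 - s))"
  have B_smooth: "n_differentiable k B" for k
  proof -
    have "n_differentiable k (\<lambda>s::real. 1/2 + - s)"
      by (cases k) (auto intro!: exI[of _ "\<lambda>_. -1"] derivative_eq_intros
          simp: has_real_derivative_iff_has_vector_derivative[symmetric])
    then have "n_differentiable k (\<lambda>s. flat 1 (1/2 - s))"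
      using n_differentiable_compose[OF n_differentiable_flat] by fastforce
    then show ?thesis
      unfolding B_def by (rule n_differentiable_bilinear[OF bounded_bilinear_mult n_differentiable_flat])
  qed
  have B0: "0 \<le> B s" "B s \<le> 1" for s
    by (auto simp: B_def flat_def mult_le_one)
  have Bpos: "0 < B s" if "0 < s" "s < 1/2" for s
    using that by (auto simp: B_def flat_def)
  have Bz: "B s = 0" if "s \<le> 0 \<or> 1/2 \<le> s" for s
    using that by (auto simp: B_def flat_def)
  have contB: "continuous_on A B" for A
  proof -
    obtain B' where "\<And>t. (B has_vector_derivative B' t) (at t)" using B_smooth[of 1] by auto
    then show ?thesis
      by (intro continuous_at_imp_continuous_on ballI) (rule has_vector_derivative_continuous)
  qed
  define G where "G = (\<lambda>u::real. LBINT y=ereal 0..ereal u. B y)"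
  have G: "(G has_real_derivative B x) (at x)" for x
  proof -
    have "((\<lambda>u. LBINT y=ereal 0..u. B y) has_vector_derivative B x) (at x within {-\<bar>x\<bar>-1..\<bar>x\<bar>+1})"
      by (rule interval_integral_FTC2[OF _ _ contB]) auto
    then show ?thesis
      by (subst (asm) at_within_interior)
         (auto simp: G_def has_real_derivative_iff_has_vector_derivative)
  qed
  have G0: "G 0 = 0" by (simp add: G_def)
  have Gneg: "G t = 0" if "t \<le> 0" for t
  proof -
    have "\<And>x. x \<in> {t..0} \<Longrightarrow> (G has_real_derivative 0) (at x within {t..0})"
      using G Bz by (metis atLeastAtMost_iff has_field_derivative_at_within)
    then show ?thesis
      using has_field_derivative_zero_constant[of "{t..0}" G] that G0 by fastforce
  qed
  have Gbig: "G t = G (1/2)" if "1/2 \<le> t" for t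
  proof -
    have "\<And>x. x \<in> {1/2..t} \<Longrightarrow> (G has_real_derivative 0) (at x within {1/2..t})"
      using G Bz by (metis atLeastAtMost_iff has_field_derivative_at_within)
    then show ?thesis
      using has_field_derivative_zero_constant[of "{1/2..t}" G] that by fastforce
  qed
  have Gpos: "0 < G (1/2)"
  proof -
    have "G 0 < G (1/2)"
      by (rule DERIV_pos_imp_increasing_open)
         (use G Bpos in \<open>auto intro!: continuous_at_imp_continuous_on DERIV_isCont\<close>)
    then show ?thesis using G0 by simp
  qed
  have Glip: "\<bar>G s - G t\<bar> \<le> \<bar>s - t\<bar>" for s t
    using field_differentiable_bound[of UNIV G B 1 t s] G B0 by (auto simp: field_simps)
  define F where "F = (\<lambda>t. G t / G (1/2))"
  have "n_differentiable k F" for k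
  proof (cases k)
    case (Suc j)
    have "(F has_vector_derivative B t / G (1/2)) (at t)" for t
      unfolding F_def has_real_derivative_iff_has_vector_derivative[symmetric]
      using G Gpos by (auto intro!: derivative_eq_intros)
    moreover have "n_differentiable j (\<lambda>t. B t / G (1/2))"
      by (rule n_differentiable_linear[OF bounded_linear_divide B_smooth])
    ultimately show ?thesis unfolding Suc by (auto intro!: exI[of _ "\<lambda>t. B t / G (1/2)"])
  qed simp
  moreover have "\<bar>F s - F t\<bar> \<le> 1 / G (1/2) * \<bar>s - t\<bar>" for s t
  proof -
    have "F s - F t = (G s - G t) / G (1/2)" by (simp add: F_def diff_divide_distrib)
    then show ?thesis using Glip[of s t] Gpos by (simp add: divide_right_mono)
  qed
  moreover have "F t = 0" if "t \<le> 0" for t using Gneg[OF that] by (simp add: F_def)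
  moreover have "F t = 1" if "1/2 \<le> t" for t using Gbig[OF that] Gpos by (simp add: F_def)
  ultimately show ?thesis using that[of F "1 / G (1/2)"] Gpos by simp
qed

section \<open>Distributions and their support\<close>

lemma distribution_add:
  "distribution S \<Longrightarrow> \<phi> \<in> test_functions \<Longrightarrow> \<psi> \<in> test_functions \<Longrightarrow> S (\<lambda>z. \<phi> z + \<psi> z) = S \<phi> + S \<psi>"
  by (simp add: distribution_def)

lemma distribution_scale:
  "distribution S \<Longrightarrow> \<phi> \<in> test_functions \<Longrightarrow> S (\<lambda>z. c * \<phi> z) = c * S \<phi>"
  by (simp add: distribution_def)

lemma distribution_zero: "distribution S \<Longrightarrow> S (\<lambda>z. 0) = 0"
  using distribution_scale[of S "\<lambda>z. 1" 0] by simp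

lemma distribution_diff:
  "distribution S \<Longrightarrow> \<phi> \<in> test_functions \<Longrightarrow> \<psi> \<in> test_functions \<Longrightarrow> S (\<lambda>z. \<phi> z - \<psi> z) = S \<phi> - S \<psi>"
  using distribution_add[of S \<phi> "\<lambda>z. -1 * \<psi> z"] distribution_scale[of S \<psi> "-1"]
    test_functions_mult[of "\<lambda>z. -1" \<psi>] by simp

lemma distribution_sum:
  assumes "distribution S" "\<And>i. i \<in> A \<Longrightarrow> \<phi> i \<in> test_functions"
  shows "S (\<lambda>z. \<Sum>i\<in>A. \<phi> i z) = (\<Sum>i\<in>A. S (\<phi> i))"
  using assms(2)
proof (induction A rule: infinite_finite_induct)
  case (insert a A)
  then show ?case using distribution_add[OF assms(1), of "\<phi> a"]
    by (simp add: test_functions_sum)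
qed (use distribution_zero[OF assms(1)] in auto)

lemma distribution_cong:
  assumes "distribution S" "\<phi> \<in> test_functions" "\<psi> \<in> test_functions" "\<And>z. z \<in> circle \<Longrightarrow> \<phi> z = \<psi> z"
  shows "S \<phi> = S \<psi>"
proof -
  obtain C N where *: "\<And>\<phi>. \<phi> \<in> test_functions \<Longrightarrow>
    norm (S \<phi>) \<le> C * (\<Sum>k\<le>N. SUP t. norm (circle_deriv k \<phi> t))"
    using assms(1) unfolding distribution_def by blast
  define \<eta> where "\<eta> = (\<lambda>z. \<phi> z - \<psi> z)"
  have "circle_deriv k \<eta> = (\<lambda>t. 0)" for k
  proof (induction k)
    case 0
    then show ?case using assms(4) by (auto simp: circle_deriv_def \<eta>_def)
  next
    case (Suc k)
    have "circle_deriv (Suc k) \<eta> = (\<lambda>t. vector_derivative (circle_deriv k \<eta>) (at t))"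
      by (simp add: circle_deriv_def)
    then show ?case by (simp add: Suc)
  qed
  then have "S \<eta> = 0" using *[of \<eta>] test_functions_diff[OF assms(2,3)] by (simp add: \<eta>_def)
  then show ?thesis using distribution_diff[OF assms(1-3)] by (simp add: \<eta>_def)
qed

text \<open>On the circle \<bar>z - a\<bar>^2 = 2 - cnj(a) z - a z^(-1), so 1 - \<bar>z - a\<bar>^2
  / d^2 is a trigonometric polynomial, and its composition with the cutoff is a test function. The
  cutoff is 1 as soon as \<bar>z - a\<bar>^2 \<le> d^2/2, which the radius d/2 ensures.\<close>

lemma bump_function:
  assumes "0 < d" "a \<in> circle"
  obtains \<eta> where "\<eta> \<in> test_functions" "\<And>z. z \<in> circle \<Longrightarrow> dist z a < d / 2 \<Longrightarrow> \<eta> z = 1"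
    "\<And>z. z \<in> circle \<Longrightarrow> d \<le> dist z a \<Longrightarrow> \<eta> z = 0"
proof -
  obtain F :: "real \<Rightarrow> real" where F: "\<And>k. n_differentiable k F" "\<And>t. t \<le> 0 \<Longrightarrow> F t = 0"
    "\<And>t. 1/2 \<le> t \<Longrightarrow> F t = 1" using smooth_cutoff by metis
  define \<phi> where "\<phi> = (\<lambda>z. 1 - (2 + (- cnj a * z powi 1 + - a * z powi (-1))) / of_real (d\<^sup>2))"
  have \<phi>: "\<phi> \<in> test_functions"
    unfolding \<phi>_def divide_inverse
    by (intro test_functions_diff test_functions_add test_functions_mult test_functions_const test_functions_powi)
  have eq: "Re (\<phi> z) = 1 - (dist z a)\<^sup>2 / d\<^sup>2" if "z \<in> circle" for z
  proof -
    have "inverse z = cnj z" using that by (simp add: inverse_eq_divide divide_conv_cnj)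
    moreover have "(dist z a)\<^sup>2 = (cmod z)\<^sup>2 + (cmod a)\<^sup>2 - 2 * Re (z * cnj a)"
      unfolding dist_norm cmod_power2 by (simp add: power2_eq_square algebra_simps)
    ultimately show ?thesis using that assms
      by (simp add: \<phi>_def power_int_minus algebra_simps flip: of_real_power)
  qed
  show ?thesis
  proof (rule that[OF test_functions_compose[OF F(1) \<phi>]])
    fix z assume z: "z \<in> circle" "dist z a < d / 2"
    have "(dist z a)\<^sup>2 \<le> (d/2)\<^sup>2" using z by (intro power_mono) auto
    moreover have "(d/2)\<^sup>2 = d\<^sup>2 / 4" by (simp add: power_divide)
    ultimately have "2 * (dist z a)\<^sup>2 \<le> d\<^sup>2" using zero_le_power2[of "dist z a"] by linarith
    then have "(dist z a)\<^sup>2 / d\<^sup>2 \<le> 1/2" using assms by (simp add: field_simps)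
    then show "complex_of_real (F (Re (\<phi> z))) = 1" using F(3) eq z by simp
  next
    fix z assume z: "z \<in> circle" "d \<le> dist z a"
    have "d\<^sup>2 \<le> (dist z a)\<^sup>2" using z assms by (intro power_mono) auto
    then have "1 \<le> (dist z a)\<^sup>2 / d\<^sup>2" using assms by (simp add: field_simps)
    then show "complex_of_real (F (Re (\<phi> z))) = 0" using F(2) eq z by simp
  qed
qed

text \<open>The cutoffs \<open>\<eta>\<^sub>a\<close> of a finite cover give \<open>\<phi> \<Prod>(1 - \<eta>\<^sub>a) = 0\<close>, and passing from \<open>\<phi>\<close> to
  \<open>\<phi> (1 - \<eta>\<^sub>a)\<close> does not change \<open>S \<phi>\<close>.\<close>

lemma distribution_eq_0_off_support:
  assumes S: "distribution S" and E: "distribution_support S \<subseteq> E"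
    and \<phi>: "\<phi> \<in> test_functions" "function_support \<phi> \<inter> E = {}"
  shows "S \<phi> = 0"
proof -
  let ?K = "function_support \<phi>"
  have K: "compact ?K" "?K \<subseteq> circle"
  proof -
    have *: "{z \<in> circle. \<phi> z \<noteq> 0} \<subseteq> circle" by auto
    then show "?K \<subseteq> circle" unfolding function_support_def by (rule closure_minimal) auto
    then show "compact ?K"
      by (auto simp: function_support_def compact_eq_bounded_closed
          intro: bounded_subset[OF compact_imp_bounded[OF compact_sphere]])
  qed
  have "\<exists>d>0. \<forall>\<psi>\<in>test_functions. function_support \<psi> \<subseteq> cball a d \<longrightarrow> S \<psi> = 0" if "a \<in> ?K" for a
  proof -
    have "a \<notin> distribution_support S" "a \<in> circle" using that \<phi>(2) E K by auto
    then obtain U where U: "open U" "a \<in> U" "\<forall>\<psi>\<in>test_functions. function_support \<psi> \<subseteq> U \<longrightarrow> S \<psi> = 0"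
      by (auto simp: distribution_support_def)
    then obtain d where "d > 0" "cball a d \<subseteq> U" by (auto simp: open_contains_cball)
    then show ?thesis using U by blast
  qed
  then obtain d where d: "\<And>a. a \<in> ?K \<Longrightarrow> 0 < d a"
    "\<And>a \<psi>. a \<in> ?K \<Longrightarrow> \<psi> \<in> test_functions \<Longrightarrow> function_support \<psi> \<subseteq> cball a (d a) \<Longrightarrow> S \<psi> = 0"
    by metis
  have "\<exists>\<eta>\<in>test_functions. (\<forall>z\<in>circle. dist z a < d a / 2 \<longrightarrow> \<eta> z = 1) \<and>
     (\<forall>z\<in>circle. d a \<le> dist z a \<longrightarrow> \<eta> z = 0)" if "a \<in> ?K" for a
    using bump_function[of "d a" a] d(1) that K by (metis subsetD)
  then obtain \<eta> where \<eta>: "\<And>a. a \<in> ?K \<Longrightarrow> \<eta> a \<in> test_functions"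
    "\<And>a z. a \<in> ?K \<Longrightarrow> z \<in> circle \<Longrightarrow> dist z a < d a / 2 \<Longrightarrow> \<eta> a z = 1"
    "\<And>a z. a \<in> ?K \<Longrightarrow> z \<in> circle \<Longrightarrow> d a \<le> dist z a \<Longrightarrow> \<eta> a z = 0"
    by metis
  obtain A where A: "A \<subseteq> ?K" "finite A" "?K \<subseteq> (\<Union>a\<in>A. ball a (d a / 2))"
    using compactE_image[OF K(1), of ?K "\<lambda>a. ball a (d a / 2)"] d(1) by force
  define R where "R = (\<lambda>B z. \<phi> z * (\<Prod>a\<in>B. 1 - \<eta> a z))"
  have "R B \<in> test_functions \<and> S (R B) = S \<phi>" if "B \<subseteq> A" for B
    using finite_subset[OF that A(2)] that
  proof (induction B rule: finite_induct)
    case empty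
    then show ?case using \<phi> by (simp add: R_def)
  next
    case (insert a B)
    then have a: "a \<in> ?K" and IH: "R B \<in> test_functions" "S (R B) = S \<phi>" using A by auto
    have t: "(\<lambda>z. R B z * \<eta> a z) \<in> test_functions"
      by (intro test_functions_mult IH \<eta> a)
    have eq: "R (insert a B) = (\<lambda>z. R B z - R B z * \<eta> a z)"
      using insert by (auto simp: R_def algebra_simps)
    have "{z \<in> circle. R B z * \<eta> a z \<noteq> 0} \<subseteq> cball a (d a)"
      using \<eta>(3)[OF a] by (force simp: dist_commute)
    then have "function_support (\<lambda>z. R B z * \<eta> a z) \<subseteq> cball a (d a)"
      unfolding function_support_def by (rule closure_minimal) auto
    then have "S (\<lambda>z. R B z * \<eta> a z) = 0" using d(2) a t by blast
    then show ?case unfolding eq using distribution_diff[OF S IH(1) t] IH(2) test_functions_diff[OF IH(1) t] by simp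
  qed
  from this[of A] have 1: "R A \<in> test_functions" "S (R A) = S \<phi>" by auto
  have "R A z = 0" if z: "z \<in> circle" for z
  proof (cases "\<phi> z = 0")
    case False
    then have "z \<in> ?K" using z closure_subset by (force simp: function_support_def)
    then obtain a where "a \<in> A" "dist z a < d a / 2" using A(3) by (auto simp: dist_commute)
    then have "a \<in> A" "\<eta> a z = 1" using \<eta>(2) A z by auto
    then show ?thesis using A(2) by (auto simp: R_def prod_zero_iff)
  qed (simp add: R_def)
  then have "S (R A) = S (\<lambda>z. 0)" by (intro distribution_cong[OF S 1(1)]) auto
  then show ?thesis using 1 distribution_zero[OF S] by simp
qed

section \<open>Density of trigonometric polynomials\<close>

text \<open>A sum over an infinite set is 0 by convention, so \<open>trig_poly a\<close> is a test
  function for every \<open>a\<close>.\<close>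

definition trig_poly :: "(int \<Rightarrow> complex) \<Rightarrow> complex \<Rightarrow> complex" where
  "trig_poly a z = (\<Sum>n | a n \<noteq> 0. a n * z powi n)"

definition finite_support :: "(int \<Rightarrow> complex) \<Rightarrow> bool" where
  "finite_support a \<longleftrightarrow> finite {n. a n \<noteq> 0}"

lemma finite_supportI: "finite A \<Longrightarrow> (\<And>n. n \<notin> A \<Longrightarrow> a n = 0) \<Longrightarrow> finite_support a"
  unfolding finite_support_def by (rule finite_subset) auto

lemma trig_poly_eq:
  "finite A \<Longrightarrow> {n. a n \<noteq> 0} \<subseteq> A \<Longrightarrow> trig_poly a z = (\<Sum>n\<in>A. a n * z powi n)"
  unfolding trig_poly_def by (rule sum.mono_neutral_left) auto

lemma trig_poly_test [simp]: "trig_poly a \<in> test_functions"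
proof -
  have "(\<lambda>z. \<Sum>n | a n \<noteq> 0. a n * z powi n) \<in> test_functions"
    by (intro test_functions_sum test_functions_mult test_functions_const test_functions_powi)
  then show ?thesis by (simp add: trig_poly_def[abs_def])
qed

text \<open>Equality is demanded on the circle only, where z^(-1) = cnj z: this turns polynomials in
  Re z and Im z into trigonometric ones, so that the Stone-Weierstrass theorem in the plane
  applies.\<close>

definition on_circle_trig :: "(complex \<Rightarrow> complex) \<Rightarrow> bool" where
  "on_circle_trig f \<longleftrightarrow> (\<exists>a. finite_support a \<and> (\<forall>z\<in>circle. f z = trig_poly a z))"

lemma on_circle_trig_monom: "on_circle_trig (\<lambda>z. c * z powi n)"
  unfolding on_circle_trig_def
proof (intro exI[of _ "\<lambda>m. if m = n then c else 0"] conjI ballI)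
  fix z
  show "c * z powi n = trig_poly (\<lambda>m. if m = n then c else 0) z"
    by (subst trig_poly_eq[of "{n}"]) auto
qed (rule finite_supportI[of "{n}"], auto)

lemma on_circle_trig_add:
  assumes "on_circle_trig f" "on_circle_trig g"
  shows "on_circle_trig (\<lambda>z. f z + g z)"
proof -
  obtain a b where a: "finite_support a" "\<And>z. z \<in> circle \<Longrightarrow> f z = trig_poly a z"
    and b: "finite_support b" "\<And>z. z \<in> circle \<Longrightarrow> g z = trig_poly b z"
    using assms by (auto simp: on_circle_trig_def)
  let ?A = "{n. a n \<noteq> 0} \<union> {n. b n \<noteq> 0}"
  have A: "finite ?A" using a b by (simp add: finite_support_def)
  have "trig_poly a z + trig_poly b z = trig_poly (\<lambda>n. a n + b n) z" for z
    using A by (subst (1 2 3) trig_poly_eq[of ?A]) (auto simp: sum.distrib[symmetric] distrib_right)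
  moreover have "finite_support (\<lambda>n. a n + b n)" using A by (rule finite_supportI) auto
  ultimately show ?thesis using a b unfolding on_circle_trig_def by metis
qed

lemma on_circle_trig_cong:
  "on_circle_trig f \<Longrightarrow> (\<And>z. z \<in> circle \<Longrightarrow> g z = f z) \<Longrightarrow> on_circle_trig g"
  by (auto simp: on_circle_trig_def)

lemma on_circle_trig_const: "on_circle_trig (\<lambda>z. c)"
  using on_circle_trig_monom[of c 0] by simp

lemma on_circle_trig_sum:
  "(\<And>i. i \<in> A \<Longrightarrow> on_circle_trig (f i)) \<Longrightarrow> on_circle_trig (\<lambda>z. \<Sum>i\<in>A. f i z)"
  by (induction A rule: infinite_finite_induct) (auto intro: on_circle_trig_add on_circle_trig_const)

lemma on_circle_trig_mult:
  assumes "on_circle_trig f" "on_circle_trig g"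
  shows "on_circle_trig (\<lambda>z. f z * g z)"
proof -
  obtain a b where a: "finite_support a" "\<And>z. z \<in> circle \<Longrightarrow> f z = trig_poly a z"
    and b: "finite_support b" "\<And>z. z \<in> circle \<Longrightarrow> g z = trig_poly b z"
    using assms by (auto simp: on_circle_trig_def)
  have "on_circle_trig (\<lambda>z. \<Sum>n | a n \<noteq> 0. \<Sum>m | b m \<noteq> 0. (a n * b m) * z powi (n + m))"
    by (intro on_circle_trig_sum on_circle_trig_monom)
  moreover have "f z * g z = (\<Sum>n | a n \<noteq> 0. \<Sum>m | b m \<noteq> 0. (a n * b m) * z powi (n + m))"
    if "z \<in> circle" for z
  proof -
    have "z \<noteq> 0" using that by auto
    then show ?thesis
      unfolding a(2)[OF that] b(2)[OF that] trig_poly_def sum_product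
      by (simp add: power_int_add mult_ac)
  qed
  ultimately show ?thesis by (rule on_circle_trig_cong)
qed

lemma on_circle_trig_Re_Im: "on_circle_trig (\<lambda>z. of_real (Re z))" "on_circle_trig (\<lambda>z. of_real (Im z))"
proof -
  have inv: "inverse z = cnj z" if "z \<in> circle" for z
    using that by (simp add: inverse_eq_divide divide_conv_cnj)
  show "on_circle_trig (\<lambda>z. of_real (Re z))"
    by (rule on_circle_trig_cong[OF on_circle_trig_add[OF on_circle_trig_monom[of "1/2" 1] on_circle_trig_monom[of "1/2" "-1"]]])
       (simp add: power_int_minus inv complex_eq_iff)
  show "on_circle_trig (\<lambda>z. of_real (Im z))"
    by (rule on_circle_trig_cong[OF on_circle_trig_add[OF on_circle_trig_monom[of "-\<i>/2" 1] on_circle_trig_monom[of "\<i>/2" "-1"]]])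
       (simp add: power_int_minus inv complex_eq_iff)
qed

lemma on_circle_trig_real_polynomial:
  "real_polynomial_function f \<Longrightarrow> on_circle_trig (\<lambda>z. of_real (f z))"
proof (induction f rule: real_polynomial_function.induct)
  case (linear f)
  have "f z = Re z * f 1 + Im z * f \<i>" for z
  proof -
    have "z = Re z *\<^sub>R 1 + Im z *\<^sub>R \<i>" by (simp add: complex_eq_iff)
    then have "f z = f (Re z *\<^sub>R 1 + Im z *\<^sub>R \<i>)" by simp
    also have "\<dots> = Re z * f 1 + Im z * f \<i>"
      using linear_add[OF bounded_linear.linear[OF linear]] linear_scale[OF bounded_linear.linear[OF linear]]
      by simp
    finally show ?thesis .
  qed
  then have "(\<lambda>z. complex_of_real (f z)) = (\<lambda>z. of_real (Re z) * of_real (f 1) + of_real (Im z) * of_real (f \<i>))"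
    by (metis of_real_add of_real_mult)
  then show ?case
    by (simp add: on_circle_trig_add on_circle_trig_mult on_circle_trig_Re_Im on_circle_trig_const)
qed (auto intro: on_circle_trig_const on_circle_trig_add on_circle_trig_mult)

lemma trig_poly_approx:
  assumes "continuous_on circle f" "0 < e"
  obtains a where "finite_support a" "\<And>z. z \<in> circle \<Longrightarrow> norm (f z - trig_poly a z) < e"
proof -
  obtain g where g: "polynomial_function g" "\<And>z. z \<in> circle \<Longrightarrow> norm (f z - g z) < e"
    using Stone_Weierstrass_polynomial_function[OF compact_sphere assms] by blast
  have "on_circle_trig (\<lambda>z. of_real (Re (g z)) + \<i> * of_real (Im (g z)))"
    using g(1) bounded_linear_Re bounded_linear_Im unfolding polynomial_function_def o_def
    by (intro on_circle_trig_add on_circle_trig_mult on_circle_trig_const on_circle_trig_real_polynomial) auto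
  then have "on_circle_trig g" by (simp flip: complex_eq)
  then show ?thesis using g(2) that by (auto simp: on_circle_trig_def)
qed

text \<open>\<open>Arg\<close> jumps across the negative axis, so the angle of \<open>w\<close> near
  \<open>z\<close> is written as Arg z + Arg(w/z), where w/z is close to 1 and \<open>Arg\<close> is
  continuous.\<close>

lemma continuous_on_circleI:
  assumes "continuous_on UNIV (g :: real \<Rightarrow> complex)" "\<And>t. h (cis t) = g t"
  shows "continuous_on circle h"
  unfolding continuous_on_eq_continuous_within
proof
  fix z assume z: "z \<in> circle"
  then have "z \<noteq> 0" by auto
  then have z_cis: "z = cis (Arg z)" using cis_Arg[of z] z by (auto simp: sgn_eq)
  have "isCont (\<lambda>w. g (Arg z + Arg (w / z))) z"
  proof -
    have "isCont (\<lambda>w. w / z) z" using \<open>z \<noteq> 0\<close> by (intro continuous_intros) auto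
    moreover have "isCont Arg (z / z)"
      using \<open>z \<noteq> 0\<close> by (intro continuous_at_Arg) (auto simp: complex_nonpos_Reals_iff)
    ultimately have "isCont (\<lambda>w. Arg (w / z)) z"
      by (rule isCont_o2[of z "\<lambda>w. w / z" Arg])
    then have "isCont (\<lambda>w. Arg z + Arg (w / z)) z" by (intro continuous_intros)
    moreover have "isCont g (Arg z + Arg (z / z))"
      using assms(1) by (simp add: continuous_on_eq_continuous_at)
    ultimately show ?thesis by (rule isCont_o2[of z "\<lambda>w. Arg z + Arg (w / z)" g])
  qed
  then have "continuous (at z within circle) (\<lambda>w. g (Arg z + Arg (w / z)))"
    by (rule continuous_at_imp_continuous_at_within)
  moreover have "g (Arg z + Arg (w / z)) = h w" if "w \<in> circle" for w
  proof -
    have "w \<noteq> 0" using that by auto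
    then have "cis (Arg (w / z)) = w / z"
      using that z \<open>z \<noteq> 0\<close> cis_Arg[of "w / z"] by (simp add: sgn_eq norm_divide)
    then have "cis (Arg z + Arg (w / z)) = z * (w / z)"
      using z_cis by (simp flip: cis_mult)
    also have "\<dots> = w" using \<open>z \<noteq> 0\<close> by simp
    finally show ?thesis using assms(2)[of "Arg z + Arg (w / z)"] by simp
  qed
  ultimately show "continuous (at z within circle) h"
    by (rule continuous_transform_within[OF _ zero_less_one z]) auto
qed

section \<open>Approximation together with finitely many derivatives\<close>

lemma periodic_int:
  assumes "\<And>t. g (t + 2 * pi) = (g t :: 'a)"
  shows "g (t + 2 * pi * of_int m) = g t"
proof -
  have n: "g (t + 2 * pi * of_nat n) = g t" for n t
    by (induction n) (use assms[of "t + 2 * pi * of_nat _"] in \<open>auto simp: algebra_simps\<close>)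
  show ?thesis
    using n[of t "nat m"] n[of "t + 2 * pi * of_int m" "nat (- m)"] by (cases "0 \<le> m") auto
qed

lemma norm_diff_le_of_vector_derivative:
  fixes f :: "real \<Rightarrow> complex"
  assumes "\<And>t. (f has_vector_derivative f' t) (at t)" "\<And>t. norm (f' t) \<le> B"
  shows "norm (f s - f t) \<le> B * \<bar>s - t\<bar>"
proof -
  have "onorm (\<lambda>h. h *\<^sub>R f' x) \<le> B" for x
    using assms(2)[of x] onorm_le[of "\<lambda>h. h *\<^sub>R f' x" "norm (f' x)"] by (simp add: mult.commute)
  then show ?thesis
    using differentiable_bound[of UNIV f "\<lambda>x h. h *\<^sub>R f' x" B s t] assms(1)
    by (auto simp: has_vector_derivative_def)
qed

lemma has_vector_derivative_trig_sum:
  "((\<lambda>t. \<Sum>n\<in>A. c n * cis (of_int n * t)) has_vector_derivative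
    (\<Sum>n\<in>A. \<i> * of_int n * c n * cis (of_int n * t))) (at t)"
proof (rule has_vector_derivative_sum)
  fix n
  show "((\<lambda>t. c n * cis (of_int n * t)) has_vector_derivative \<i> * of_int n * c n * cis (of_int n * t)) (at t)"
    using has_vector_derivative_mult_right[OF has_vector_derivative_cis_mult[of "of_int n" t], of "c n"]
    by (simp add: mult_ac)
qed

text \<open>The top derivative is approximated by the Weierstrass theorem, and the approximation is then
  integrated repeatedly; the mean of the approximating polynomial is small by periodicity and is
  dropped before each integration.\<close>

lemma trig_approx_derivatives:
  fixes g :: "nat \<Rightarrow> real \<Rightarrow> complex"
  assumes "\<And>k t. (g k has_vector_derivative g (Suc k) t) (at t)"
    and "\<And>k t. g k (t + 2 * pi) = g k t" and "0 < e"
  shows "\<exists>a. finite_support a \<and>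
    (\<forall>k\<le>N. \<forall>t. norm (g k t - (\<Sum>n | a n \<noteq> 0. (\<i> * of_int n) ^ k * a n * cis (of_int n * t))) \<le> e)"
  using assms
proof (induction N arbitrary: g e)
  case 0
  have "g 0 (Arg (cis t)) = g 0 t" for t
  proof -
    have "cis (Arg (cis t)) = cis t" using cis_Arg[of "cis t"] by (auto simp: sgn_eq)
    then obtain m :: int where "Arg (cis t) = t + 2 * pi * m"
      using sin_cos_eq_iff[of "Arg (cis t)" t] by (auto simp: complex_eq_iff)
    then show ?thesis using periodic_int[of "g 0"] 0(2) by simp
  qed
  moreover have "continuous_on UNIV (g 0)"
    using 0(1)[of 0] by (auto intro!: continuous_at_imp_continuous_on has_vector_derivative_continuous)
  ultimately have "continuous_on circle (\<lambda>z. g 0 (Arg z))" by (intro continuous_on_circleI)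
  from trig_poly_approx[OF this 0(3)] obtain a where a: "finite_support a"
    "\<And>z. z \<in> circle \<Longrightarrow> norm (g 0 (Arg z) - trig_poly a z) < e" by auto
  have "norm (g 0 t - (\<Sum>n | a n \<noteq> 0. a n * cis (of_int n * t))) \<le> e" for t
    using a(2)[of "cis t"] \<open>\<And>t. g 0 (Arg (cis t)) = g 0 t\<close>[of t] by (simp add: trig_poly_def cis_power_int)
  then show ?case using a(1) by (intro exI[of _ a]) auto
next
  case (Suc N)
  \<comment> \<open>The error of order zero will be at most 2 d times the period 2 pi, and 2 pi <
    8.\<close>
  define d where "d = e / 16"
  have d: "0 < d" using Suc.prems by (simp add: d_def)
  obtain b where b: "finite_support b"
    "\<And>k t. k \<le> N \<Longrightarrow> norm (g (Suc k) t - (\<Sum>n | b n \<noteq> 0. (\<i> * of_int n) ^ k * b n * cis (of_int n * t))) \<le> d"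
    using Suc.IH[of "\<lambda>k. g (Suc k)" d] Suc.prems d by auto
  define B where "B = {n. b n \<noteq> 0} - {0}"
  have B: "finite B" using b(1) by (simp add: B_def finite_support_def)
  have split: "(\<Sum>n | b n \<noteq> 0. (\<i> * of_int n) ^ k * b n * cis (of_int n * t)) =
      (if k = 0 then b 0 else 0) + (\<Sum>n\<in>B. (\<i> * of_int n) ^ k * b n * cis (of_int n * t))" for k t
    using b(1) sum.remove[of "{n. b n \<noteq> 0}" 0 "\<lambda>n. (\<i> * of_int n) ^ k * b n * cis (of_int n * t)"]
    by (cases "b 0 = 0") (auto simp: B_def finite_support_def)
  define P where "P = (\<lambda>t. \<Sum>n\<in>B. (b n / (\<i> * of_int n)) * cis (of_int n * t))"
  define H where "H = (\<lambda>t. g 0 t - P t)"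
  have P': "(P has_vector_derivative (\<Sum>n\<in>B. b n * cis (of_int n * t))) (at t)" for t
  proof -
    have "(\<Sum>n\<in>B. \<i> * of_int n * (b n / (\<i> * of_int n)) * cis (of_int n * t)) = (\<Sum>n\<in>B. b n * cis (of_int n * t))"
      by (rule sum.cong) (auto simp: B_def)
    then show ?thesis using has_vector_derivative_trig_sum[of "\<lambda>n. b n / (\<i> * of_int n)" B t] by (simp add: P_def)
  qed
  have Pper: "P (t + 2 * pi) = P t" for t
  proof -
    have "cis (of_int n * (t + 2 * pi)) = cis (of_int n * t)" for n
      by (simp add: distrib_left flip: cis_mult) (metis cis_multiple_2pi Ints_of_int mult.commute mult.assoc mult_1_right)
    then show ?thesis by (simp add: P_def)
  qed
  have Hper: "H (t + 2 * pi) = H t" for t using Pper Suc.prems(2) by (simp add: H_def)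
  have H': "(H has_vector_derivative (g 1 t - (\<Sum>n\<in>B. b n * cis (of_int n * t)))) (at t)" for t
    unfolding H_def using Suc.prems(1)[of 0] P' by (auto intro!: has_vector_derivative_diff)
  have q: "norm (g 1 t - (b 0 + (\<Sum>n\<in>B. b n * cis (of_int n * t)))) \<le> d" for t
    using b(2)[of 0 t] split[of 0 t] by simp
  \<comment> \<open>\<open>H\<close> returns to its value after one period, while its derivative
    stays within \<open>d\<close> of the constant \<open>b 0\<close>; hence \<bar>2 pi b 0\<bar>
    \<le> 2 pi d.\<close>
  have b0: "norm (b 0) \<le> d"
  proof -
    have "((\<lambda>t. H t - t *\<^sub>R b 0) has_vector_derivative
        (g 1 t - (\<Sum>n\<in>B. b n * cis (of_int n * t))) - b 0) (at t)" for t
      by (intro has_vector_derivative_diff H')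
         (auto simp: has_vector_derivative_def intro!: derivative_eq_intros)
    moreover have "norm ((g 1 t - (\<Sum>n\<in>B. b n * cis (of_int n * t))) - b 0) \<le> d" for t
      using q[of t] by (simp add: algebra_simps)
    ultimately have "norm ((H (2 * pi) - (2 * pi) *\<^sub>R b 0) - (H 0 - 0 *\<^sub>R b 0)) \<le> d * \<bar>2 * pi - 0\<bar>"
      by (rule norm_diff_le_of_vector_derivative)
    then show ?thesis using Hper[of 0] by (simp add: norm_mult)
  qed
  have H'le: "norm (g 1 t - (\<Sum>n\<in>B. b n * cis (of_int n * t))) \<le> 2 * d" for t
    using norm_triangle_ineq[of "g 1 t - (b 0 + (\<Sum>n\<in>B. b n * cis (of_int n * t)))" "b 0"] q[of t] b0 by simp
  \<comment> \<open>The constant term matches the value at t = 0: the error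
    \<open>g 0 - (H 0 + P)\<close> is then H minus its value at 0, which vanishes at all multiples
    of 2 pi and has derivative at most 2 d.\<close>
  define a where "a = (\<lambda>n. if n = 0 then H 0 else b n / (\<i> * of_int n))"
  have fin: "finite_support a"
    using B by (intro finite_supportI[of "insert 0 B"]) (auto simp: a_def B_def)
  have a_sum: "(\<Sum>n | a n \<noteq> 0. (\<i> * of_int n) ^ k * a n * cis (of_int n * t)) =
     (\<i> * of_int 0) ^ k * H 0 + (\<Sum>n\<in>B. (\<i> * of_int n) ^ k * (b n / (\<i> * of_int n)) * cis (of_int n * t))" for k t
  proof -
    have "(\<Sum>n | a n \<noteq> 0. (\<i> * of_int n) ^ k * a n * cis (of_int n * t)) =
        (\<Sum>n\<in>insert 0 B. (\<i> * of_int n) ^ k * a n * cis (of_int n * t))"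
      using B by (intro sum.mono_neutral_left) (auto simp: a_def B_def split: if_splits)
    also have "\<dots> = (\<i> * of_int 0) ^ k * H 0 + (\<Sum>n\<in>B. (\<i> * of_int n) ^ k * a n * cis (of_int n * t))"
      using B by (subst sum.insert) (auto simp: a_def B_def)
    also have "(\<Sum>n\<in>B. (\<i> * of_int n) ^ k * a n * cis (of_int n * t)) =
      (\<Sum>n\<in>B. (\<i> * of_int n) ^ k * (b n / (\<i> * of_int n)) * cis (of_int n * t))"
      by (rule sum.cong) (auto simp: a_def B_def)
    finally show ?thesis .
  qed
  have "norm (g k t - (\<Sum>n | a n \<noteq> 0. (\<i> * of_int n) ^ k * a n * cis (of_int n * t))) \<le> e" if "k \<le> Suc N" for k t
  proof (cases k)
    case 0
    define m where "m = \<lfloor>t / (2 * pi)\<rfloor>"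
    have m: "\<bar>t - 2 * pi * of_int m\<bar> \<le> 2 * pi"
    proof -
      have "of_int m \<le> t / (2 * pi)" "t / (2 * pi) < of_int m + 1" unfolding m_def by linarith+
      then have "of_int m * (2 * pi) \<le> t" "t < (of_int m + 1) * (2 * pi)"
        by (simp_all add: pos_le_divide_eq pos_divide_less_eq)
      then show ?thesis by (auto simp: algebra_simps abs_le_iff)
    qed
    have "norm (g 0 t - (H 0 + P t)) = norm (H t - H (0 + 2 * pi * of_int m))"
      unfolding periodic_int[of H, OF Hper] by (simp add: H_def algebra_simps)
    also have "\<dots> \<le> 2 * d * \<bar>t - (0 + 2 * pi * of_int m)\<bar>"
      by (rule norm_diff_le_of_vector_derivative[OF H' H'le])
    also have "\<dots> \<le> 2 * d * (2 * pi)" using m d by (intro mult_left_mono) auto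
    also have "\<dots> \<le> 2 * d * (2 * 4)" using d pi_less_4 by (intro mult_left_mono) auto
    finally have "norm (g 0 t - (H 0 + P t)) \<le> e" by (simp add: d_def)
    then show ?thesis using 0 a_sum[of 0 t] by (simp add: P_def)
  next
    case (Suc j)
    have "(\<Sum>n\<in>B. (\<i> * of_int n) ^ k * (b n / (\<i> * of_int n)) * cis (of_int n * t)) =
       (\<Sum>n\<in>B. (\<i> * of_int n) ^ j * b n * cis (of_int n * t))"
      by (rule sum.cong) (auto simp: B_def Suc)
    then have eq: "g k t - (\<Sum>n | a n \<noteq> 0. (\<i> * of_int n) ^ k * a n * cis (of_int n * t)) =
      (g (Suc j) t - (\<Sum>n | b n \<noteq> 0. (\<i> * of_int n) ^ j * b n * cis (of_int n * t))) + (if j = 0 then b 0 else 0)"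
      unfolding a_sum split by (simp add: Suc)
    have "norm (g k t - (\<Sum>n | a n \<noteq> 0. (\<i> * of_int n) ^ k * a n * cis (of_int n * t))) \<le> d + d"
      unfolding eq using b0 d that Suc by (intro norm_triangle_mono b(2)) auto
    then show ?thesis using Suc.prems(3) by (simp add: d_def)
  qed
  then show ?case using fin by blast
qed

lemma circle_deriv_has_vector_derivative:
  "\<phi> \<in> test_functions \<Longrightarrow> (circle_deriv k \<phi> has_vector_derivative circle_deriv (Suc k) \<phi> t) (at t)"
  by (simp add: test_functions_def circle_deriv_def vector_derivative_works[symmetric])

lemma circle_deriv_periodic:
  assumes "\<phi> \<in> test_functions"
  shows "circle_deriv k \<phi> (t + 2 * pi) = circle_deriv k \<phi> t"
proof (induction k arbitrary: t)
  case 0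
  then show ?case by (simp add: circle_deriv_def flip: cis_mult)
next
  case (Suc k)
  have "((circle_deriv k \<phi> \<circ> (\<lambda>s. s + 2 * pi)) has_vector_derivative 1 *\<^sub>R circle_deriv (Suc k) \<phi> (t + 2 * pi)) (at t)"
    by (rule vector_diff_chain_at)
       (auto intro!: circle_deriv_has_vector_derivative assms derivative_eq_intros
          simp: has_real_derivative_iff_has_vector_derivative[symmetric])
  moreover have "circle_deriv k \<phi> \<circ> (\<lambda>s. s + 2 * pi) = circle_deriv k \<phi>" using Suc by auto
  ultimately show ?case
    using circle_deriv_has_vector_derivative[OF assms, of k t] by (auto dest: vector_derivative_unique_at)
qed

lemma circle_deriv_diff:
  assumes "\<phi> \<in> test_functions" "\<psi> \<in> test_functions"
  shows "circle_deriv k (\<lambda>z. \<phi> z - \<psi> z) = (\<lambda>t. circle_deriv k \<phi> t - circle_deriv k \<psi> t)"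
proof (induction k)
  case (Suc k)
  have "circle_deriv (Suc k) (\<lambda>z. \<phi> z - \<psi> z) t = circle_deriv (Suc k) \<phi> t - circle_deriv (Suc k) \<psi> t" for t
    using has_vector_derivative_diff[OF circle_deriv_has_vector_derivative[OF assms(1), of k t]
        circle_deriv_has_vector_derivative[OF assms(2), of k t]]
      circle_deriv_has_vector_derivative[OF test_functions_diff[OF assms], of k t]
    unfolding Suc by (auto dest: vector_derivative_unique_at)
  then show ?case by auto
qed (simp add: circle_deriv_def)

lemma circle_deriv_trig_poly:
  "circle_deriv k (trig_poly a) = (\<lambda>t. \<Sum>n | a n \<noteq> 0. (\<i> * of_int n) ^ k * a n * cis (of_int n * t))"
proof (induction k)
  case 0
  then show ?case by (simp add: circle_deriv_def trig_poly_def cis_power_int)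
next
  case (Suc k)
  have "circle_deriv (Suc k) (trig_poly a) t = (\<Sum>n | a n \<noteq> 0. (\<i> * of_int n) ^ Suc k * a n * cis (of_int n * t))" for t
    using circle_deriv_has_vector_derivative[OF trig_poly_test[of a], of k t]
      has_vector_derivative_trig_sum[of "\<lambda>n. (\<i> * of_int n) ^ k * a n" "{n. a n \<noteq> 0}" t]
    unfolding Suc by (auto dest: vector_derivative_unique_at simp: mult_ac)
  then show ?case by auto
qed

lemma test_function_approx:
  assumes "\<psi> \<in> test_functions" "0 < e"
  obtains a where "finite_support a"
    "\<And>k t. k \<le> N \<Longrightarrow> norm (circle_deriv k (\<lambda>z. \<psi> z - trig_poly a z) t) \<le> e"
  using trig_approx_derivatives[of "\<lambda>k. circle_deriv k \<psi>" e N] assms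
    circle_deriv_has_vector_derivative circle_deriv_periodic
  by (auto simp: circle_deriv_diff circle_deriv_trig_poly)

section \<open>A Dirichlet kernel for a doubling weight\<close>

lemma norm_cis_minus_1: "(norm (cis x - 1))\<^sup>2 = 2 - 2 * cos x"
proof -
  have "(norm (cis x - 1))\<^sup>2 = (cos x - 1)\<^sup>2 + (sin x)\<^sup>2" by (simp add: cmod_power2)
  also have "\<dots> = 2 - 2 * cos x" using sin_cos_squared_add[of x] by (simp add: power2_eq_square algebra_simps)
  finally show ?thesis .
qed

lemma norm_cis_minus_1_le: "norm (cis x - 1) \<le> \<bar>x\<bar>"
  using norm_diff_le_of_vector_derivative[of cis "\<lambda>t. \<i> * cis t" 1 x 0]
    has_vector_derivative_cis_mult[of 1] by (simp add: norm_mult)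

text \<open>The integral is 2 d - 2 sin(n d)/n \<ge> 2 d - 2/n: an interval of length
  \<open>d\<close> sees the oscillation of frequency \<open>n\<close> once n d \<ge> 2.\<close>

lemma nn_integral_cis_ge:
  assumes "0 < d" "2 \<le> real n * d"
  shows "ennreal d \<le> (\<integral>\<^sup>+x. indicator {0..d} x * ennreal ((norm (cis (real n * x) - 1))\<^sup>2) \<partial>lborel)"
proof -
  have n: "0 < real n" using assms by (cases n) auto
  define G where "G = (\<lambda>x. 2 * x - 2 * sin (real n * x) / real n)"
  have "(\<integral>\<^sup>+x. ennreal ((norm (cis (real n * x) - 1))\<^sup>2) * indicator {0..d} x \<partial>lborel) = G d - G 0"
    by (rule nn_integral_FTC_Icc)
       (use n assms in \<open>auto simp: G_def norm_cis_minus_1 intro!: derivative_eq_intros\<close>)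
  moreover have "d \<le> G d - G 0"
  proof -
    have "2 * sin (real n * d) / real n \<le> 2 / real n"
      using n by (intro divide_right_mono) auto
    also have "\<dots> \<le> d" using assms n by (simp add: field_simps)
    finally show ?thesis by (simp add: G_def)
  qed
  ultimately show ?thesis by (simp add: mult.commute ennreal_leI)
qed

locale doubling_weight =
  fixes w :: "nat \<Rightarrow> real" and \<theta> :: real
  assumes w_pos: "\<And>n. 0 < w n"
    and w_decr: "\<And>n. w (Suc n) \<le> w n"
    and w_doubling: "\<And>n. 1 \<le> n \<Longrightarrow> w n \<le> \<theta> * w (2 * n)"
    and \<theta>_less: "\<theta> < 4"
begin

definition h :: "nat \<Rightarrow> real" where "h n = 1 / w n"

text \<open>Increments of 1/w rather than its values: the scales 2^j up to n must add up to the
  order of h(n). For slowly growing \<open>h\<close> the sum of the values h(2^j) would exceed this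
  by an unbounded factor, whereas increments telescope.\<close>

definition m :: "nat \<Rightarrow> real" where "m j = h (2 ^ Suc j) - h (2 ^ j)"

text \<open>The difference energy \<open>\<integral> ker x \<bar>e\<^sup>i\<^sup>n\<^sup>x - 1\<bar>\<^sup>2 dx\<close> is comparable to \<open>1 / w n\<close>: the scale \<open>2\<^sup>-\<^sup>j\<close>
  contributes \<open>m j\<close> up to constants if \<open>2\<^sup>j \<le> n\<close>, and \<open>m j (n / 2\<^sup>j)\<^sup>2\<close> at most otherwise.\<close>

definition ker :: "real \<Rightarrow> ennreal" where
  "ker x = (\<Sum>j. ennreal (m j * 2 ^ j) * indicator {0..(1/2) ^ j} x)"

lemma \<theta>_pos: "0 < \<theta>"
proof -
  have "0 < \<theta> * w 2" using w_doubling[of 1] w_pos[of 1] by simp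
  then show ?thesis using w_pos[of 2] by (simp add: zero_less_mult_iff)
qed

lemma h_pos: "0 < h n" by (simp add: h_def w_pos)

lemma h_mono: "k \<le> n \<Longrightarrow> h k \<le> h n"
  unfolding h_def using lift_Suc_antimono_le[of w k n] w_decr w_pos
  by (intro divide_left_mono) auto

lemma h_double: "h (2 ^ (i + j)) \<le> \<theta> ^ i * h (2 ^ j)"
proof (induction i)
  case (Suc i)
  have "h (2 ^ (Suc i + j)) \<le> \<theta> * h (2 ^ (i + j))"
    using w_doubling[of "2 ^ (i + j)"] w_pos[of "2 ^ (i + j)"] w_pos[of "2 * 2 ^ (i + j)"]
    by (simp add: h_def field_simps)
  also have "\<dots> \<le> \<theta> * (\<theta> ^ i * h (2 ^ j))" using Suc \<theta>_pos by (intro mult_left_mono) auto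
  finally show ?case by (simp add: mult.assoc)
qed simp

lemma m_nonneg: "0 \<le> m j" unfolding m_def using h_mono[of "2 ^ j" "2 ^ Suc j"] by simp

lemma m_le: "m j \<le> h (2 ^ Suc j)" unfolding m_def using h_pos[of "2 ^ j"] by simp

lemma sum_m: "(\<Sum>j<J. m j) = h (2 ^ J) - h 1"
  unfolding m_def using sum_lessThan_telescope[of "\<lambda>j. h (2 ^ j)" J] by simp

lemma measurable_ker [measurable]: "ker \<in> borel_measurable borel"
  unfolding ker_def[abs_def] by measurable

lemma nn_integral_ker:
  assumes [measurable]: "f \<in> borel_measurable borel"
  shows "(\<integral>\<^sup>+x. ker x * f x \<partial>lborel) =
    (\<Sum>j. ennreal (m j * 2 ^ j) * (\<integral>\<^sup>+x. indicator {0..(1/2) ^ j} x * f x \<partial>lborel))"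
proof -
  have "(\<integral>\<^sup>+x. ker x * f x \<partial>lborel) =
    (\<integral>\<^sup>+x. (\<Sum>j. ennreal (m j * 2 ^ j) * (indicator {0..(1/2) ^ j} x * f x)) \<partial>lborel)"
    by (simp add: ker_def mult.assoc flip: ennreal_suminf_multc)
  also have "\<dots> = (\<Sum>j. \<integral>\<^sup>+x. ennreal (m j * 2 ^ j) * (indicator {0..(1/2) ^ j} x * f x) \<partial>lborel)"
    by (rule nn_integral_suminf) measurable
  finally show ?thesis by (simp add: nn_integral_cmult)
qed

text \<open>With 2^J \<le> N < 2^(J+1), the scales j \<le> J use f \<le> 4 and telescope to 4
  (h(2^(J+1)) - h(1)); the finer ones use f \<le> (N x)^2 and give a geometric series of ratio
  \<theta>/4. These are the two summands of \<open>C\<close>. The function \<open>f\<close> is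
  general because the bound serves for \<bar>e^(inx) - 1\<bar>^2 and, with N = 1, for x^2.\<close>

lemma nn_integral_ker_le:
  obtains C where "0 < C" "\<And>f N. f \<in> borel_measurable borel \<Longrightarrow> 1 \<le> N \<Longrightarrow>
    (\<And>x. x \<in> {0..1} \<Longrightarrow> 0 \<le> f x \<and> f x \<le> 4 \<and> f x \<le> (real N * x)\<^sup>2) \<Longrightarrow>
    (\<integral>\<^sup>+x. ker x * ennreal (f x) \<partial>lborel) \<le> ennreal (C * h N)"
proof
  define C where "C = 4 * \<theta> + \<theta>\<^sup>2 * (1 / (1 - \<theta> / 4))"
  show "0 < C" using \<theta>_pos \<theta>_less by (auto simp: C_def intro!: add_pos_pos)
  fix f N assume f [measurable]: "f \<in> borel_measurable borel" and N: "1 \<le> N"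
    and f_le: "\<And>x. x \<in> {0..1} \<Longrightarrow> 0 \<le> f x \<and> f x \<le> 4 \<and> f x \<le> (real N * x)\<^sup>2"
  define u where "u = (\<lambda>j. m j * min 4 ((real N)\<^sup>2 / 4 ^ j))"
  have term_le: "ennreal (m j * 2 ^ j) * (\<integral>\<^sup>+x. indicator {0..(1/2) ^ j} x * ennreal (f x) \<partial>lborel) \<le> ennreal (u j)" for j
  proof -
    have "f x \<le> min 4 ((real N)\<^sup>2 / 4 ^ j)" if "x \<in> {0..(1/2)^j}" for x
    proof -
      have "x \<in> {0..1}" using that power_le_one[of "1/2::real" j] by auto
      moreover have "(real N * x)\<^sup>2 \<le> (real N * (1/2)^j)\<^sup>2"
        using that by (intro power_mono mult_left_mono) auto
      moreover have "(real N * (1/2)^j)\<^sup>2 = (real N)\<^sup>2 / 4 ^ j"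
      proof -
        have "(2 ^ j)\<^sup>2 = (4::real) ^ j" by (simp add: power2_eq_square flip: power_mult_distrib)
        then show ?thesis by (simp add: power_mult_distrib power_one_over power_divide)
      qed
      ultimately show ?thesis using f_le[of x] by simp
    qed
    then have "(\<integral>\<^sup>+x. indicator {0..(1/2) ^ j} x * ennreal (f x) \<partial>lborel) \<le>
      (\<integral>\<^sup>+x. ennreal (min 4 ((real N)\<^sup>2 / 4 ^ j)) * indicator {0..(1/2::real) ^ j} x \<partial>lborel)"
      by (intro nn_integral_mono) (auto simp: indicator_def intro!: ennreal_leI)
    also have "\<dots> = ennreal (min 4 ((real N)\<^sup>2 / 4 ^ j)) * ennreal ((1/2)^j)"
      by (subst nn_integral_cmult) (auto simp: nn_integral_indicator)
    finally have "ennreal (m j * 2 ^ j) * (\<integral>\<^sup>+x. indicator {0..(1/2) ^ j} x * ennreal (f x) \<partial>lborel) \<le>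
      ennreal (m j * 2 ^ j) * (ennreal (min 4 ((real N)\<^sup>2 / 4 ^ j)) * ennreal ((1/2)^j))"
      by (rule mult_left_mono) auto
    also have "\<dots> = ennreal (u j)"
      using m_nonneg[of j] by (simp add: u_def power_one_over flip: ennreal_mult)
    finally show ?thesis .
  qed
  obtain J where J: "2 ^ J \<le> N" "N < 2 ^ (J + 1)" using ex_power_ivl1[of 2 N] N by auto
  have hJ: "h (2 ^ J) \<le> h N" using J by (intro h_mono)
  have tail: "u (i + (J + 1)) \<le> \<theta>\<^sup>2 * h (2 ^ J) * (\<theta> / 4) ^ i" for i
  proof -
    have "real N \<le> 2 ^ (J + 1)" using J(2) by (metis less_imp_le of_nat_le_iff of_nat_numeral of_nat_power)
    then have "(real N)\<^sup>2 \<le> (2 ^ (J + 1))\<^sup>2" by (intro power_mono) auto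
    also have "\<dots> = 4 ^ (J + 1)" by (simp add: power2_eq_square flip: power_mult_distrib)
    finally have "(real N)\<^sup>2 / 4 ^ (i + (J + 1)) \<le> 4 ^ (J + 1) / 4 ^ (i + (J + 1))" by (intro divide_right_mono) auto
    also have "\<dots> = 1 / 4 ^ i" by (simp add: power_add)
    finally have "min 4 ((real N)\<^sup>2 / 4 ^ (i + (J + 1))) \<le> 1 / 4 ^ i" by simp
    moreover have "m (i + (J + 1)) \<le> \<theta> ^ (i + 2) * h (2 ^ J)"
      using m_le[of "i + (J + 1)"] h_double[of "i + 2" J] by (simp add: add_ac)
    ultimately have "u (i + (J + 1)) \<le> (\<theta> ^ (i + 2) * h (2 ^ J)) * (1 / 4 ^ i)"
      unfolding u_def using h_pos[of "2 ^ J"] \<theta>_pos by (intro mult_mono) auto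
    then show ?thesis by (simp add: power_add power_divide power2_eq_square mult_ac)
  qed
  have u0: "0 \<le> u j" for j using m_nonneg[of j] by (simp add: u_def)
  have geo: "summable (\<lambda>i. \<theta>\<^sup>2 * h (2 ^ J) * (\<theta> / 4) ^ i)"
    using \<theta>_pos \<theta>_less by (intro summable_mult summable_geometric) auto
  have summ': "summable (\<lambda>i. u (i + (J + 1)))"
    using tail u0 by (intro summable_comparison_test'[OF geo, of 0]) auto
  then have summ: "summable u" by (subst (asm) summable_iff_shift)
  have "(\<Sum>j<J+1. u j) \<le> (\<Sum>j<J+1. m j * 4)"
    unfolding u_def using m_nonneg by (intro sum_mono mult_left_mono) auto
  also have "\<dots> = 4 * (h (2 ^ (J + 1)) - h 1)"
    by (subst sum_m[symmetric]) (simp add: sum_distrib_left mult.commute)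
  also have "\<dots> \<le> 4 * (\<theta> * h (2 ^ J))" using h_pos[of 1] h_double[of 1 J] by simp
  finally have "(\<Sum>j<J+1. u j) \<le> 4 * (\<theta> * h (2 ^ J))" .
  moreover have "(\<Sum>i. u (i + (J + 1))) \<le> (\<Sum>i. \<theta>\<^sup>2 * h (2 ^ J) * (\<theta> / 4) ^ i)"
    using tail by (intro suminf_le summ' geo)
  moreover have "(\<Sum>i. \<theta>\<^sup>2 * h (2 ^ J) * (\<theta> / 4) ^ i) = \<theta>\<^sup>2 * h (2 ^ J) * (1 / (1 - \<theta> / 4))"
    using \<theta>_pos \<theta>_less by (subst suminf_mult) (auto simp: suminf_geometric)
  ultimately have "suminf u \<le> C * h (2 ^ J)"
    unfolding suminf_split_initial_segment[OF summ, of "J + 1"] C_def by (simp add: algebra_simps)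
  also have "\<dots> \<le> C * h N" using hJ \<open>0 < C\<close> by simp
  finally have u_le: "suminf u \<le> C * h N" .
  have "(\<integral>\<^sup>+x. ker x * ennreal (f x) \<partial>lborel) \<le> (\<Sum>j. ennreal (u j))"
    unfolding nn_integral_ker[of "\<lambda>x. ennreal (f x)", simplified]
    by (intro suminf_le term_le) auto
  also have "\<dots> = ennreal (suminf u)" by (rule suminf_ennreal_eq[OF u0 summable_sums[OF summ]])
  also have "\<dots> \<le> ennreal (C * h N)" by (rule ennreal_leI[OF u_le])
  finally show "(\<integral>\<^sup>+x. ker x * ennreal (f x) \<partial>lborel) \<le> ennreal (C * h N)" .
qed

definition lam :: "int \<Rightarrow> real" where
  "lam n = enn2real (\<integral>\<^sup>+x. ker x * ennreal ((norm (cis (of_int n * x) - 1))\<^sup>2) \<partial>lborel)"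

lemma lam_nonneg: "0 \<le> lam n" by (simp add: lam_def)

text \<open>The lower bound counts only the scales j < J, where 2^J \<le> \<bar>n\<bar> < 2^(J+1):
  each contributes at least \<open>m j\<close> by \<open>nn_integral_cis_ge\<close>, and one
  doubling leads from h(2^J) to h(\<bar>n\<bar>). The 1 in 1 + lam n absorbs h(1) and the frequency
  0, where \<open>lam\<close> vanishes. The last claim will bound the energy of functions that are
  small together with their derivative.\<close>

lemma ker_comparison:
  obtains C where "0 < C"
    "\<And>n. (\<integral>\<^sup>+x. ker x * ennreal ((norm (cis (of_int n * x) - 1))\<^sup>2) \<partial>lborel) = ennreal (lam n)"
    "\<And>n. (1 + lam n) * w (nat \<bar>n\<bar>) \<le> C" "\<And>n. 1 / w (nat \<bar>n\<bar>) \<le> C * (1 + lam n)"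
    "(\<integral>\<^sup>+x. ker x * ennreal (x\<^sup>2) \<partial>lborel) \<le> ennreal C"
proof -
  define L where "L = (\<lambda>n::int. \<integral>\<^sup>+x. ker x * ennreal ((norm (cis (of_int n * x) - 1))\<^sup>2) \<partial>lborel)"
  obtain C1 where C1: "0 < C1" "\<And>f N. f \<in> borel_measurable borel \<Longrightarrow> 1 \<le> N \<Longrightarrow>
    (\<And>x. x \<in> {0..1} \<Longrightarrow> 0 \<le> f x \<and> f x \<le> 4 \<and> f x \<le> (real N * x)\<^sup>2) \<Longrightarrow>
    (\<integral>\<^sup>+x. ker x * ennreal (f x) \<partial>lborel) \<le> ennreal (C1 * h N)"
    using nn_integral_ker_le by blast
  have L_abs: "L n = L (int (nat \<bar>n\<bar>))" for n
    by (cases "0 \<le> n") (auto simp: L_def norm_cis_minus_1)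
  have L_le: "L n \<le> ennreal (C1 * h (nat \<bar>n\<bar>))" for n
  proof (cases "n = 0")
    case False
    have "2 - 2 * cos y \<le> 4" for y :: real using cos_ge_minus_one[of y] by linarith
    moreover have "(norm (cis y - 1))\<^sup>2 \<le> y\<^sup>2" for y
      using norm_cis_minus_1_le[of y] power_mono[of "norm (cis y - 1)" "\<bar>y\<bar>" 2] by simp
    moreover have "(real (nat \<bar>n\<bar>) * x)\<^sup>2 = (of_int n * x)\<^sup>2" for x
      by (simp add: power_mult_distrib)
    ultimately show ?thesis
      unfolding L_def using False
      by (intro C1(2)) (auto simp: norm_cis_minus_1 simp del: power_mult_distrib)
  qed (simp add: L_def)
  have L_fin: "L n < \<infinity>" for n using L_le[of n] by (auto simp: less_top[symmetric] top_unique intro: le_less_trans)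
  have lam: "L n = ennreal (lam n)" for n using L_fin[of n] by (simp add: lam_def L_def)
  note lam0 = lam_nonneg
  have lam_le: "lam n \<le> C1 * h (nat \<bar>n\<bar>)" for n
    using L_le[of n] C1(1) h_pos[of "nat \<bar>n\<bar>"] unfolding lam by (subst (asm) ennreal_le_iff) auto
  have lam_ge: "h (nat \<bar>n\<bar>) \<le> \<theta> * (h 1 + lam n) \<or> n = 0" for n
  proof (cases "n = 0")
    case False
    define N where "N = nat \<bar>n\<bar>"
    have N: "1 \<le> N" using False by (auto simp: N_def)
    obtain J where J: "2 ^ J \<le> N" "N < 2 ^ (J + 1)" using ex_power_ivl1[of 2 N] N by auto
    have "ennreal (\<Sum>j<J. m j) = (\<Sum>j<J. ennreal (m j))" using m_nonneg by (simp add: sum_ennreal)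
    also have "\<dots> \<le> (\<Sum>j<J. ennreal (m j * 2 ^ j) *
       (\<integral>\<^sup>+x. indicator {0..(1/2) ^ j} x * ennreal ((norm (cis (real N * x) - 1))\<^sup>2) \<partial>lborel))"
    proof (rule sum_mono)
      fix j assume "j \<in> {..<J}"
      then have "(2::nat) ^ Suc j \<le> 2 ^ J" by (intro power_increasing) auto
      then have "2 ^ Suc j \<le> N" using J by linarith
      then have "2 ^ Suc j \<le> real N" by (metis of_nat_le_iff of_nat_numeral of_nat_power)
      then have "2 \<le> real N * (1/2) ^ j" by (simp add: power_one_over field_simps)
      from nn_integral_cis_ge[OF _ this]
      have "ennreal (m j * 2 ^ j) * ennreal ((1/2) ^ j) \<le> ennreal (m j * 2 ^ j) *
       (\<integral>\<^sup>+x. indicator {0..(1/2) ^ j} x * ennreal ((norm (cis (real N * x) - 1))\<^sup>2) \<partial>lborel)"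
        by (intro mult_left_mono) auto
      moreover have "ennreal (m j * 2 ^ j) * ennreal ((1/2) ^ j) = ennreal (m j)"
        using m_nonneg[of j] by (simp add: power_one_over flip: ennreal_mult)
      ultimately show "ennreal (m j) \<le> ennreal (m j * 2 ^ j) *
       (\<integral>\<^sup>+x. indicator {0..(1/2) ^ j} x * ennreal ((norm (cis (real N * x) - 1))\<^sup>2) \<partial>lborel)"
        by simp
    qed
    also have "\<dots> \<le> (\<Sum>j. ennreal (m j * 2 ^ j) *
       (\<integral>\<^sup>+x. indicator {0..(1/2) ^ j} x * ennreal ((norm (cis (real N * x) - 1))\<^sup>2) \<partial>lborel))"
      by (rule sum_le_suminf) auto
    also have "\<dots> = L (int N)"
      unfolding L_def by (subst nn_integral_ker) (auto simp: norm_cis_minus_1)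
    also have "\<dots> = ennreal (lam n)" using L_abs[of n] lam by (simp add: N_def)
    finally have "h (2 ^ J) - h 1 \<le> lam n"
      unfolding sum_m using lam0 by (subst (asm) ennreal_le_iff) auto
    moreover have "h N \<le> h (2 ^ (1 + J))" using J by (intro h_mono) auto
    then have "h N \<le> \<theta> * h (2 ^ J)" using h_double[of 1 J] by simp
    ultimately have "h N \<le> \<theta> * (h 1 + lam n)"
      using \<theta>_pos by (smt (verit) mult_left_mono)
    then show ?thesis by (simp add: N_def)
  qed simp
  have x2: "(\<integral>\<^sup>+x. ker x * ennreal (x\<^sup>2) \<partial>lborel) \<le> ennreal (C1 * h 1)"
  proof (rule C1(2))
    fix x :: real assume "x \<in> {0..1}"
    then show "0 \<le> x\<^sup>2 \<and> x\<^sup>2 \<le> 4 \<and> x\<^sup>2 \<le> (real 1 * x)\<^sup>2" using power_le_one[of x 2] by auto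
  qed auto
  \<comment> \<open>One constant for all claims: w 0 + C1 for the upper bound, \<theta> (h 1 + 1)
    and h 0 for the lower bound at n \<noteq> 0 and n = 0, and C1 * h 1 for x^2.\<close>
  define C where "C = w 0 + C1 + C1 * h 1 + \<theta> * (h 1 + 1) + h 0"
  have nn: "0 < w 0" "0 < C1" "0 < C1 * h 1" "0 < \<theta> * (h 1 + 1)" "0 < h 0"
    using w_pos[of 0] C1(1) h_pos[of 0] h_pos[of 1] \<theta>_pos by (auto intro: mult_pos_pos add_pos_pos)
  show ?thesis
  proof (rule that[of C])
    show "0 < C" using nn by (simp add: C_def)
    fix n
    show "(\<integral>\<^sup>+x. ker x * ennreal ((norm (cis (of_int n * x) - 1))\<^sup>2) \<partial>lborel) = ennreal (lam n)"
      using lam by (simp add: L_def)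
    have "lam n * w (nat \<bar>n\<bar>) \<le> C1"
      using lam_le[of n] w_pos[of "nat \<bar>n\<bar>"] by (simp add: h_def field_simps)
    moreover have "w (nat \<bar>n\<bar>) \<le> w 0" using lift_Suc_antimono_le[of w 0] w_decr by auto
    ultimately show "(1 + lam n) * w (nat \<bar>n\<bar>) \<le> C" using nn by (simp add: C_def algebra_simps)
    show "1 / w (nat \<bar>n\<bar>) \<le> C * (1 + lam n)"
    proof (cases "n = 0")
      case True
      have "h 0 * 1 \<le> C * (1 + lam n)" using nn lam0[of n] by (intro mult_mono) (auto simp: C_def)
      then show ?thesis using True by (simp add: h_def)
    next
      case False
      have "\<theta> * (h 1 + lam n) \<le> \<theta> * ((h 1 + 1) * (1 + lam n))"
        using \<theta>_pos h_pos[of 1] lam0[of n] by (intro mult_left_mono) (auto simp: algebra_simps)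
      also have "\<dots> \<le> C * (1 + lam n)"
        unfolding mult.assoc[symmetric] using nn lam0[of n] by (intro mult_right_mono) (auto simp: C_def)
      finally show ?thesis using lam_ge[of n] False by (simp add: h_def)
    qed
    have "ennreal (C1 * h 1) \<le> ennreal C" using nn by (intro ennreal_leI) (simp add: C_def)
    then show "(\<integral>\<^sup>+x. ker x * ennreal (x\<^sup>2) \<partial>lborel) \<le> ennreal C" using x2 by (rule order_trans[rotated])
  qed
qed

end

section \<open>Moment sequences are doubling weights\<close>

lemma doubling_weight_moment:
  assumes "weight W" "cond_C2 W" "cond_C3 W"
  obtains \<theta> where "doubling_weight (moment W) \<theta>"
proof -
  have W0: "\<And>t. t \<in> {0<..1} \<Longrightarrow> 0 \<le> W t" and int: "set_integrable lborel {0<..1} W"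
    using assms(1) by (auto simp: weight_def)
  obtain c where c: "0 < c" "c < 2" "\<And>t. t \<in> {0<..<1} \<Longrightarrow> W t \<le> c * W (t / 2)"
    using assms(3) by (auto simp: cond_C3_def)
  \<comment> \<open>Extension by 0 lets the substitutions r = 1 - t and t = 2 s be made over the
    whole line.\<close>
  define V where "V = (\<lambda>t. indicator {0<..1} t * W t)"
  have V: "integrable lborel V" and V0: "0 \<le> V t" for t
    using int W0 by (auto simp: V_def set_integrable_def indicator_def)
  have Vm [measurable]: "V \<in> borel_measurable borel" using V by auto
  have int1: "integrable lborel (\<lambda>t. (1 - t) ^ n * V t)" for n
  proof (rule Bochner_Integration.integrable_bound[OF V])
    show "AE t in lborel. norm ((1 - t) ^ n * V t) \<le> norm (V t)"
      by (auto simp: V_def indicator_def abs_mult power_le_one intro!: mult_left_le_one_le)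
  qed simp
  have eq: "moment W n = (LINT t|lborel. (1 - t) ^ n * V t)" for n
  proof -
    have "moment W n = (LINT r|lborel. indicator {0..<1} r *\<^sub>R (r ^ n * W (1 - r)))"
      by (simp add: moment_def set_lebesgue_integral_def)
    also have "\<dots> = (LINT t|lborel. indicator {0..<1} (1 - t) *\<^sub>R ((1 - t) ^ n * W (1 - (1 - t))))"
      using lborel_integral_real_affine[of "-1" "\<lambda>r. indicator {0..<1} r *\<^sub>R (r ^ n * W (1 - r))" 1] by simp
    also have "\<dots> = (LINT t|lborel. (1 - t) ^ n * V t)"
      by (rule Bochner_Integration.integral_cong) (auto simp: V_def indicator_def)
    finally show ?thesis .
  qed
  have nonneg: "0 \<le> (1 - t) ^ n * V t" for n t
    using V0[of t] by (cases "t \<in> {0<..1}") (auto simp: V_def)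
  have pos: "0 < moment W n" for n
  proof (rule ccontr)
    assume "\<not> 0 < moment W n"
    moreover have "0 \<le> moment W n" unfolding eq using nonneg by (rule Bochner_Integration.integral_nonneg)
    ultimately have "(LINT t|lborel. (1 - t) ^ n * V t) = 0" by (simp add: eq)
    \<comment> \<open>The factor (1 - t)^n has at most the zero t = 1, so \<open>W\<close> would
      vanish almost everywhere on (0,1] and the integral in \<open>cond_C2\<close> would be
      0.\<close>
    then have "AE t in lborel. (1 - t) ^ n * V t = 0"
      using integral_nonneg_eq_0_iff_AE[OF int1[of n]] nonneg by auto
    moreover have "AE t in lborel. t \<noteq> (1::real)" by (rule AE_lborel_singleton)
    ultimately have "AE t in lborel. ennreal (W t / t) * indicator {0<..1} t = 0"
      by eventually_elim (auto simp: V_def indicator_def)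
    then have "(\<integral>\<^sup>+t\<in>{0<..1}. ennreal (W t / t) \<partial>lborel) = (\<integral>\<^sup>+t. 0 \<partial>(lborel :: real measure))"
      by (rule nn_integral_cong_AE)
    then show False using assms(2) by (simp add: cond_C2_def)
  qed
  have decr: "moment W (Suc n) \<le> moment W n" for n
    unfolding eq
  proof (rule integral_mono[OF int1 int1])
    fix t
    show "(1 - t) ^ Suc n * V t \<le> (1 - t) ^ n * V t"
      using nonneg[of t n] by (auto simp: V_def indicator_def mult.assoc intro!: mult_left_le_one_le)
  qed
  have dbl: "moment W n \<le> (2 * c) * moment W (2 * n)" if n: "1 \<le> n" for n
  proof -
    \<comment> \<open>What becomes of the n-th moment's integrand under t = 2 s and
      \<open>cond_C3\<close>, up to the factor c. On (0, 1/2] the number 1 - 2 s is nonnegative, so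
      its n-th power is below (1 - s)^(2 n). The substitution contributes the 2 in 2 c.\<close>
    define g where "g = (\<lambda>s. indicator {0<..1/2} s * ((1 - 2 * s) ^ n * V s))"
    have g_le: "g s \<le> (1 - s) ^ (2 * n) * V s" "0 \<le> g s" for s
    proof -
      have "(1 - 2 * s) ^ n \<le> ((1 - s)\<^sup>2) ^ n" if "s \<le> 1/2"
        using that by (intro power_mono) (auto simp: power2_eq_square algebra_simps)
      then show "g s \<le> (1 - s) ^ (2 * n) * V s"
        using V0[of s] nonneg[of s "2 * n"]
        by (auto simp: g_def indicator_def power_mult intro!: mult_right_mono)
      show "0 \<le> g s" using V0[of s] by (auto simp: g_def indicator_def)
    qed
    have g: "integrable lborel g"
      by (rule Bochner_Integration.integrable_bound[OF int1[of "2 * n"]])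
         (use g_le nonneg in \<open>auto simp: g_def\<close>)
    then have g2: "integrable lborel (\<lambda>t. g (0 + (1/2) * t))"
      by (rule lborel_integrable_real_affine) simp
    have "moment W n \<le> (LINT t|lborel. c * g (0 + (1/2) * t))"
      unfolding eq
    proof (rule integral_mono[OF int1])
      show "integrable lborel (\<lambda>t. c * g (0 + (1/2) * t))" using g2 by (rule integrable_mult_right)
      fix t
      show "(1 - t) ^ n * V t \<le> c * g (0 + (1/2) * t)"
      proof (cases "t \<in> {0<..<1}")
        case True
        have "(1 - t) ^ n * W t \<le> (1 - t) ^ n * (c * W (t / 2))"
          using True c(3)[OF True] by (intro mult_left_mono) auto
        then show ?thesis using True by (simp add: V_def g_def mult_ac)
      next
        case False
        \<comment> \<open>At t = 1 \<open>cond_C3\<close> says nothing, but (1 - t)^n vanishes there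
          because n \<ge> 1.\<close>
        obtain k where "n = Suc k" using n by (cases n) auto
        then show ?thesis using False c(1) g_le(2)[of "0 + (1/2) * t"] by (auto simp: V_def indicator_def)
      qed
    qed
    also have "\<dots> = c * (LINT t|lborel. g (0 + (1/2) * t))" by simp
    also have "(LINT t|lborel. g (0 + (1/2) * t)) = 2 * (LINT s|lborel. g s)"
      using lborel_integral_real_affine[of "1/2" g 0] by simp
    also have "(LINT s|lborel. g s) \<le> moment W (2 * n)"
      unfolding eq by (rule integral_mono[OF g int1 g_le(1)])
    finally show ?thesis using c(1) by simp
  qed
  have "doubling_weight (moment W) (2 * c)"
    using pos decr dbl c by unfold_locales auto
  then show ?thesis by (rule that)
qed

section \<open>Dirichlet energy\<close>

lemma measurable_cis [measurable]: "cis \<in> borel_measurable borel"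
  by (intro borel_measurable_continuous_onI continuous_intros)

text \<open>Normalised arc length, kept on the line: translates t + x stay meaningful, and limits
  can be taken among distributions on the reals.\<close>

definition angle_measure :: "real measure" where
  "angle_measure = density lborel (\<lambda>t. ennreal (indicator {0..2 * pi} t / (2 * pi)))"

lemma sets_angle [simp, measurable_cong]: "sets angle_measure = sets borel"
  by (simp add: angle_measure_def)

lemma space_angle [simp]: "space angle_measure = UNIV"
  by (simp add: angle_measure_def)

lemma integral_cis_angle: "(LINT t|angle_measure. cis (of_int n * t)) = (if n = 0 then 1 else 0)"
proof -
  have "(LINT t|angle_measure. cis (of_int n * t)) =
      (LINT t|lborel. (indicator {0..2 * pi} t / (2 * pi)) *\<^sub>R cis (of_int n * t))"
    unfolding angle_measure_def by (intro integral_density) (auto simp: indicator_def)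
  also have "\<dots> = (LINT t|lborel. indicator {0..2 * pi} t *\<^sub>R (cis (of_int n * t) / of_real (2 * pi)))"
    by (intro Bochner_Integration.integral_cong) (auto simp: indicator_def scaleR_conv_of_real)
  also have "\<dots> = (if n = 0 then 1 else 0)"
  proof (cases "n = 0")
    case True
    have "(LINT t|lborel. indicator {0..2 * pi} t *\<^sub>R (cis (of_int n * t) / of_real (2 * pi))) =
      of_real (2 * pi) / of_real (2 * pi) - of_real 0 / complex_of_real (2 * pi)"
      using True
      by (intro integral_FTC_atLeastAtMost)
         (auto intro!: derivative_eq_intros continuous_intros simp: has_vector_derivative_def scaleR_conv_of_real)
    then show ?thesis using True by simp
  next
    case False
    define G where "G = (\<lambda>t. cis (of_int n * t) / (\<i> * of_int n * of_real (2 * pi)))"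
    have "(G has_vector_derivative cis (of_int n * t) / of_real (2 * pi)) (at t within {0..2 * pi})" for t
    proof -
      have "\<i> * of_int n * cis (of_int n * t) / (\<i> * of_int n * of_real (2 * pi)) = cis (of_int n * t) / of_real (2 * pi)"
        using False by (simp add: field_simps)
      then show ?thesis
        using has_vector_derivative_divide[OF has_vector_derivative_cis_mult[of "of_int n" t], of "\<i> * of_int n * of_real (2 * pi)"]
        by (auto simp: G_def intro: has_vector_derivative_at_within)
    qed
    then have "(LINT t|lborel. indicator {0..2 * pi} t *\<^sub>R (cis (of_int n * t) / of_real (2 * pi))) = G (2 * pi) - G 0"
      by (intro integral_FTC_atLeastAtMost) (auto intro!: continuous_intros)
    moreover have "cis (of_int n * (2 * pi)) = 1"
      using cis_multiple_2pi[of "of_int n"] by (simp add: mult_ac)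
    ultimately show ?thesis using False by (simp add: G_def)
  qed
  finally show ?thesis .
qed

lemma prob_space_angle: "prob_space angle_measure"
proof
  have "emeasure angle_measure (space angle_measure) = (\<integral>\<^sup>+t. ennreal (1 / (2 * pi)) * indicator {0..2 * pi} t \<partial>lborel)"
    unfolding angle_measure_def by (subst emeasure_density) (auto intro!: nn_integral_cong simp: indicator_def)
  also have "\<dots> = 1" by (subst nn_integral_cmult_indicator) (auto simp flip: ennreal_mult ennreal_1)
  finally show "emeasure angle_measure (space angle_measure) = 1" .
qed

interpretation angle: prob_space angle_measure by (rule prob_space_angle)

lemma nn_integral_angle_const: "(\<integral>\<^sup>+t. c \<partial>angle_measure) = c"
  using angle.emeasure_space_1 by simp

lemma integrable_angle_cis: "integrable angle_measure (\<lambda>t. c * cis (of_int n * t))"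
  by (intro integrable_mult_right angle.integrable_const_bound[of _ 1]) auto

lemma parseval_angle:
  assumes "finite A"
  shows "(\<integral>\<^sup>+t. ennreal ((norm (\<Sum>n\<in>A. c n * cis (of_int n * t)))\<^sup>2) \<partial>angle_measure) = ennreal (\<Sum>n\<in>A. (norm (c n))\<^sup>2)"
proof -
  let ?s = "\<lambda>t. \<Sum>n\<in>A. c n * cis (of_int n * t)"
  have "integrable angle_measure (\<lambda>t. (norm (?s t))\<^sup>2)"
  proof (rule angle.integrable_const_bound)
    show "AE t in angle_measure. norm ((norm (?s t))\<^sup>2) \<le> (\<Sum>n\<in>A. norm (c n))\<^sup>2"
      by (auto intro!: power_mono order_trans[OF norm_sum] simp: norm_mult)
  qed simp
  then have nn: "(\<integral>\<^sup>+t. ennreal ((norm (?s t))\<^sup>2) \<partial>angle_measure) = ennreal (LINT t|angle_measure. (norm (?s t))\<^sup>2)"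
    by (intro nn_integral_eq_integral) auto
  have "complex_of_real (LINT t|angle_measure. (norm (?s t))\<^sup>2) = (\<Sum>n\<in>A. of_real ((norm (c n))\<^sup>2))"
  proof -
    have sq: "complex_of_real ((norm (?s t))\<^sup>2) =
        (\<Sum>n\<in>A. \<Sum>k\<in>A. c n * cnj (c k) * cis (of_int (n - k) * t))" for t
      unfolding complex_norm_square cnj_sum sum_product
    proof (intro sum.cong refl)
      fix n k
      have "cis (of_int n * t) * cis (- (of_int k * t)) = cis (of_int (n - k) * t)"
        by (simp add: cis_mult left_diff_distrib)
      then show "c n * cis (of_int n * t) * cnj (c k * cis (of_int k * t)) =
          c n * cnj (c k) * cis (of_int (n - k) * t)"
        by (simp add: cis_cnj mult_ac)
    qed
    have "complex_of_real (LINT t|angle_measure. (norm (?s t))\<^sup>2) =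
       (LINT t|angle_measure. (\<Sum>n\<in>A. \<Sum>k\<in>A. c n * cnj (c k) * cis (of_int (n - k) * t)))"
      by (simp only: integral_complex_of_real[symmetric] sq)
    also have "\<dots> = (\<Sum>n\<in>A. \<Sum>k\<in>A. c n * cnj (c k) * (if n - k = 0 then 1 else 0))"
      by (simp only: Bochner_Integration.integral_sum integrable_angle_cis integral_cis_angle
          Bochner_Integration.integrable_sum Bochner_Integration.integral_mult_right_zero)
    also have "\<dots> = (\<Sum>n\<in>A. \<Sum>k\<in>A. if k = n then c n * cnj (c k) else 0)"
      by (intro sum.cong) auto
    also have "\<dots> = (\<Sum>n\<in>A. of_real ((norm (c n))\<^sup>2))"
      using assms by (simp add: complex_norm_square del: of_real_power)
    finally show ?thesis .
  qed
  then have "complex_of_real (LINT t|angle_measure. (norm (?s t))\<^sup>2) = of_real (\<Sum>n\<in>A. (norm (c n))\<^sup>2)"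
    by (simp only: of_real_sum)
  then show ?thesis by (simp only: nn of_real_eq_iff)
qed

context doubling_weight
begin

text \<open>The squared L^2 norm plus a Dirichlet form in the translations; on trigonometric
  polynomials Parseval diagonalises it with eigenvalues 1 + lam n. Values in \<open>ennreal\<close>
  let the estimates run before finiteness is known.\<close>

definition energy :: "(real \<Rightarrow> complex) \<Rightarrow> ennreal" where
  "energy g = (\<integral>\<^sup>+t. ennreal ((norm (g t))\<^sup>2) \<partial>angle_measure) +
     (\<integral>\<^sup>+x. ker x * (\<integral>\<^sup>+t. ennreal ((norm (g (t + x) - g t))\<^sup>2) \<partial>angle_measure) \<partial>lborel)"

text \<open>One pointwise comparison serves three times: for sums (a = b = 2, p = 0), for Lipschitz
  maps (a = K^2, b = 0, p = 0) and for modulations, where \<open>p\<close> is the cost of the moving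
  factor and multiplies the L^2 part only.\<close>

lemma energy_le:
  assumes [measurable]: "g1 \<in> borel_measurable borel" "g2 \<in> borel_measurable borel"
    "p \<in> borel_measurable borel"
    and nn: "0 \<le> a" "0 \<le> b" "\<And>x. 0 \<le> p x"
    and le0: "\<And>t. (norm (g t))\<^sup>2 \<le> a * (norm (g1 t))\<^sup>2 + b * (norm (g2 t))\<^sup>2"
    and le1: "\<And>t x. (norm (g (t + x) - g t))\<^sup>2 \<le> a * (norm (g1 (t + x) - g1 t))\<^sup>2 +
      b * (norm (g2 (t + x) - g2 t))\<^sup>2 + p x * (norm (g1 t))\<^sup>2"
  shows "energy g \<le> ennreal a * energy g1 + ennreal b * energy g2 +
    (\<integral>\<^sup>+x. ker x * ennreal (p x) \<partial>lborel) * (\<integral>\<^sup>+t. ennreal ((norm (g1 t))\<^sup>2) \<partial>angle_measure)"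
proof -
  let ?I = "\<lambda>g. (\<integral>\<^sup>+t. ennreal ((norm (g t :: complex))\<^sup>2) \<partial>angle_measure)"
  let ?D = "\<lambda>g x. (\<integral>\<^sup>+t. ennreal ((norm (g (t + x) - g t :: complex))\<^sup>2) \<partial>angle_measure)"
  have "?I g \<le> (\<integral>\<^sup>+t. ennreal a * ennreal ((norm (g1 t))\<^sup>2) + ennreal b * ennreal ((norm (g2 t))\<^sup>2) \<partial>angle_measure)"
    using le0 nn by (intro nn_integral_mono) (auto simp: ennreal_leI simp flip: ennreal_mult ennreal_plus)
  also have "\<dots> = ennreal a * ?I g1 + ennreal b * ?I g2"
    by (simp add: nn_integral_add nn_integral_cmult)
  finally have I: "?I g \<le> ennreal a * ?I g1 + ennreal b * ?I g2" .
  have D: "?D g x \<le> ennreal a * ?D g1 x + ennreal b * ?D g2 x + ennreal (p x) * ?I g1" for x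
  proof -
    have "?D g x \<le> (\<integral>\<^sup>+t. ennreal a * ennreal ((norm (g1 (t + x) - g1 t))\<^sup>2) +
       ennreal b * ennreal ((norm (g2 (t + x) - g2 t))\<^sup>2) + ennreal (p x) * ennreal ((norm (g1 t))\<^sup>2) \<partial>angle_measure)"
      using le1 nn by (intro nn_integral_mono) (auto simp: ennreal_leI simp flip: ennreal_mult ennreal_plus)
    also have "\<dots> = ennreal a * ?D g1 x + ennreal b * ?D g2 x + ennreal (p x) * ?I g1"
      by (simp add: nn_integral_add nn_integral_cmult)
    finally show ?thesis .
  qed
  have "(\<integral>\<^sup>+x. ker x * ?D g x \<partial>lborel) \<le>
    (\<integral>\<^sup>+x. ker x * (ennreal a * ?D g1 x + ennreal b * ?D g2 x + ennreal (p x) * ?I g1) \<partial>lborel)"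
    using D by (intro nn_integral_mono mult_left_mono) auto
  also have "\<dots> = (\<integral>\<^sup>+x. ennreal a * (ker x * ?D g1 x) + ennreal b * (ker x * ?D g2 x) + (ker x * ennreal (p x)) * ?I g1 \<partial>lborel)"
    by (intro nn_integral_cong) (simp add: algebra_simps)
  also have "\<dots> = ennreal a * (\<integral>\<^sup>+x. ker x * ?D g1 x \<partial>lborel) + ennreal b * (\<integral>\<^sup>+x. ker x * ?D g2 x \<partial>lborel) +
     (\<integral>\<^sup>+x. ker x * ennreal (p x) \<partial>lborel) * ?I g1"
    by (simp add: nn_integral_add nn_integral_cmult nn_integral_multc)
  finally have Q: "(\<integral>\<^sup>+x. ker x * ?D g x \<partial>lborel) \<le> \<dots>" .
  show ?thesis
    unfolding energy_def using add_mono[OF I Q] by (simp add: algebra_simps)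
qed

lemma energy_add:
  assumes "f \<in> borel_measurable borel" "g \<in> borel_measurable borel"
  shows "energy (\<lambda>t. f t + g t) \<le> 2 * energy f + 2 * energy g"
proof -
  have sq: "(norm (u + v))\<^sup>2 \<le> 2 * (norm u)\<^sup>2 + 2 * (norm v)\<^sup>2" for u v :: complex
  proof -
    have "(norm (u + v))\<^sup>2 \<le> (norm u + norm v)\<^sup>2" by (intro power_mono norm_triangle_ineq) auto
    also have "\<dots> \<le> 2 * (norm u)\<^sup>2 + 2 * (norm v)\<^sup>2"
      using zero_le_power2[of "norm u - norm v"] by (simp add: power2_eq_square algebra_simps)
    finally show ?thesis .
  qed
  have "energy (\<lambda>t. f t + g t) \<le> ennreal 2 * energy f + ennreal 2 * energy g +
     (\<integral>\<^sup>+x. ker x * ennreal 0 \<partial>lborel) * (\<integral>\<^sup>+t. ennreal ((norm (f t))\<^sup>2) \<partial>angle_measure)"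
    by (rule energy_le) (use assms sq sq[of "f _ - f _" "g _ - g _"] in \<open>auto simp: algebra_simps\<close>)
  then show ?thesis by simp
qed

lemma energy_contraction:
  assumes "g \<in> borel_measurable borel" "\<And>s t. \<bar>F s - F t\<bar> \<le> K * \<bar>s - t\<bar>" "F 0 = 0" "0 \<le> K"
  shows "energy (\<lambda>t. of_real (F (Re (g t)))) \<le> ennreal (K\<^sup>2) * energy g"
proof -
  have le: "(norm (of_real (F (Re u)) - complex_of_real (F (Re v))))\<^sup>2 \<le> K\<^sup>2 * (norm (u - v))\<^sup>2" for u v
  proof -
    have "\<bar>F (Re u) - F (Re v)\<bar> \<le> K * \<bar>Re u - Re v\<bar>" by (rule assms)
    also have "\<dots> \<le> K * norm (u - v)" using abs_Re_le_cmod[of "u - v"] assms(4) by (intro mult_left_mono) auto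
    finally have "\<bar>F (Re u) - F (Re v)\<bar>\<^sup>2 \<le> (K * norm (u - v))\<^sup>2" by (intro power_mono) auto
    then show ?thesis by (simp add: power_mult_distrib flip: of_real_diff)
  qed
  have "energy (\<lambda>t. of_real (F (Re (g t)))) \<le> ennreal (K\<^sup>2) * energy g + ennreal 0 * energy (\<lambda>t. 0) +
     (\<integral>\<^sup>+x. ker x * ennreal 0 \<partial>lborel) * (\<integral>\<^sup>+t. ennreal ((norm (g t))\<^sup>2) \<partial>angle_measure)"
    by (rule energy_le) (use assms(1,3) le le[of _ 0] in auto)
  then show ?thesis by simp
qed

lemma nn_integral_lam:
  "(\<integral>\<^sup>+x. ker x * ennreal ((norm (cis (of_int n * x) - 1))\<^sup>2) \<partial>lborel) = ennreal (lam n)"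
  using ker_comparison by metis

text \<open>The difference of the product splits into the difference of \<open>g\<close> and
  (e^(inx) - 1) g(t). Integrating \<bar>e^(inx) - 1\<bar>^2 against \<open>ker\<close> gives exactly
  \<open>lam n\<close>; the 2s come from (u + v)^2 \<le> 2 u^2 + 2 v^2.\<close>

lemma energy_modulation:
  assumes [measurable]: "g \<in> borel_measurable borel"
  shows "energy (\<lambda>t. cis (of_int n * t) * g t) \<le> ennreal (2 + 2 * lam n) * energy g"
proof -
  have le: "(norm (cis (of_int n * (t + x)) * g (t + x) - cis (of_int n * t) * g t))\<^sup>2 \<le>
    2 * (norm (g (t + x) - g t))\<^sup>2 + (2 * (norm (cis (of_int n * x) - 1))\<^sup>2) * (norm (g t))\<^sup>2" for t x
  proof -
    have eq: "cis (of_int n * (t + x)) * g (t + x) - cis (of_int n * t) * g t =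
      cis (of_int n * (t + x)) * (g (t + x) - g t) + cis (of_int n * t) * ((cis (of_int n * x) - 1) * g t)"
      by (simp add: distrib_left algebra_simps flip: cis_mult)
    have "norm (cis (of_int n * (t + x)) * g (t + x) - cis (of_int n * t) * g t) \<le>
      norm (g (t + x) - g t) + norm (cis (of_int n * x) - 1) * norm (g t)"
      unfolding eq by (rule order_trans[OF norm_triangle_ineq]) (simp add: norm_mult)
    then have "(norm (cis (of_int n * (t + x)) * g (t + x) - cis (of_int n * t) * g t))\<^sup>2 \<le>
      (norm (g (t + x) - g t) + norm (cis (of_int n * x) - 1) * norm (g t))\<^sup>2"
      by (intro power_mono) auto
    also have "\<dots> \<le> 2 * (norm (g (t + x) - g t))\<^sup>2 + 2 * (norm (cis (of_int n * x) - 1) * norm (g t))\<^sup>2"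
      using zero_le_power2[of "norm (g (t + x) - g t) - norm (cis (of_int n * x) - 1) * norm (g t)"]
      by (simp add: power2_sum power2_diff)
    finally show ?thesis by (simp add: power_mult_distrib)
  qed
  let ?I = "\<integral>\<^sup>+t. ennreal ((norm (g t))\<^sup>2) \<partial>angle_measure"
  have "energy (\<lambda>t. cis (of_int n * t) * g t) \<le> ennreal 2 * energy g + ennreal 0 * energy (\<lambda>t. 0) +
     (\<integral>\<^sup>+x. ker x * ennreal (2 * (norm (cis (of_int n * x) - 1))\<^sup>2) \<partial>lborel) * ?I"
    by (rule energy_le) (use le in \<open>auto simp: norm_mult\<close>)
  also have "(\<integral>\<^sup>+x. ker x * ennreal (2 * (norm (cis (of_int n * x) - 1))\<^sup>2) \<partial>lborel) = ennreal (2 * lam n)"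
  proof -
    have "(\<integral>\<^sup>+x. ker x * ennreal (2 * (norm (cis (of_int n * x) - 1))\<^sup>2) \<partial>lborel) =
      (\<integral>\<^sup>+x. ennreal 2 * (ker x * ennreal ((norm (cis (of_int n * x) - 1))\<^sup>2)) \<partial>lborel)"
      by (intro nn_integral_cong) (simp add: ennreal_mult mult_ac)
    also have "\<dots> = ennreal 2 * ennreal (lam n)"
      by (subst nn_integral_cmult) (auto simp: nn_integral_lam)
    finally show ?thesis by (simp add: ennreal_mult lam_nonneg)
  qed
  also have "ennreal 2 * energy g + ennreal 0 * energy (\<lambda>t. 0) + ennreal (2 * lam n) * ?I \<le>
     ennreal 2 * energy g + ennreal (2 * lam n) * energy g"
    by (auto intro!: add_mono mult_left_mono simp: energy_def)
  also have "\<dots> = ennreal (2 + 2 * lam n) * energy g"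
    using lam_nonneg[of n] by (simp add: ennreal_plus distrib_right)
  finally show ?thesis .
qed

text \<open>The mean value inequality gives \<bar>g(t + x) - g(t)\<bar> \<le> e \<bar>x\<bar>, and
  x^2 is integrable against \<open>ker\<close>. This controls the remainder when a test function is
  replaced by a trigonometric polynomial.\<close>

lemma energy_smooth_small:
  obtains C where "0 < C" "\<And>g g' e. (\<And>t. (g has_vector_derivative g' t) (at t)) \<Longrightarrow>
    (\<And>t. norm (g t) \<le> e) \<Longrightarrow> (\<And>t. norm (g' t) \<le> e) \<Longrightarrow> energy g \<le> ennreal (C * e\<^sup>2)"
proof -
  obtain C where C: "0 < C" "(\<integral>\<^sup>+x. ker x * ennreal (x\<^sup>2) \<partial>lborel) \<le> ennreal C"
    using ker_comparison by metis
  show ?thesis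
  proof (rule that[of "1 + C"])
    fix g :: "real \<Rightarrow> complex" and g' e
    assume g: "\<And>t. (g has_vector_derivative g' t) (at t)" "\<And>t. norm (g t) \<le> e" "\<And>t. norm (g' t) \<le> e"
    have e: "0 \<le> e" using norm_ge_zero[of "g 0"] g(2)[of 0] by linarith
    have "(\<integral>\<^sup>+t. ennreal ((norm (g t))\<^sup>2) \<partial>angle_measure) \<le> (\<integral>\<^sup>+t. ennreal (e\<^sup>2) \<partial>angle_measure)"
      using g(2) by (intro nn_integral_mono ennreal_leI power_mono) auto
    then have 1: "(\<integral>\<^sup>+t. ennreal ((norm (g t))\<^sup>2) \<partial>angle_measure) \<le> ennreal (e\<^sup>2)"
      by (simp only: nn_integral_angle_const)
    have "(\<integral>\<^sup>+t. ennreal ((norm (g (t + x) - g t))\<^sup>2) \<partial>angle_measure) \<le> ennreal (e\<^sup>2) * ennreal (x\<^sup>2)" for x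
    proof -
      have "norm (g (t + x) - g t) \<le> e * \<bar>x\<bar>" for t
        using norm_diff_le_of_vector_derivative[OF g(1,3), of "t + x" t] by simp
      then have "(norm (g (t + x) - g t))\<^sup>2 \<le> (e * \<bar>x\<bar>)\<^sup>2" for t by (intro power_mono) auto
      then have "(\<integral>\<^sup>+t. ennreal ((norm (g (t + x) - g t))\<^sup>2) \<partial>angle_measure) \<le> (\<integral>\<^sup>+t. ennreal (e\<^sup>2 * x\<^sup>2) \<partial>angle_measure)"
        by (intro nn_integral_mono ennreal_leI) (simp add: power_mult_distrib)
      then show ?thesis by (simp only: nn_integral_angle_const ennreal_mult zero_le_power2)
    qed
    then have "ker x * (\<integral>\<^sup>+t. ennreal ((norm (g (t + x) - g t))\<^sup>2) \<partial>angle_measure) \<le>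
        ennreal (e\<^sup>2) * (ker x * ennreal (x\<^sup>2))" for x
      unfolding mult.left_commute[of "ennreal (e\<^sup>2)"] by (rule mult_left_mono) simp
    then have "(\<integral>\<^sup>+x. ker x * (\<integral>\<^sup>+t. ennreal ((norm (g (t + x) - g t))\<^sup>2) \<partial>angle_measure) \<partial>lborel) \<le>
      (\<integral>\<^sup>+x. ennreal (e\<^sup>2) * (ker x * ennreal (x\<^sup>2)) \<partial>lborel)"
      by (intro nn_integral_mono)
    also have "\<dots> = ennreal (e\<^sup>2) * (\<integral>\<^sup>+x. ker x * ennreal (x\<^sup>2) \<partial>lborel)"
      by (rule nn_integral_cmult) measurable
    also have "\<dots> \<le> ennreal (e\<^sup>2) * ennreal C" using C(2) by (rule mult_left_mono) auto
    finally have "energy g \<le> ennreal (e\<^sup>2) + ennreal (e\<^sup>2) * ennreal C"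
      unfolding energy_def using 1 by (rule add_mono[rotated])
    also have "\<dots> = ennreal ((1 + C) * e\<^sup>2)"
      using C(1) by (simp add: distrib_right mult.commute flip: ennreal_mult ennreal_plus)
    finally show "energy g \<le> ennreal ((1 + C) * e\<^sup>2)" .
  qed (use C in simp)
qed

text \<open>A squared norm; by \<open>ker_comparison\<close> it is equivalent to \<Sum> \<bar>a
  n\<bar>^2 / w(\<bar>n\<bar>).\<close>

definition coeff_norm :: "(int \<Rightarrow> complex) \<Rightarrow> real" where
  "coeff_norm a = (\<Sum>n | a n \<noteq> 0. (1 + lam n) * (norm (a n))\<^sup>2)"

lemma energy_trig_poly:
  assumes "finite_support a"
  shows "energy (\<lambda>t. trig_poly a (cis t)) = ennreal (coeff_norm a)"
proof -
  let ?A = "{n. a n \<noteq> 0}"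
  have A: "finite ?A" using assms by (simp add: finite_support_def)
  have p: "trig_poly a (cis t) = (\<Sum>n\<in>?A. a n * cis (of_int n * t))" for t
    by (simp add: trig_poly_def cis_power_int)
  have d: "trig_poly a (cis (t + x)) - trig_poly a (cis t) =
      (\<Sum>n\<in>?A. (a n * (cis (of_int n * x) - 1)) * cis (of_int n * t))" for t x
    unfolding p sum_subtractf[symmetric]
    by (intro sum.cong refl) (simp add: distrib_left algebra_simps flip: cis_mult)
  have "(\<integral>\<^sup>+x. ker x * (\<integral>\<^sup>+t. ennreal ((norm (trig_poly a (cis (t + x)) - trig_poly a (cis t)))\<^sup>2) \<partial>angle_measure) \<partial>lborel) =
    (\<integral>\<^sup>+x. (\<Sum>n\<in>?A. ennreal ((norm (a n))\<^sup>2) * (ker x * ennreal ((norm (cis (of_int n * x) - 1))\<^sup>2))) \<partial>lborel)"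
    unfolding d parseval_angle[OF A]
    by (intro nn_integral_cong)
       (simp add: sum_distrib_left norm_mult power_mult_distrib ennreal_mult mult_ac flip: sum_ennreal)
  also have "\<dots> = (\<Sum>n\<in>?A. ennreal ((norm (a n))\<^sup>2) * ennreal (lam n))"
    by (subst nn_integral_sum) (auto simp: nn_integral_cmult nn_integral_lam)
  also have "\<dots> = ennreal (\<Sum>n\<in>?A. (norm (a n))\<^sup>2 * lam n)"
    using lam_nonneg by (simp flip: ennreal_mult sum_ennreal)
  finally have "energy (\<lambda>t. trig_poly a (cis t)) =
      ennreal (\<Sum>n\<in>?A. (norm (a n))\<^sup>2) + ennreal (\<Sum>n\<in>?A. (norm (a n))\<^sup>2 * lam n)"
    unfolding energy_def by (simp add: p parseval_angle[OF A])
  also have "\<dots> = ennreal ((\<Sum>n\<in>?A. (norm (a n))\<^sup>2) + (\<Sum>n\<in>?A. (norm (a n))\<^sup>2 * lam n))"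
    using lam_nonneg by (intro ennreal_plus[symmetric] sum_nonneg) auto
  also have "(\<Sum>n\<in>?A. (norm (a n))\<^sup>2) + (\<Sum>n\<in>?A. (norm (a n))\<^sup>2 * lam n) = coeff_norm a"
    unfolding coeff_norm_def sum.distrib[symmetric] by (intro sum.cong) (auto simp: algebra_simps)
  finally show ?thesis .
qed

end

section \<open>Distributions bounded by the energy\<close>

lemma distribution_small:
  assumes "distribution S"
  obtains C N where "0 < C" "\<And>\<phi> e. \<phi> \<in> test_functions \<Longrightarrow>
    (\<And>k t. k \<le> N \<Longrightarrow> norm (circle_deriv k \<phi> t) \<le> e) \<Longrightarrow> norm (S \<phi>) \<le> C * e"
proof -
  obtain C N where *: "\<And>\<phi>. \<phi> \<in> test_functions \<Longrightarrow>
    norm (S \<phi>) \<le> C * (\<Sum>k\<le>N. SUP t. norm (circle_deriv k \<phi> t))"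
    using assms unfolding distribution_def by blast
  show ?thesis
  proof (rule that[of "(\<bar>C\<bar> + 1) * (real N + 1)" N])
    fix \<phi> e assume \<phi>: "\<phi> \<in> test_functions" and e: "\<And>k t. k \<le> N \<Longrightarrow> norm (circle_deriv k \<phi> t) \<le> e"
    \<comment> \<open>A real \<open>SUP\<close> is meaningful only for bounded sets; its
      nonnegativity, which allows \<open>C\<close> to be enlarged to
      \<open>\<bar>C\<bar> + 1\<close>, rests on this.\<close>
    have bdd: "bdd_above (range (\<lambda>t. norm (circle_deriv k \<phi> t)))" if "k \<le> N" for k
      using e[OF that] by (intro bdd_aboveI[of _ e]) auto
    have nn: "0 \<le> (SUP t. norm (circle_deriv k \<phi> t))" if "k \<le> N" for k
      by (rule order_trans[OF norm_ge_zero cSUP_upper[OF UNIV_I[of 0] bdd[OF that]]])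
    have "(\<Sum>k\<le>N. SUP t. norm (circle_deriv k \<phi> t)) \<le> (\<Sum>k\<le>N. e)"
      using e by (intro sum_mono cSUP_least) auto
    then have le: "(\<Sum>k\<le>N. SUP t. norm (circle_deriv k \<phi> t)) \<le> (real N + 1) * e" by (simp add: add.commute)
    have "norm (S \<phi>) \<le> C * (\<Sum>k\<le>N. SUP t. norm (circle_deriv k \<phi> t))" by (rule *[OF \<phi>])
    also have "\<dots> \<le> (\<bar>C\<bar> + 1) * (\<Sum>k\<le>N. SUP t. norm (circle_deriv k \<phi> t))"
      using nn by (intro mult_right_mono sum_nonneg) auto
    also have "\<dots> \<le> (\<bar>C\<bar> + 1) * ((real N + 1) * e)" using le by (intro mult_left_mono) auto
    finally show "norm (S \<phi>) \<le> (\<bar>C\<bar> + 1) * (real N + 1) * e" by (simp add: mult.assoc)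
  qed (auto intro!: mult_pos_pos add_nonneg_pos)
qed

lemma distribution_trig_poly:
  assumes "distribution S"
  shows "S (trig_poly a) = (\<Sum>n | a n \<noteq> 0. a n * distribution_fourier S (- n))"
proof -
  have "S (\<lambda>z. \<Sum>n | a n \<noteq> 0. a n * z powi n) = (\<Sum>n | a n \<noteq> 0. S (\<lambda>z. a n * z powi n))"
    by (rule distribution_sum[OF assms]) (intro test_functions_mult test_functions_const test_functions_powi)
  then show ?thesis
    by (simp add: trig_poly_def[abs_def] distribution_fourier_def distribution_scale[OF assms])
qed

text \<open>Trigonometric polynomials are dense in every C^N norm, and \<open>S\<close> is
  continuous for one of them. Were all coefficients 0, the tolerance \<open>e\<close> would give
  \<bar>S \<psi>\<bar> \<le> \<bar>S \<psi>\<bar> / 2.\<close>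

lemma nontrivial_distribution_fourier:
  assumes S: "distribution S" and "nontrivial_distribution S"
  obtains n where "distribution_fourier S n \<noteq> 0"
proof (rule ccontr)
  assume "\<not> thesis"
  then have z: "distribution_fourier S n = 0" for n using that by blast
  obtain \<psi> where \<psi>: "\<psi> \<in> test_functions" "S \<psi> \<noteq> 0"
    using assms(2) by (auto simp: nontrivial_distribution_def)
  obtain C N where C: "0 < C" "\<And>\<phi> e. \<phi> \<in> test_functions \<Longrightarrow>
    (\<And>k t. k \<le> N \<Longrightarrow> norm (circle_deriv k \<phi> t) \<le> e) \<Longrightarrow> norm (S \<phi>) \<le> C * e"
    using distribution_small[OF S] by metis
  define e where "e = norm (S \<psi>) / (2 * C)"
  have e: "0 < e" using \<psi>(2) C(1) by (simp add: e_def)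
  obtain a where a: "\<And>k t. k \<le> N \<Longrightarrow> norm (circle_deriv k (\<lambda>z. \<psi> z - trig_poly a z) t) \<le> e"
    using test_function_approx[OF \<psi>(1) e, of N] by metis
  have "norm (S (\<lambda>z. \<psi> z - trig_poly a z)) \<le> C * e"
    by (intro C(2) test_functions_diff \<psi>(1) trig_poly_test a)
  moreover have "S (\<lambda>z. \<psi> z - trig_poly a z) = S \<psi>"
    using distribution_diff[OF S \<psi>(1) trig_poly_test[of a]] by (simp add: distribution_trig_poly[OF S] z)
  ultimately show False using \<psi>(2) C(1) by (simp add: e_def)
qed

lemma continuous_on_test_function:
  assumes "\<phi> \<in> test_functions"
  shows "continuous_on UNIV (\<lambda>t. \<phi> (cis t))"
proof -
  have "((\<lambda>t. \<phi> (cis t)) has_vector_derivative circle_deriv 1 \<phi> t) (at t)" for t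
    using circle_deriv_has_vector_derivative[OF assms, of 0 t] by (simp add: circle_deriv_def)
  then show ?thesis
    by (intro continuous_at_imp_continuous_on ballI) (rule has_vector_derivative_continuous)
qed

lemma measurable_test_function:
  "\<phi> \<in> test_functions \<Longrightarrow> (\<lambda>t. \<phi> (cis t)) \<in> borel_measurable borel"
  by (intro borel_measurable_continuous_onI continuous_on_test_function)

context doubling_weight
begin

text \<open>Cauchy-Schwarz after dividing one factor by sqrt(w) and multiplying the other. The
  coefficient of z^n meets the Fourier coefficient at -n, harmless as the weight depends on
  \<bar>n\<bar>; M + 1 makes the constant positive.\<close>

lemma distribution_le_coeff_norm:
  assumes S: "distribution S" and l2: "distribution_fourier S \<in> weighted_l2 w"
  obtains K where "0 < K" "\<And>a. finite_support a \<Longrightarrow> (norm (S (trig_poly a)))\<^sup>2 \<le> K * coeff_norm a"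
proof -
  define f where "f = (\<lambda>n. (norm (distribution_fourier S n))\<^sup>2 * w (nat \<bar>n\<bar>))"
  have f: "f summable_on UNIV" using l2 by (simp add: weighted_l2_def f_def)
  have f0: "0 \<le> f n" for n using w_pos[of "nat \<bar>n\<bar>"] by (simp add: f_def)
  define M where "M = infsum f UNIV"
  have M0: "0 \<le> M" unfolding M_def using f0 by (intro infsum_nonneg) auto
  obtain C where C: "0 < C" "\<And>n. 1 / w (nat \<bar>n\<bar>) \<le> C * (1 + lam n)"
    using ker_comparison by metis
  show ?thesis
  proof (rule that[of "C * (M + 1)"])
    show "0 < C * (M + 1)" using C(1) M0 by simp
    fix a assume a: "finite_support a"
    let ?A = "{n. a n \<noteq> 0}"
    have A: "finite ?A" using a by (simp add: finite_support_def)
    let ?w = "\<lambda>n. sqrt (w (nat \<bar>n\<bar>))"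
    have wp: "0 < ?w n" for n using w_pos by simp
    have "norm (S (trig_poly a)) \<le> (\<Sum>n\<in>?A. norm (a n * distribution_fourier S (- n)))"
      unfolding distribution_trig_poly[OF S] by (rule norm_sum)
    also have "\<dots> = (\<Sum>n\<in>?A. (norm (a n) / ?w n) * (norm (distribution_fourier S (- n)) * ?w n))"
      using wp by (intro sum.cong) (auto simp: norm_mult less_imp_neq[symmetric])
    finally have "(norm (S (trig_poly a)))\<^sup>2 \<le>
       (\<Sum>n\<in>?A. (norm (a n) / ?w n) * (norm (distribution_fourier S (- n)) * ?w n))\<^sup>2"
      by (intro power_mono) auto
    also have "\<dots> \<le> (\<Sum>n\<in>?A. (norm (a n) / ?w n)\<^sup>2) * (\<Sum>n\<in>?A. (norm (distribution_fourier S (- n)) * ?w n)\<^sup>2)"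
      by (rule Cauchy_Schwarz_ineq_sum)
    also have "\<dots> \<le> (C * coeff_norm a) * M"
    proof (rule mult_mono)
      have "(norm (a n) / ?w n)\<^sup>2 \<le> C * ((1 + lam n) * (norm (a n))\<^sup>2)" for n
      proof -
        have "(norm (a n) / ?w n)\<^sup>2 = (1 / w (nat \<bar>n\<bar>)) * (norm (a n))\<^sup>2"
          using w_pos[of "nat \<bar>n\<bar>"] by (simp add: power_divide)
        also have "\<dots> \<le> (C * (1 + lam n)) * (norm (a n))\<^sup>2" by (intro mult_right_mono C) auto
        finally show ?thesis by (simp add: mult.assoc)
      qed
      then show "(\<Sum>n\<in>?A. (norm (a n) / ?w n)\<^sup>2) \<le> C * coeff_norm a"
        unfolding coeff_norm_def sum_distrib_left by (intro sum_mono)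
      have "(\<Sum>n\<in>?A. (norm (distribution_fourier S (- n)) * ?w n)\<^sup>2) = (\<Sum>n\<in>?A. f (- n))"
        using w_pos by (intro sum.cong) (auto simp: f_def power_mult_distrib less_imp_le)
      also have "\<dots> = (\<Sum>n\<in>uminus ` ?A. f n)" by (subst sum.reindex) auto
      also have "\<dots> \<le> M" unfolding M_def using f0 A by (intro finite_sum_le_infsum f) auto
      finally show "(\<Sum>n\<in>?A. (norm (distribution_fourier S (- n)) * ?w n)\<^sup>2) \<le> M" .
      show "0 \<le> C * coeff_norm a" using C(1) lam_nonneg
        by (auto simp: coeff_norm_def intro!: sum_nonneg mult_nonneg_nonneg add_nonneg_nonneg)
    qed (auto intro!: sum_nonneg)
    also have "\<dots> \<le> C * (M + 1) * coeff_norm a"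
      using C(1) lam_nonneg
      by (auto simp: coeff_norm_def algebra_simps intro!: sum_nonneg mult_nonneg_nonneg add_nonneg_nonneg)
    finally show "(norm (S (trig_poly a)))\<^sup>2 \<le> C * (M + 1) * coeff_norm a" .
  qed
qed

text \<open>Write \<psi> = \<phi> + p with \<open>p\<close> a trigonometric polynomial and \<phi>
  small with its derivatives. Splitting \<bar>S \<psi>\<bar>^2 costs a factor 2, and bounding the
  energy of \<open>p\<close> by that of \<psi> another one, hence 4 K.\<close>

lemma distribution_le_energy:
  assumes S: "distribution S" and l2: "distribution_fourier S \<in> weighted_l2 w"
  obtains K where "0 < K" "\<And>\<psi>. \<psi> \<in> test_functions \<Longrightarrow>
    ennreal ((norm (S \<psi>))\<^sup>2) \<le> ennreal K * energy (\<lambda>t. \<psi> (cis t))"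
proof -
  obtain K where K: "0 < K" "\<And>a. finite_support a \<Longrightarrow> (norm (S (trig_poly a)))\<^sup>2 \<le> K * coeff_norm a"
    using distribution_le_coeff_norm[OF S l2] by metis
  obtain C N where C: "0 < C" "\<And>\<phi> e. \<phi> \<in> test_functions \<Longrightarrow>
    (\<And>k t. k \<le> N \<Longrightarrow> norm (circle_deriv k \<phi> t) \<le> e) \<Longrightarrow> norm (S \<phi>) \<le> C * e"
    using distribution_small[OF S] by metis
  obtain D where D: "0 < D" "\<And>g g' e. (\<And>t. (g has_vector_derivative g' t) (at t)) \<Longrightarrow>
    (\<And>t. norm (g t) \<le> e) \<Longrightarrow> (\<And>t. norm (g' t) \<le> e) \<Longrightarrow> energy g \<le> ennreal (D * e\<^sup>2)"
    using energy_smooth_small by metis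
  show ?thesis
  proof (rule that[of "4 * K"])
    fix \<psi> assume \<psi>: "\<psi> \<in> test_functions"
    show "ennreal ((norm (S \<psi>))\<^sup>2) \<le> ennreal (4 * K) * energy (\<lambda>t. \<psi> (cis t))"
    proof (cases "energy (\<lambda>t. \<psi> (cis t))")
      case top
      then show ?thesis using K(1) by (simp add: ennreal_mult_top)
    next
      case (real r)
      have "(norm (S \<psi>))\<^sup>2 \<le> 4 * K * r + \<epsilon>" if \<epsilon>: "0 < \<epsilon>" for \<epsilon>
      proof -
        \<comment> \<open>\<open>B\<close> collects what \<phi> costs: 2 C^2 e^2 through S \<phi>
          and 4 K D e^2 through its energy; \<open>e\<close> makes the total equal to
          \<epsilon>.\<close>
        define B where "B = 2 * C\<^sup>2 + 4 * K * D"
        have B: "0 < B" using C(1) K(1) D(1) by (auto simp: B_def intro!: add_pos_pos)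
        define e where "e = sqrt (\<epsilon> / B)"
        have e: "0 < e" "B * e\<^sup>2 = \<epsilon>" using B \<epsilon> by (auto simp: e_def)
        \<comment> \<open>\<open>Suc N\<close> covers the \<open>N\<close> derivatives seen by
          \<open>S\<close> and, even for N = 0, the first derivative used for the energy.\<close>
        obtain a where a: "finite_support a"
          "\<And>k t. k \<le> Suc N \<Longrightarrow> norm (circle_deriv k (\<lambda>z. \<psi> z - trig_poly a z) t) \<le> e"
          using test_function_approx[OF \<psi> e(1), of "Suc N"] by metis
        define \<phi> where "\<phi> = (\<lambda>z. \<psi> z - trig_poly a z)"
        have \<phi>: "\<phi> \<in> test_functions" unfolding \<phi>_def by (intro test_functions_diff \<psi> trig_poly_test)
        have "norm (S \<phi>) \<le> C * e" by (rule C(2)[OF \<phi>]) (use a(2) in \<open>auto simp: \<phi>_def\<close>)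
        have "energy (\<lambda>t. \<phi> (cis t)) \<le> ennreal (D * e\<^sup>2)"
        proof (rule D(2))
          show "((\<lambda>t. \<phi> (cis t)) has_vector_derivative circle_deriv 1 \<phi> t) (at t)" for t
            using circle_deriv_has_vector_derivative[OF \<phi>, of 0 t] by (simp add: circle_deriv_def)
          show "norm (\<phi> (cis t)) \<le> e" for t
            using a(2)[of 0 t] by (simp add: \<phi>_def circle_deriv_def)
          show "norm (circle_deriv 1 \<phi> t) \<le> e" for t
            using a(2)[of 1 t] by (simp add: \<phi>_def)
        qed
        have "ennreal (coeff_norm a) = energy (\<lambda>t. \<psi> (cis t) + (- 1) * \<phi> (cis t))"
          unfolding energy_trig_poly[OF a(1), symmetric] by (simp add: \<phi>_def)
        also have "\<dots> \<le> 2 * energy (\<lambda>t. \<psi> (cis t)) + 2 * energy (\<lambda>t. (- 1) * \<phi> (cis t))"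
          using measurable_test_function[OF \<psi>] measurable_test_function[OF \<phi>]
          by (intro energy_add) auto
        also have "energy (\<lambda>t. (- 1) * \<phi> (cis t)) = energy (\<lambda>t. \<phi> (cis t))"
          by (simp add: energy_def norm_minus_commute)
        also have "2 * energy (\<lambda>t. \<psi> (cis t)) + 2 * energy (\<lambda>t. \<phi> (cis t)) \<le> 2 * ennreal r + 2 * ennreal (D * e\<^sup>2)"
          using \<open>energy (\<lambda>t. \<phi> (cis t)) \<le> ennreal (D * e\<^sup>2)\<close> real by (intro add_mono mult_left_mono) auto
        also have "\<dots> = ennreal (2 * r + 2 * (D * e\<^sup>2))"
          using real D(1) by (simp add: ennreal_plus ennreal_mult)
        finally have cn: "coeff_norm a \<le> 2 * r + 2 * (D * e\<^sup>2)"
          using real D(1) by (subst (asm) ennreal_le_iff) auto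
        have "S \<psi> = S \<phi> + S (trig_poly a)"
          using distribution_diff[OF S \<psi> trig_poly_test[of a]] by (simp add: \<phi>_def)
        then have "norm (S \<psi>) \<le> norm (S \<phi>) + norm (S (trig_poly a))" by (simp add: norm_triangle_ineq)
        then have "(norm (S \<psi>))\<^sup>2 \<le> (norm (S \<phi>) + norm (S (trig_poly a)))\<^sup>2" by (intro power_mono) auto
        also have "\<dots> \<le> 2 * (norm (S \<phi>))\<^sup>2 + 2 * (norm (S (trig_poly a)))\<^sup>2"
          using zero_le_power2[of "norm (S \<phi>) - norm (S (trig_poly a))"] by (simp add: power2_sum power2_diff)
        also have "\<dots> \<le> 2 * (C * e)\<^sup>2 + 2 * (K * (2 * r + 2 * (D * e\<^sup>2)))"
        proof (intro add_mono mult_left_mono)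
          show "(norm (S \<phi>))\<^sup>2 \<le> (C * e)\<^sup>2" using \<open>norm (S \<phi>) \<le> C * e\<close> by (intro power_mono) auto
          show "(norm (S (trig_poly a)))\<^sup>2 \<le> K * (2 * r + 2 * (D * e\<^sup>2))"
            using K(2)[OF a(1)] cn K(1) by (meson mult_left_mono less_imp_le order_trans)
        qed auto
        also have "\<dots> = 4 * K * r + B * e\<^sup>2" by (simp add: B_def power_mult_distrib algebra_simps)
        finally show ?thesis using e(2) by simp
      qed
      then have "(norm (S \<psi>))\<^sup>2 \<le> 4 * K * r" by (rule field_le_epsilon)
      then have "ennreal ((norm (S \<psi>))\<^sup>2) \<le> ennreal (4 * K * r)" by (rule ennreal_leI)
      then show ?thesis using real K(1) by (simp add: ennreal_mult)
    qed
  qed (use K in simp)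
qed

text \<open>Positivity of a capacity of \<open>E\<close>. If \<open>Re p \<ge> 1\<close> on \<open>E\<close>, then \<open>\<psi> = F (Re p)\<close> is \<open>1\<close> near \<open>E\<close>, so
  that \<open>S (z\<^sup>-\<^sup>n) = S (z\<^sup>-\<^sup>n \<psi>)\<close>, and the energy of \<open>\<psi>\<close> is controlled by that of \<open>p\<close>.\<close>

lemma coeff_norm_lower_bound:
  assumes S: "distribution S" "nontrivial_distribution S" "distribution_support S \<subseteq> E"
    and l2: "distribution_fourier S \<in> weighted_l2 w"
  obtains d where "0 < d" "\<And>a. finite_support a \<Longrightarrow> (\<And>z. z \<in> E \<Longrightarrow> 1 \<le> Re (trig_poly a z)) \<Longrightarrow> d \<le> coeff_norm a"
proof -
  obtain n where n: "distribution_fourier S n \<noteq> 0" using nontrivial_distribution_fourier[OF S(1,2)] .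
  obtain K where K: "0 < K" "\<And>\<psi>. \<psi> \<in> test_functions \<Longrightarrow>
    ennreal ((norm (S \<psi>))\<^sup>2) \<le> ennreal K * energy (\<lambda>t. \<psi> (cis t))"
    using distribution_le_energy[OF S(1) l2] by metis
  obtain F :: "real \<Rightarrow> real" and L where F: "\<And>k. n_differentiable k F" "\<And>t. t \<le> 0 \<Longrightarrow> F t = 0"
    "\<And>t. 1/2 \<le> t \<Longrightarrow> F t = 1" "\<And>s t. \<bar>F s - F t\<bar> \<le> L * \<bar>s - t\<bar>" "0 < L"
    using smooth_cutoff by metis
  define M where "M = K * ((2 + 2 * lam (- n)) * L\<^sup>2)"
  have M: "0 < M" using K(1) F(5) lam_nonneg[of "- n"] by (auto simp: M_def intro!: mult_pos_pos add_pos_nonneg)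
  show ?thesis
  proof (rule that[of "(norm (distribution_fourier S n))\<^sup>2 / M"])
    show "0 < (norm (distribution_fourier S n))\<^sup>2 / M" using n M by simp
    fix a assume a: "finite_support a" "\<And>z. z \<in> E \<Longrightarrow> 1 \<le> Re (trig_poly a z)"
    define \<psi> where "\<psi> = (\<lambda>z. complex_of_real (F (Re (trig_poly a z))))"
    have \<psi>: "\<psi> \<in> test_functions" unfolding \<psi>_def by (rule test_functions_compose[OF F(1) trig_poly_test])
    have e\<psi>: "(\<lambda>z. z powi (- n) * \<psi> z) \<in> test_functions" by (rule test_functions_mult[OF test_functions_powi \<psi>])
    have cont: "continuous_on circle (trig_poly a)"
      unfolding trig_poly_def[abs_def] by (intro continuous_intros) auto
    \<comment> \<open>Closed, so that it contains the closure in \<open>function_support\<close>,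
      and still disjoint from \<open>E\<close>: the gap between 1/2 and 1 provides both.\<close>
    let ?Z = "{z \<in> circle. Re (trig_poly a z) \<le> 1/2}"
    have "closed ?Z"
      by (intro continuous_closed_preimage_constant continuous_on_closed_Collect_le continuous_intros cont) auto
    moreover have "{z \<in> circle. z powi (- n) - z powi (- n) * \<psi> z \<noteq> 0} \<subseteq> ?Z"
    proof
      fix z assume z: "z \<in> {z \<in> circle. z powi (- n) - z powi (- n) * \<psi> z \<noteq> 0}"
      then have "\<psi> z \<noteq> 1" by auto
      then have "\<not> 1/2 \<le> Re (trig_poly a z)" using F(3)[of "Re (trig_poly a z)"] by (auto simp: \<psi>_def)
      then show "z \<in> ?Z" using z by auto
    qed
    ultimately have "function_support (\<lambda>z. z powi (- n) - z powi (- n) * \<psi> z) \<subseteq> ?Z"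
      unfolding function_support_def by (rule closure_minimal[rotated])
    moreover have "?Z \<inter> E = {}" using a(2) by force
    ultimately have "S (\<lambda>z. z powi (- n) - z powi (- n) * \<psi> z) = 0"
      by (intro distribution_eq_0_off_support[OF S(1,3)] test_functions_diff test_functions_powi e\<psi>) auto
    then have "distribution_fourier S n = S (\<lambda>z. z powi (- n) * \<psi> z)"
      using distribution_diff[OF S(1) test_functions_powi e\<psi>] by (simp add: distribution_fourier_def)
    then have "ennreal ((norm (distribution_fourier S n))\<^sup>2) \<le>
        ennreal K * energy (\<lambda>t. cis (of_int (- n) * t) * \<psi> (cis t))"
      using K(2)[OF e\<psi>] by (simp add: cis_power_int)
    also have "\<dots> \<le> ennreal K * (ennreal (2 + 2 * lam (- n)) * (ennreal (L\<^sup>2) * energy (\<lambda>t. trig_poly a (cis t))))"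
    proof (intro mult_left_mono)
      have "energy (\<lambda>t. cis (of_int (- n) * t) * \<psi> (cis t)) \<le> ennreal (2 + 2 * lam (- n)) * energy (\<lambda>t. \<psi> (cis t))"
        by (rule energy_modulation[OF measurable_test_function[OF \<psi>]])
      also have "\<dots> \<le> ennreal (2 + 2 * lam (- n)) * (ennreal (L\<^sup>2) * energy (\<lambda>t. trig_poly a (cis t)))"
        unfolding \<psi>_def using F measurable_test_function[OF trig_poly_test[of a]]
        by (intro mult_left_mono energy_contraction) auto
      finally show "energy (\<lambda>t. cis (of_int (- n) * t) * \<psi> (cis t)) \<le> \<dots>" .
    qed auto
    also have "\<dots> = ennreal (M * coeff_norm a)"
      unfolding energy_trig_poly[OF a(1)] M_def using K(1) lam_nonneg[of "- n"]
      by (simp add: ennreal_mult' mult.assoc)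
    finally have "(norm (distribution_fourier S n))\<^sup>2 \<le> M * coeff_norm a"
      using M lam_nonneg by (subst (asm) ennreal_le_iff)
        (auto simp: coeff_norm_def intro!: mult_nonneg_nonneg sum_nonneg add_nonneg_nonneg)
    then show "(norm (distribution_fourier S n))\<^sup>2 / M \<le> coeff_norm a"
      using M by (simp add: field_simps)
  qed
qed

end

section \<open>Positive functionals and measures\<close>

text \<open>\<open>b n\<close> stands for the value of a functional at z^n. Only real parts are
  compared because the variational argument is real-linear.\<close>

definition positive_on :: "complex set \<Rightarrow> (int \<Rightarrow> complex) \<Rightarrow> bool" where
  "positive_on E b \<longleftrightarrow> (\<forall>p. finite_support p \<longrightarrow> (\<forall>z\<in>E. 0 \<le> Re (trig_poly p z)) \<longrightarrow>
     0 \<le> Re (\<Sum>n | p n \<noteq> 0. p n * b n))"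

text \<open>Exponents may repeat here, as they do for the differences i - j in Fejer sums, for n and
  -n at n = 0, and when a polynomial is subtracted from a constant. Grouping equal exponents leads
  back to coefficient sequences.\<close>

lemma positive_on_family:
  assumes b: "positive_on E b" and I: "finite I"
    and pos: "\<And>z. z \<in> E \<Longrightarrow> 0 \<le> Re (\<Sum>i\<in>I. c i * z powi (f i))"
  shows "0 \<le> Re (\<Sum>i\<in>I. c i * b (f i))"
proof -
  define p where "p = (\<lambda>n. \<Sum>i | i \<in> I \<and> f i = n. c i)"
  have out: "p n = 0" if "n \<notin> f ` I" for n
  proof -
    have "{i. i \<in> I \<and> f i = n} = {}" using that by auto
    then show ?thesis by (simp only: p_def sum.empty)
  qed
  have group: "(\<Sum>n\<in>f ` I. p n * h n) = (\<Sum>i\<in>I. c i * h (f i))" for h :: "int \<Rightarrow> complex"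
  proof -
    have "(\<Sum>i\<in>I. c i * h (f i)) = (\<Sum>n\<in>f ` I. \<Sum>i | i \<in> I \<and> f i = n. c i * h (f i))"
      by (rule sum.group[symmetric]) (use I in auto)
    also have "\<dots> = (\<Sum>n\<in>f ` I. p n * h n)"
      unfolding p_def sum_distrib_right by (intro sum.cong refl) auto
    finally show ?thesis by simp
  qed
  have sub: "{n. p n \<noteq> 0} \<subseteq> f ` I" using out by blast
  have fs: "finite_support p" using I out by (intro finite_supportI[of "f ` I"]) auto
  have tp: "trig_poly p z = (\<Sum>i\<in>I. c i * z powi (f i))" for z
    using I sub group[of "\<lambda>n. z powi n"] by (subst trig_poly_eq[of "f ` I"]) auto
  have "(\<Sum>n | p n \<noteq> 0. p n * b n) = (\<Sum>n\<in>f ` I. p n * b n)"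
    using I sub by (intro sum.mono_neutral_left) auto
  then have "(\<Sum>n | p n \<noteq> 0. p n * b n) = (\<Sum>i\<in>I. c i * b (f i))" by (simp only: group)
  moreover have "0 \<le> Re (\<Sum>n | p n \<noteq> 0. p n * b n)"
    by (rule b[unfolded positive_on_def, rule_format, OF fs]) (simp only: tp pos)
  ultimately show ?thesis by simp
qed

text \<open>On the circle c z^n - cnj(c) z^(-n) is purely imaginary, so positivity applies to it and
  to its negative and forces real part 0. Taking for \<open>c\<close> the conjugate of b n -
  cnj(b(-n)) turns this real part into a squared modulus.\<close>

lemma positive_on_hermitian:
  assumes b: "positive_on E b" and E: "E \<subseteq> circle"
  shows "b (- n) = cnj (b n)"
proof -
  have Re_diff_cnj: "Re (w - cnj w) = 0" for w by simp
  have zero: "Re (c * b n - cnj c * b (- n)) = 0" for c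
  proof -
    have pm: "0 \<le> Re (s * c * b n + - (s * cnj c) * b (- n))" if "s \<in> \<real>" for s
    proof -
      have s: "cnj s = s" using that by (simp add: Reals_cnj_iff)
      have "0 \<le> Re (\<Sum>i\<in>{True, False}. (if i then s * c else - (s * cnj c)) * b (if i then n else - n))"
      proof (rule positive_on_family[OF b])
        fix z assume "z \<in> E"
        then have z: "z \<in> circle" using E by auto
        then have "inverse z = cnj z" by (simp add: inverse_eq_divide divide_conv_cnj)
        then have "z powi (- n) = cnj (z powi n)" by (simp add: power_int_minus flip: power_int_inverse)
        then have "s * c * z powi n + - (s * cnj c) * z powi (- n) = s * c * z powi n - cnj (s * c * z powi n)"
          using s by simp
        moreover have "(\<Sum>i\<in>{True, False}. (if i then s * c else - (s * cnj c)) * z powi (if i then n else - n)) =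
            s * c * z powi n + - (s * cnj c) * z powi (- n)" by simp
        ultimately show "0 \<le> Re (\<Sum>i\<in>{True, False}. (if i then s * c else - (s * cnj c)) * z powi (if i then n else - n))"
          using Re_diff_cnj by (simp only: order_refl)
      qed simp
      then show ?thesis by simp
    qed
    show ?thesis using pm[of 1] pm[of "-1"] by simp
  qed
  have "Re (c * (b n - cnj (b (- n)))) = 0" for c
    using zero[of c] by (simp add: algebra_simps)
  moreover have "Re (cnj y * y) = (Re y)\<^sup>2 + (Im y)\<^sup>2" for y :: complex
    by (simp add: power2_eq_square)
  ultimately have "b n - cnj (b (- n)) = 0"
    by (metis complex_eq_iff sum_power2_eq_zero_iff zero_complex.sel)
  then show ?thesis by (metis complex_cnj_cnj eq_iff_diff_eq_0)
qed

section \<open>The functional given by an element of least norm\<close>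

lemma norm_scale_add: "(norm (r *\<^sub>R u + t *\<^sub>R v))\<^sup>2 = r\<^sup>2 * (norm u)\<^sup>2 + 2 * r * t * Re (v * cnj u) + t\<^sup>2 * (norm v)\<^sup>2"
  for u v :: complex
  unfolding cmod_power2 by (simp add: cmod_power2 power2_eq_square algebra_simps)

context doubling_weight
begin

lemma coeff_norm_eq:
  assumes "finite A" "{n. a n \<noteq> 0} \<subseteq> A"
  shows "coeff_norm a = (\<Sum>n\<in>A. (1 + lam n) * (norm (a n))\<^sup>2)"
  unfolding coeff_norm_def using assms by (intro sum.mono_neutral_left) auto

lemma coeff_norm_nonneg: "0 \<le> coeff_norm a"
  unfolding coeff_norm_def using lam_nonneg by (auto intro!: sum_nonneg mult_nonneg_nonneg add_nonneg_nonneg)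

text \<open>The real inner product belonging to \<open>coeff_norm\<close>. The sum runs over the
  support of \<open>p\<close> alone, so that \<open>a\<close> may be a limit with infinite
  support.\<close>

definition coeff_inner :: "(int \<Rightarrow> complex) \<Rightarrow> (int \<Rightarrow> complex) \<Rightarrow> real" where
  "coeff_inner a p = (\<Sum>n | p n \<noteq> 0. (1 + lam n) * Re (p n * cnj (a n)))"

lemma coeff_norm_combination:
  assumes "finite_support a" "finite_support p"
  shows "coeff_norm (\<lambda>n. r *\<^sub>R a n + t *\<^sub>R p n) =
    r\<^sup>2 * coeff_norm a + 2 * r * t * coeff_inner a p + t\<^sup>2 * coeff_norm p"
proof -
  let ?A = "{n. a n \<noteq> 0} \<union> {n. p n \<noteq> 0}"
  have A: "finite ?A" using assms by (simp add: finite_support_def)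
  have i: "coeff_inner a p = (\<Sum>n\<in>?A. (1 + lam n) * Re (p n * cnj (a n)))"
    unfolding coeff_inner_def using A by (intro sum.mono_neutral_left) auto
  have s: "coeff_norm a = (\<Sum>n\<in>?A. (1 + lam n) * (norm (a n))\<^sup>2)"
    "coeff_norm p = (\<Sum>n\<in>?A. (1 + lam n) * (norm (p n))\<^sup>2)"
    using A by (intro coeff_norm_eq; auto)+
  have "coeff_norm (\<lambda>n. r *\<^sub>R a n + t *\<^sub>R p n) = (\<Sum>n\<in>?A. (1 + lam n) * (norm (r *\<^sub>R a n + t *\<^sub>R p n))\<^sup>2)"
    using A by (intro coeff_norm_eq) auto
  also have "\<dots> = r\<^sup>2 * coeff_norm a + 2 * r * t * coeff_inner a p + t\<^sup>2 * coeff_norm p"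
    unfolding s i norm_scale_add sum_distrib_left sum.distrib[symmetric]
    by (intro sum.cong refl) (simp add: algebra_simps)
  finally show ?thesis .
qed

lemma trig_poly_combination:
  assumes "finite_support a" "finite_support p"
  shows "finite_support (\<lambda>n. r *\<^sub>R a n + t *\<^sub>R p n)"
    "trig_poly (\<lambda>n. r *\<^sub>R a n + t *\<^sub>R p n) z = r *\<^sub>R trig_poly a z + t *\<^sub>R trig_poly p z"
proof -
  let ?A = "{n. a n \<noteq> 0} \<union> {n. p n \<noteq> 0}"
  have A: "finite ?A" using assms by (simp add: finite_support_def)
  then show "finite_support (\<lambda>n. r *\<^sub>R a n + t *\<^sub>R p n)" by (rule finite_supportI) auto
  show "trig_poly (\<lambda>n. r *\<^sub>R a n + t *\<^sub>R p n) z = r *\<^sub>R trig_poly a z + t *\<^sub>R trig_poly p z"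
    using A by (subst (1 2 3) trig_poly_eq[of ?A])
      (auto simp: scaleR_sum_right sum.distrib[symmetric] distrib_right)
qed

text \<open>The functional is \<open>p \<mapsto> \<langle>p, \<alpha>\<rangle>\<close>, where \<open>\<alpha>\<close> is the limit of a minimizing sequence for the norm on
  the convex set \<open>{p. Re p \<ge> 1 on E}\<close>: this set is stable under adding \<open>t p\<close> with \<open>Re p \<ge> 0\<close> on \<open>E\<close>
  and \<open>t \<ge> 0\<close>, whence positivity.\<close>

lemma positive_functional:
  assumes d: "0 < d" "\<And>a. finite_support a \<Longrightarrow> (\<And>z. z \<in> E \<Longrightarrow> 1 \<le> Re (trig_poly a z)) \<Longrightarrow> d \<le> coeff_norm a"
    and E: "E \<subseteq> circle"
  obtains b M where "positive_on E b" "b 0 = 1"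
    "\<And>A. finite A \<Longrightarrow> (\<Sum>n\<in>A. (norm (b n))\<^sup>2 / (1 + lam n)) \<le> M"
proof -
  define X where "X = {a. finite_support a \<and> (\<forall>z\<in>E. 1 \<le> Re (trig_poly a z))}"
  define one where "one = (\<lambda>n::int. if n = 0 then (1::complex) else 0)"
  have one: "finite_support one" "trig_poly one z = 1" for z
    by (rule finite_supportI[of "{0}"], auto simp: one_def) (subst trig_poly_eq[of "{0}"], auto simp: one_def)
  have one_norm: "coeff_norm one = 1 + lam 0" "coeff_inner a one = (1 + lam 0) * Re (a 0)" for a
    by (subst coeff_norm_eq[of "{0}"]) (auto simp: one_def coeff_inner_def)
  have one_X: "one \<in> X" using one by (simp add: X_def)
  define \<mu> where "\<mu> = Inf (coeff_norm ` X)"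
  have bdd: "bdd_below (coeff_norm ` X)" using coeff_norm_nonneg by (intro bdd_belowI[of _ 0]) auto
  have \<mu>_le: "\<mu> \<le> coeff_norm a" if "a \<in> X" for a unfolding \<mu>_def using bdd that by (intro cInf_lower) auto
  have \<mu>_ge: "d \<le> \<mu>" unfolding \<mu>_def using one_X d(2) by (intro cInf_greatest) (auto simp: X_def)
  have \<mu>_pos: "0 < \<mu>" using d(1) \<mu>_ge by simp
  have "\<exists>a\<in>X. coeff_norm a < \<mu> + 1 / (real k + 1)" for k
    using cInf_lessD[of "coeff_norm ` X" "\<mu> + 1 / (real k + 1)"] one_X by (auto simp: \<mu>_def)
  then obtain a where a: "\<And>k. a k \<in> X" "\<And>k. coeff_norm (a k) < \<mu> + 1 / (real k + 1)" by metis
  have fin: "finite_support (a k)" for k using a(1) by (auto simp: X_def)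
  have lim1: "(\<lambda>k. 1 / (real k + 1)) \<longlonglongrightarrow> 0" by real_asymp
  have lim_norm: "(\<lambda>k. coeff_norm (a k)) \<longlonglongrightarrow> \<mu>"
  proof (rule tendsto_sandwich[of "\<lambda>_. \<mu>"])
    show "(\<lambda>k. \<mu> + 1 / (real k + 1)) \<longlonglongrightarrow> \<mu>" using tendsto_add[OF tendsto_const lim1] by simp
    show "\<forall>\<^sub>F k in sequentially. coeff_norm (a k) \<le> \<mu> + 1 / (real k + 1)"
      using a(2) by (intro always_eventually allI less_imp_le)
  qed (use \<mu>_le a(1) in auto)
  \<comment> \<open>Parallelogram law: the midpoint lies in \<open>X\<close>, so its squared norm is
    at least \<mu>, which makes the half difference small. Since 1 + lam n \<ge> 1, this bounds each
    coefficient.\<close>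
  have diff: "(norm (a k n - a l n))\<^sup>2 \<le> 2 * (1 / (real k + 1) + 1 / (real l + 1))" for k l n
  proof -
    let ?m = "\<lambda>n. (1/2) *\<^sub>R a k n + (1/2) *\<^sub>R a l n" and ?d = "\<lambda>n. (1/2) *\<^sub>R a k n + (-1/2) *\<^sub>R a l n"
    have m: "finite_support ?m" "\<And>z. trig_poly ?m z = (1/2) *\<^sub>R trig_poly (a k) z + (1/2) *\<^sub>R trig_poly (a l) z"
      using trig_poly_combination[OF fin fin] by blast+
    have "?m \<in> X"
    proof -
      have "1 \<le> Re (trig_poly ?m z)" if "z \<in> E" for z
      proof -
        have "1 \<le> Re (trig_poly (a k) z)" "1 \<le> Re (trig_poly (a l) z)" using a(1) that by (auto simp: X_def)
        then show ?thesis unfolding m(2) by simp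
      qed
      then show ?thesis using m(1) by (simp add: X_def)
    qed
    then have "\<mu> \<le> coeff_norm ?m" by (rule \<mu>_le)
    moreover have "coeff_norm ?m + coeff_norm ?d = (coeff_norm (a k) + coeff_norm (a l)) / 2"
      unfolding coeff_norm_combination[OF fin fin] by (simp add: power2_eq_square)
    ultimately have "coeff_norm ?d \<le> (1 / (real k + 1) + 1 / (real l + 1)) / 2"
      using a(2)[of k] a(2)[of l] by simp
    moreover have "(norm (?d n))\<^sup>2 \<le> coeff_norm ?d"
    proof (cases "?d n = 0")
      case False
      have fd: "finite {n. ?d n \<noteq> 0}" using trig_poly_combination(1)[OF fin fin] by (simp only: finite_support_def)
      have "1 * (norm (?d n))\<^sup>2 \<le> (1 + lam n) * (norm (?d n))\<^sup>2" using lam_nonneg by (intro mult_right_mono) auto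
      also have "\<dots> \<le> coeff_norm ?d" unfolding coeff_norm_def
        by (rule member_le_sum[of n]) (use False fd lam_nonneg in \<open>auto intro!: mult_nonneg_nonneg add_nonneg_nonneg\<close>)
      finally show ?thesis by simp
    qed (simp add: coeff_norm_nonneg)
    moreover have "(norm (?d n))\<^sup>2 = (norm (a k n - a l n))\<^sup>2 / 4"
    proof -
      have "?d n = (1/2) *\<^sub>R (a k n - a l n)" by (simp add: algebra_simps)
      then show ?thesis by (simp only: norm_scaleR power_mult_distrib) (simp add: power_divide)
    qed
    ultimately show ?thesis by simp
  qed
  have "Cauchy (\<lambda>k. a k n)" for n
  proof (rule metric_CauchyI)
    fix e :: real assume e: "0 < e"
    obtain N where N: "4 / e\<^sup>2 < real N" using reals_Archimedean2 by blast
    have "dist (a k n) (a l n) < e" if "N \<le> k" "N \<le> l" for k l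
    proof -
      have "4 < e\<^sup>2 * real N" using N e by (simp add: field_simps)
      also have "\<dots> \<le> e\<^sup>2 * (real N + 1)" by (intro mult_left_mono) auto
      finally have "4 < e\<^sup>2 * (real N + 1)" .
      then have "4 / (real N + 1) < e\<^sup>2" by (simp add: field_simps)
      moreover have "1 / (real k + 1) \<le> 1 / (real N + 1)" "1 / (real l + 1) \<le> 1 / (real N + 1)"
        using that by (auto intro!: divide_left_mono)
      ultimately have "(norm (a k n - a l n))\<^sup>2 < e\<^sup>2" using diff[of k n l] by simp
      then show ?thesis using e by (simp add: dist_norm power_less_imp_less_base)
    qed
    then show "\<exists>N. \<forall>k\<ge>N. \<forall>l\<ge>N. dist (a k n) (a l n) < e" by blast
  qed
  \<comment> \<open>A coefficientwise limit suffices: pairing with a finitely supported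
    \<open>p\<close> involves finitely many coefficients.\<close>
  then obtain \<alpha> where \<alpha>: "\<And>n. (\<lambda>k. a k n) \<longlonglongrightarrow> \<alpha> n"
    unfolding Cauchy_convergent_iff convergent_def by metis
  have lim_inner: "(\<lambda>k. coeff_inner (a k) p) \<longlonglongrightarrow> coeff_inner \<alpha> p" for p
    unfolding coeff_inner_def by (intro tendsto_intros \<alpha>)
  have pos: "0 \<le> coeff_inner \<alpha> p" if p: "finite_support p" "\<And>z. z \<in> E \<Longrightarrow> 0 \<le> Re (trig_poly p z)" for p
  proof -
    have "0 \<le> coeff_inner \<alpha> p + t" if t: "0 < t" for t
    proof -
      \<comment> \<open>Step length of the variation a k + s p: after division by 2 s the minimality
        inequality reads 0 \<le> \<open>coeff_inner \<alpha> p\<close> + (s/2)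
        \<open>coeff_norm p\<close>, and the last term is at most t. The 1 guards against division
        by 0.\<close>
      define s where "s = 2 * t / (coeff_norm p + 1)"
      have s: "0 < s" "s * coeff_norm p \<le> 2 * t"
        using t coeff_norm_nonneg[of p] by (auto simp: s_def field_simps intro!: divide_pos_pos add_nonneg_pos)
      have "\<mu> \<le> coeff_norm (a k) + 2 * s * coeff_inner (a k) p + s\<^sup>2 * coeff_norm p" for k
      proof -
        have "(\<lambda>n. 1 *\<^sub>R a k n + s *\<^sub>R p n) \<in> X"
          unfolding X_def mem_Collect_eq trig_poly_combination(2)[OF fin p(1)]
        proof (intro conjI ballI trig_poly_combination(1)[OF fin p(1)])
          fix z assume z: "z \<in> E"
          have "1 \<le> Re (trig_poly (a k) z)" using a(1)[of k] z by (simp add: X_def)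
          moreover have "0 \<le> s * Re (trig_poly p z)" using s p(2)[OF z] by simp
          ultimately show "1 \<le> Re (1 *\<^sub>R trig_poly (a k) z + s *\<^sub>R trig_poly p z)" by simp
        qed
        from \<mu>_le[OF this] show ?thesis unfolding coeff_norm_combination[OF fin p(1)] by simp
      qed
      moreover have "(\<lambda>k. coeff_norm (a k) + 2 * s * coeff_inner (a k) p + s\<^sup>2 * coeff_norm p) \<longlonglongrightarrow>
         \<mu> + 2 * s * coeff_inner \<alpha> p + s\<^sup>2 * coeff_norm p"
        by (intro tendsto_intros lim_norm lim_inner)
      ultimately have "\<mu> \<le> \<mu> + 2 * s * coeff_inner \<alpha> p + s\<^sup>2 * coeff_norm p"
        by (intro LIMSEQ_le_const) auto
      then have "0 \<le> s * (2 * coeff_inner \<alpha> p + s * coeff_norm p)"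
        by (simp add: power2_eq_square algebra_simps)
      then have "0 \<le> 2 * coeff_inner \<alpha> p + s * coeff_norm p" using s(1) by (simp add: zero_le_mult_iff)
      then show ?thesis using s(2) by linarith
    qed
    then show ?thesis by (rule field_le_epsilon)
  qed
  define \<nu> where "\<nu> = (1 + lam 0) * Re (\<alpha> 0)"
  have \<nu>: "0 < \<nu>"
  proof -
    \<comment> \<open>Minimality is tested on (1 - s) a k + s; for this \<open>s\<close> it reduces
      to \<mu> \<le> 2 (1 - s) \<nu>, so \<mu> > 0 yields \<nu> > 0.\<close>
    define s where "s = \<mu> / (\<mu> + (1 + lam 0))"
    have s: "0 < s" "s < 1" "s * (\<mu> + (1 + lam 0)) = \<mu>"
      using \<mu>_pos lam_nonneg[of 0] by (auto simp: s_def field_simps)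
    have "\<mu> \<le> (1 - s)\<^sup>2 * coeff_norm (a k) + 2 * (1 - s) * s * coeff_inner (a k) one + s\<^sup>2 * coeff_norm one" for k
    proof -
      have "(\<lambda>n. (1 - s) *\<^sub>R a k n + s *\<^sub>R one n) \<in> X"
        unfolding X_def mem_Collect_eq trig_poly_combination(2)[OF fin one(1)]
      proof (intro conjI ballI trig_poly_combination(1)[OF fin one(1)])
        fix z assume z: "z \<in> E"
        have "(1 - s) * 1 \<le> (1 - s) * Re (trig_poly (a k) z)"
          using a(1)[of k] z s by (intro mult_left_mono) (auto simp: X_def)
        then show "1 \<le> Re ((1 - s) *\<^sub>R trig_poly (a k) z + s *\<^sub>R trig_poly one z)" by (simp add: one)
      qed
      from \<mu>_le[OF this] show ?thesis unfolding coeff_norm_combination[OF fin one(1)] .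
    qed
    moreover have "(\<lambda>k. (1 - s)\<^sup>2 * coeff_norm (a k) + 2 * (1 - s) * s * coeff_inner (a k) one + s\<^sup>2 * coeff_norm one) \<longlonglongrightarrow>
       (1 - s)\<^sup>2 * \<mu> + 2 * (1 - s) * s * coeff_inner \<alpha> one + s\<^sup>2 * coeff_norm one"
      by (intro tendsto_intros lim_norm lim_inner)
    ultimately have "\<mu> \<le> (1 - s)\<^sup>2 * \<mu> + 2 * (1 - s) * s * coeff_inner \<alpha> one + s\<^sup>2 * coeff_norm one"
      by (intro LIMSEQ_le_const) auto
    then have "0 \<le> s * (2 * (1 - s) * \<nu> - 2 * \<mu> + s * (\<mu> + (1 + lam 0)))"
      unfolding one_norm \<nu>_def by (simp add: power2_eq_square algebra_simps)
    then have "\<mu> \<le> 2 * (1 - s) * \<nu>" using s by (simp add: zero_le_mult_iff)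
    then have "0 < 2 * (1 - s) * \<nu>" using \<mu>_pos by simp
    then show ?thesis using s by (simp add: zero_less_mult_iff)
  qed
  \<comment> \<open>The coefficients of the pairing with \<alpha>, divided by its value \<nu> at the
    constant 1. Thus \<bar>b n\<bar>^2 / (1 + lam n) = (1 + lam n) \<bar>\<alpha> n\<bar>^2 /
    \<nu>^2, and finite sums of these are limits of sums bounded by
    \<open>coeff_norm (a k)\<close>.\<close>
  define b where "b = (\<lambda>n. ((1 + lam n) / \<nu>) *\<^sub>R cnj (\<alpha> n))"
  have inner_b: "Re (\<Sum>n | p n \<noteq> 0. p n * b n) = coeff_inner \<alpha> p / \<nu>" for p
    unfolding coeff_inner_def b_def Re_sum sum_divide_distrib
    by (intro sum.cong refl) (simp add: algebra_simps add_divide_distrib diff_divide_distrib)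
  have b_pos: "positive_on E b"
    unfolding positive_on_def inner_b using pos \<nu> by auto
  have "Re (b 0) = \<nu> / \<nu>" by (simp add: b_def \<nu>_def)
  then have "Re (b 0) = 1" using \<nu> by simp
  moreover have "Im (b 0) = 0" using positive_on_hermitian[OF b_pos E, of 0] by (simp add: complex_eq_iff)
  ultimately have "b 0 = 1" by (simp add: complex_eq_iff)
  moreover have "(\<Sum>n\<in>A. (norm (b n))\<^sup>2 / (1 + lam n)) \<le> (\<mu> + 1) / \<nu>\<^sup>2" if A: "finite A" for A
  proof -
    have "(\<lambda>k. \<Sum>n\<in>A. (1 + lam n) * (norm (a k n))\<^sup>2) \<longlonglongrightarrow> (\<Sum>n\<in>A. (1 + lam n) * (norm (\<alpha> n))\<^sup>2)"
      by (intro tendsto_intros \<alpha>)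
    moreover have "(\<Sum>n\<in>A. (1 + lam n) * (norm (a k n))\<^sup>2) \<le> \<mu> + 1" for k
    proof -
      have "(\<Sum>n\<in>A. (1 + lam n) * (norm (a k n))\<^sup>2) \<le> (\<Sum>n\<in>A \<union> {n. a k n \<noteq> 0}. (1 + lam n) * (norm (a k n))\<^sup>2)"
        using A fin[of k] lam_nonneg by (intro sum_mono2) (auto simp: finite_support_def intro!: mult_nonneg_nonneg add_nonneg_nonneg)
      also have "\<dots> = coeff_norm (a k)"
        using A fin[of k] by (intro coeff_norm_eq[symmetric]) (auto simp: finite_support_def)
      also have "\<dots> \<le> \<mu> + 1 / (real k + 1)" using a(2)[of k] by simp
      also have "\<dots> \<le> \<mu> + 1" by simp
      finally show ?thesis .
    qed
    ultimately have le: "(\<Sum>n\<in>A. (1 + lam n) * (norm (\<alpha> n))\<^sup>2) \<le> \<mu> + 1" by (intro LIMSEQ_le_const2) auto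
    have "(norm (b n))\<^sup>2 / (1 + lam n) = (1 + lam n) * (norm (\<alpha> n))\<^sup>2 / \<nu>\<^sup>2" for n
    proof -
      have "0 < 1 + lam n" using lam_nonneg[of n] by simp
      then show ?thesis using \<nu>
        by (simp add: b_def power_mult_distrib power_divide power2_eq_square)
    qed
    then have "(\<Sum>n\<in>A. (norm (b n))\<^sup>2 / (1 + lam n)) = (\<Sum>n\<in>A. (1 + lam n) * (norm (\<alpha> n))\<^sup>2) / \<nu>\<^sup>2"
      by (simp add: sum_divide_distrib)
    also have "\<dots> \<le> (\<mu> + 1) / \<nu>\<^sup>2" using le by (rule divide_right_mono) simp
    finally show ?thesis .
  qed
  ultimately show ?thesis using that b_pos by blast
qed

end

section \<open>Herglotz' theorem through Fejer sums\<close>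

lemma card_difference_eq:
  "card {p \<in> {..<N} \<times> {..<N}. int (fst p) - int (snd p) = m} = N - nat \<bar>m\<bar>"
proof (cases "0 \<le> m")
  case True
  have "{p \<in> {..<N} \<times> {..<N}. int (fst p) - int (snd p) = m} = (\<lambda>j. (j + nat m, j)) ` {..<N - nat m}"
    using True by (auto simp: image_iff)
  then show ?thesis using True by (simp add: card_image inj_on_def)
next
  case False
  have "{p \<in> {..<N} \<times> {..<N}. int (fst p) - int (snd p) = m} = (\<lambda>i. (i, i + nat (- m))) ` {..<N - nat (- m)}"
    using False by (auto simp: image_iff)
  then show ?thesis using False by (simp add: card_image inj_on_def)
qed

text \<open>The Fejer mean \<Sum> (1 - \<bar>m\<bar>/N) b(m) e^(-imt) over \<bar>m\<bar> < N, left
  as a sum over pairs because positivity is visible in this form.\<close>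

definition fejer_sum :: "(int \<Rightarrow> complex) \<Rightarrow> nat \<Rightarrow> real \<Rightarrow> complex" where
  "fejer_sum b N t = (\<Sum>p\<in>{..<N} \<times> {..<N}. b (int (fst p) - int (snd p)) *
     cis (of_int (- (int (fst p) - int (snd p))) * t)) / of_nat N"

text \<open>With z^m in place of b(m) the double sum is \<bar>\<Sum> (z e^(-it))^i\<bar>^2 \<ge> 0
  for \<open>z\<close> on the circle, and \<open>b\<close> preserves positivity.\<close>

lemma fejer_sum_nonneg:
  assumes b: "positive_on E b" and E: "E \<subseteq> circle"
  shows "0 \<le> Re (fejer_sum b N t)"
proof -
  let ?I = "{..<N} \<times> {..<N}" and ?f = "\<lambda>p. int (fst p) - int (snd p)"
  have "0 \<le> Re (\<Sum>p\<in>?I. cis (of_int (- ?f p) * t) * b (?f p))"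
  proof (rule positive_on_family[OF b])
    fix z assume "z \<in> E"
    then have z: "norm z = 1" "z \<noteq> 0" using E by auto
    define u where "u = z * cis (- t)"
    have u: "norm u = 1" "u \<noteq> 0" using z by (auto simp: u_def norm_mult)
    then have inv: "inverse u = cnj u" by (simp add: inverse_eq_divide divide_conv_cnj)
    have "cis (of_int (- ?f p) * t) * z powi ?f p = u ^ fst p * cnj (u ^ snd p)" for p
    proof -
      have "cis (of_int (- ?f p) * t) * z powi ?f p = u powi ?f p"
        by (simp add: u_def power_int_mult_distrib cis_power_int algebra_simps)
      also have "\<dots> = u powi int (fst p) * inverse (u powi int (snd p))"
        using u by (simp add: power_int_diff divide_inverse)
      also have "\<dots> = u ^ fst p * cnj (u ^ snd p)" using inv by (simp add: power_inverse[symmetric])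
      finally show ?thesis .
    qed
    then have "(\<Sum>p\<in>?I. cis (of_int (- ?f p) * t) * z powi ?f p) = (\<Sum>p\<in>?I. u ^ fst p * cnj (u ^ snd p))"
      by simp
    also have "\<dots> = (\<Sum>i<N. u ^ i) * cnj (\<Sum>j<N. u ^ j)"
      unfolding cnj_sum sum_product sum.cartesian_product by (simp add: case_prod_beta)
    also have "\<dots> = of_real ((norm (\<Sum>i<N. u ^ i))\<^sup>2)" by (rule complex_norm_square[symmetric])
    finally show "0 \<le> Re (\<Sum>p\<in>?I. cis (of_int (- ?f p) * t) * z powi ?f p)" by (simp only: Re_complex_of_real zero_le_power2)
  qed simp
  then have "0 \<le> Re (\<Sum>p\<in>?I. b (?f p) * cis (of_int (- ?f p) * t))" by (simp only: mult.commute)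
  then show ?thesis unfolding fejer_sum_def Re_divide_of_nat by (rule divide_nonneg_nonneg) simp
qed

lemma fejer_sum_real:
  assumes "\<And>n. b (- n) = cnj (b n)"
  shows "fejer_sum b N t = of_real (Re (fejer_sum b N t))"
proof -
  let ?I = "{..<N} \<times> {..<N}" and ?f = "\<lambda>p. int (fst p) - int (snd p)"
  have "cnj (\<Sum>p\<in>?I. b (?f p) * cis (of_int (- ?f p) * t)) = (\<Sum>p\<in>?I. b (- ?f p) * cis (of_int (?f p) * t))"
    unfolding cnj_sum by (intro sum.cong refl) (simp only: assms complex_cnj_mult cis_cnj of_int_minus mult_minus_left minus_minus)
  also have "\<dots> = (\<Sum>p\<in>?I. b (?f p) * cis (of_int (- ?f p) * t))"
    by (rule sum.reindex_bij_witness[of _ prod.swap prod.swap]) auto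
  finally have "cnj (fejer_sum b N t) = fejer_sum b N t" by (simp add: fejer_sum_def)
  then show ?thesis by (simp add: complex_eq_iff)
qed

lemma fejer_sum_bound: "norm (fejer_sum b N t) \<le> (\<Sum>p\<in>{..<N} \<times> {..<N}. norm (b (int (fst p) - int (snd p)))) / real N"
  unfolding fejer_sum_def norm_divide norm_of_nat
  by (intro divide_right_mono order_trans[OF norm_sum]) (auto simp: norm_mult)

lemma measurable_fejer_sum [measurable]: "fejer_sum b N \<in> borel_measurable borel"
  unfolding fejer_sum_def[abs_def] by measurable

lemma integral_fejer_sum_cis:
  "(LINT t|angle_measure. fejer_sum b N t * cis (of_int m * t)) = b m * of_nat (N - nat \<bar>m\<bar>) / of_nat N"
proof -
  let ?I = "{..<N} \<times> {..<N}" and ?f = "\<lambda>p. int (fst p) - int (snd p)"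
  have "fejer_sum b N t * cis (of_int m * t) = (\<Sum>p\<in>?I. b (?f p) * cis (of_int (m - ?f p) * t)) / of_nat N" for t
  proof -
    have "cis (of_int (- ?f p) * t) * cis (of_int m * t) = cis (of_int (m - ?f p) * t)" for p
      by (simp add: cis_mult algebra_simps)
    then show ?thesis by (simp add: fejer_sum_def sum_distrib_right mult.assoc)
  qed
  then have "(LINT t|angle_measure. fejer_sum b N t * cis (of_int m * t)) =
     (\<Sum>p\<in>?I. b (?f p) * (if m - ?f p = 0 then 1 else 0)) / of_nat N"
    by (simp only: Bochner_Integration.integral_sum integrable_angle_cis integral_cis_angle
          Bochner_Integration.integral_divide_zero Bochner_Integration.integral_mult_right_zero)
  also have "(\<Sum>p\<in>?I. b (?f p) * (if m - ?f p = 0 then 1 else 0)) = (\<Sum>p | p \<in> ?I \<and> ?f p = m. b m)"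
    by (rule sum.mono_neutral_cong_right) auto
  finally show ?thesis by (simp add: card_difference_eq)
qed

text \<open>Herglotz' theorem: the measure is a weak limit of the Fejer densities.\<close>

lemma positive_on_measure:
  assumes b: "positive_on E b" "b 0 = 1" and E: "E \<subseteq> circle"
  obtains M where "real_distribution M" "\<And>m. (LINT t|M. cis (of_int m * t)) = b m"
proof -
  have herm: "\<And>n. b (- n) = cnj (b n)" by (rule positive_on_hermitian[OF b(1) E])
  \<comment> \<open>\<open>Suc k\<close> keeps N positive: for N = 0 the sum is 0 and its mass would
    not be 1.\<close>
  define \<sigma> where "\<sigma> = (\<lambda>k t. Re (fejer_sum b (Suc k) t))"
  have \<sigma>0: "0 \<le> \<sigma> k t" for k t unfolding \<sigma>_def by (rule fejer_sum_nonneg[OF b(1) E])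
  have \<sigma>_eq: "complex_of_real (\<sigma> k t) = fejer_sum b (Suc k) t" for k t
    unfolding \<sigma>_def by (rule fejer_sum_real[symmetric]) (rule herm)
  have [measurable]: "\<sigma> k \<in> borel_measurable borel" for k unfolding \<sigma>_def by measurable
  define \<mu> where "\<mu> = (\<lambda>k. density angle_measure (\<lambda>t. ennreal (\<sigma> k t)))"
  have int_\<sigma>: "integrable angle_measure (\<sigma> k)" for k
  proof (rule angle.integrable_const_bound)
    show "AE t in angle_measure. norm (\<sigma> k t) \<le> (\<Sum>p\<in>{..<Suc k} \<times> {..<Suc k}. norm (b (int (fst p) - int (snd p)))) / real (Suc k)"
      using fejer_sum_bound[of b "Suc k"] abs_Re_le_cmod by (auto simp: \<sigma>_def intro: order_trans)
  qed simp
  have \<mu>_int: "(LINT t|\<mu> k. cis (of_int m * t)) = b m * of_nat (Suc k - nat \<bar>m\<bar>) / of_nat (Suc k)" for k m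
  proof -
    have "(LINT t|\<mu> k. cis (of_int m * t)) = (LINT t|angle_measure. \<sigma> k t *\<^sub>R cis (of_int m * t))"
      unfolding \<mu>_def using \<sigma>0 by (intro integral_density) auto
    also have "\<dots> = (LINT t|angle_measure. fejer_sum b (Suc k) t * cis (of_int m * t))"
      by (simp only: scaleR_conv_of_real \<sigma>_eq)
    finally show ?thesis by (simp only: integral_fejer_sum_cis)
  qed
  have "emeasure (\<mu> k) (space (\<mu> k)) = 1" for k
  proof -
    have "complex_of_real (LINT t|angle_measure. \<sigma> k t) = 1"
      using integral_fejer_sum_cis[of b "Suc k" 0] b(2)
      by (simp only: integral_complex_of_real[symmetric] \<sigma>_eq) (simp del: of_nat_Suc)
    then have "(LINT t|angle_measure. \<sigma> k t) = 1" by simp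
    then have "(\<integral>\<^sup>+t. ennreal (\<sigma> k t) \<partial>angle_measure) = 1"
      using nn_integral_eq_integral[OF int_\<sigma>[of k]] \<sigma>0 by simp
    then show ?thesis unfolding \<mu>_def by (subst emeasure_density) auto
  qed
  then have prob: "prob_space (\<mu> k)" for k by (intro prob_spaceI)
  have sets_\<mu>: "sets (\<mu> k) = sets borel" for k by (simp add: \<mu>_def)
  have rd: "real_distribution (\<mu> k)" for k
    using prob sets_\<mu> by (simp add: real_distribution_def real_distribution_axioms_def)
  \<comment> \<open>All these measures live on [0, 2 pi], inside (-1, 7], whence tightness.\<close>
  have "measure (\<mu> k) {-1<..7} = 1" for k
  proof -
    interpret k: prob_space "\<mu> k" by (rule prob)
    have "AE t in lborel. 0 < ennreal (indicator {0..2 * pi} t / (2 * pi)) \<longrightarrow> t \<in> {-1<..7}"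
      using pi_less_4 pi_approx by (auto simp: indicator_def)
    then have "AE t in angle_measure. t \<in> {-1<..7}"
      unfolding angle_measure_def by (subst AE_density) auto
    then have "AE t in \<mu> k. t \<in> {-1<..7}"
      unfolding \<mu>_def by (subst AE_density) auto
    then show ?thesis using sets_\<mu>[of k] by (subst k.prob_eq_1) auto
  qed
  then have "\<exists>a b. a < b \<and> (\<forall>k. 1 - \<epsilon> < measure (\<mu> k) {a<..b})" if "0 < \<epsilon>" for \<epsilon> :: real
    using that by (intro exI[of _ "-1"] exI[of _ 7]) auto
  then have "tight \<mu>" using rd by (auto simp: tight_def)
  then obtain r M where r: "strict_mono (r :: nat \<Rightarrow> nat)" "real_distribution M" "weak_conv_m (\<mu> \<circ> id \<circ> r) M"
    using tight_imp_convergent_subsubsequence[of \<mu> id] by (auto simp: strict_mono_id)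
  have "(LINT t|M. cis (of_int m * t)) = b m" for m
  proof -
    have cont: "isCont (\<lambda>t. cis (of_int m * t)) x" for x
      by (rule has_vector_derivative_continuous[OF has_vector_derivative_cis_mult])
    have "(\<lambda>k. LINT t|(\<mu> \<circ> id \<circ> r) k. cis (of_int m * t)) \<longlonglongrightarrow> (LINT t|M. cis (of_int m * t))"
      by (rule weak_conv_imp_integral_bdd_continuous_conv[OF _ r(2,3) cont, of 1]) (use rd in auto)
    moreover have "(\<lambda>k. LINT t|(\<mu> \<circ> id \<circ> r) k. cis (of_int m * t)) \<longlonglongrightarrow> b m"
    proof -
      have "(\<lambda>k. 1 - real (nat \<bar>m\<bar>) / real (Suc k)) \<longlonglongrightarrow> 1" by real_asymp
      then have "(\<lambda>k. real (Suc k - nat \<bar>m\<bar>) / real (Suc k)) \<longlonglongrightarrow> 1"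
      proof (rule Lim_transform_eventually)
        show "\<forall>\<^sub>F k in sequentially. 1 - real (nat \<bar>m\<bar>) / real (Suc k) = real (Suc k - nat \<bar>m\<bar>) / real (Suc k)"
          using eventually_ge_at_top[of "nat \<bar>m\<bar>"] by eventually_elim (simp add: of_nat_diff diff_divide_distrib)
      qed
      then have "(\<lambda>k. b m * of_real (real (Suc k - nat \<bar>m\<bar>) / real (Suc k))) \<longlonglongrightarrow> b m * of_real 1"
        by (intro tendsto_intros)
      then have "(\<lambda>k. LINT t|\<mu> k. cis (of_int m * t)) \<longlonglongrightarrow> b m"
        unfolding \<mu>_int by simp
      from LIMSEQ_subseq_LIMSEQ[OF this r(1)] show ?thesis by (simp add: o_def)
    qed
    ultimately show ?thesis by (rule LIMSEQ_unique)
  qed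
  then show ?thesis using that r(2) by blast
qed

section \<open>The measure on the circle and its support\<close>

lemma measure_on_circle:
  assumes b: "positive_on E b" "b 0 = 1" and E: "E \<subseteq> circle" "closed E" "E \<noteq> {}"
  obtains \<mu> where "prob_space \<mu>" "sets \<mu> = sets circle_borel" "measure_support \<mu> \<subseteq> E"
    "\<And>n. measure_fourier \<mu> n = b (- n)"
proof -
  obtain M where M: "real_distribution M" "\<And>m. (LINT t|M. cis (of_int m * t)) = b m"
    using positive_on_measure[OF b E(1)] by metis
  interpret M: real_distribution M by (rule M(1))
  have intM: "integrable M (\<lambda>t. c * cis (of_int n * t))" for c n
    by (intro integrable_mult_right M.integrable_const_bound[of _ 1]) auto
  have cis_circle [measurable]: "cis \<in> measurable M circle_borel"
    unfolding circle_borel_def by (rule measurable_restrict_space2) auto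
  define \<mu> where "\<mu> = distr M circle_borel cis"
  have "prob_space \<mu>" unfolding \<mu>_def by (rule M.prob_space_distr[OF cis_circle])
  moreover have "sets \<mu> = sets circle_borel" by (simp add: \<mu>_def)
  moreover have "measure_fourier \<mu> n = b (- n)" for n
  proof -
    have "(\<lambda>z. z powi (- n)) \<in> borel_measurable circle_borel"
      unfolding circle_borel_def
      by (intro borel_measurable_continuous_on_restrict continuous_intros) auto
    then have "measure_fourier \<mu> n = (LINT t|M. cis t powi (- n))"
      unfolding measure_fourier_def \<mu>_def by (rule integral_distr[OF cis_circle])
    then show ?thesis using M(2)[of "- n"] by (simp only: cis_power_int)
  qed
  moreover have "measure_support \<mu> \<subseteq> E"
  proof -
    \<comment> \<open>The distance to \<open>E\<close> vanishes on \<open>E\<close>, so a polynomial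
      within \<epsilon>/2 of it has real part at most \<epsilon>/2 on \<open>E\<close>. Positivity
      of \<open>b\<close> bounds the integral of this real part by \<epsilon>/2, hence that of the
      distance by \<epsilon>, and so cis t lies in \<open>E\<close> almost surely.\<close>
    define g where "g = (\<lambda>t. infdist (cis t) E)"
    have g_cont: "continuous_on UNIV g" unfolding g_def by (intro continuous_intros)
    then have [measurable]: "g \<in> borel_measurable borel" by (rule borel_measurable_continuous_onI)
    have g0: "0 \<le> g t" for t by (simp add: g_def infdist_nonneg)
    have approx: "integrable M g \<and> (LINT t|M. g t) \<le> 0 + \<epsilon>" if \<epsilon>: "0 < \<epsilon>" for \<epsilon>
    proof -
      have "continuous_on circle (\<lambda>z. complex_of_real (infdist z E))" by (intro continuous_intros)
      from trig_poly_approx[OF this, of "\<epsilon> / 2"] \<epsilon> obtain a where a: "finite_support a"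
        "\<And>z. z \<in> circle \<Longrightarrow> norm (complex_of_real (infdist z E) - trig_poly a z) < \<epsilon> / 2" by auto
      let ?A = "{n. a n \<noteq> 0}"
      have A: "finite ?A" using a(1) by (simp add: finite_support_def)
      have p_eq: "trig_poly a (cis t) = (\<Sum>n\<in>?A. a n * cis (of_int n * t))" for t
        by (simp add: trig_poly_def cis_power_int)
      have int_p: "integrable M (\<lambda>t. trig_poly a (cis t))"
        unfolding p_eq by (intro Bochner_Integration.integrable_sum intM)
      have "(LINT t|M. trig_poly a (cis t)) = (\<Sum>n\<in>?A. a n * b n)"
        unfolding p_eq by (simp only: Bochner_Integration.integral_sum intM M(2)
            Bochner_Integration.integral_mult_right_zero)
      then have L: "(LINT t|M. Re (trig_poly a (cis t))) = Re (\<Sum>n\<in>?A. a n * b n)"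
        using int_p by simp
      \<comment> \<open>\<open>None\<close> carries the constant \<epsilon>/2 separately, since 0
        may already belong to the support of \<open>a\<close>.\<close>
      have "0 \<le> Re (\<Sum>i\<in>insert None (Some ` ?A). (case i of None \<Rightarrow> of_real (\<epsilon> / 2) | Some n \<Rightarrow> - a n) *
          b (case i of None \<Rightarrow> 0 | Some n \<Rightarrow> n))"
      proof (rule positive_on_family[OF b(1)])
        fix z assume z: "z \<in> E"
        have "norm (trig_poly a z) < \<epsilon> / 2" using a(2)[of z] z E(1) by auto
        then have "Re (trig_poly a z) \<le> \<epsilon> / 2" using complex_Re_le_cmod[of "trig_poly a z"] by linarith
        moreover have "(\<Sum>i\<in>insert None (Some ` ?A). (case i of None \<Rightarrow> of_real (\<epsilon> / 2) | Some n \<Rightarrow> - a n) *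
          z powi (case i of None \<Rightarrow> 0 | Some n \<Rightarrow> n)) = of_real (\<epsilon> / 2) - trig_poly a z"
          using A by (simp add: sum.reindex trig_poly_def sum_negf)
        ultimately show "0 \<le> Re (\<Sum>i\<in>insert None (Some ` ?A). (case i of None \<Rightarrow> of_real (\<epsilon> / 2) | Some n \<Rightarrow> - a n) *
          z powi (case i of None \<Rightarrow> 0 | Some n \<Rightarrow> n))" by (simp del: Re_sum)
      qed (use A in simp)
      moreover have "(\<Sum>i\<in>insert None (Some ` ?A). (case i of None \<Rightarrow> of_real (\<epsilon> / 2) | Some n \<Rightarrow> - a n) *
          b (case i of None \<Rightarrow> 0 | Some n \<Rightarrow> n)) = of_real (\<epsilon> / 2) - (\<Sum>n\<in>?A. a n * b n)"
        using A b(2) by (simp add: sum.reindex sum_negf)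
      ultimately have "Re (\<Sum>n\<in>?A. a n * b n) \<le> \<epsilon> / 2" by (simp del: Re_sum)
      then have L_le: "(LINT t|M. Re (trig_poly a (cis t))) \<le> \<epsilon> / 2" using L by simp
      have g_le: "g t \<le> Re (trig_poly a (cis t)) + \<epsilon> / 2" for t
      proof -
        have "norm (complex_of_real (g t) - trig_poly a (cis t)) < \<epsilon> / 2" using a(2)[of "cis t"] by (simp add: g_def)
        then have "Re (complex_of_real (g t) - trig_poly a (cis t)) \<le> \<epsilon> / 2"
          using complex_Re_le_cmod[of "complex_of_real (g t) - trig_poly a (cis t)"] by linarith
        then show ?thesis by simp
      qed
      have int_r: "integrable M (\<lambda>t. Re (trig_poly a (cis t)) + \<epsilon> / 2)" using int_p by simp
      have int_g: "integrable M g"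
        by (rule Bochner_Integration.integrable_bound[OF int_r])
           (use g_le g0 in \<open>auto intro!: AE_I2 simp: abs_of_nonneg intro: order_trans[OF _ abs_ge_self]\<close>)
      have "(LINT t|M. g t) \<le> (LINT t|M. Re (trig_poly a (cis t)) + \<epsilon> / 2)"
        by (rule integral_mono[OF int_g int_r g_le])
      also have "\<dots> = (LINT t|M. Re (trig_poly a (cis t))) + \<epsilon> / 2"
        using int_p by (simp add: M.prob_space[simplified])
      finally have "(LINT t|M. g t) \<le> 0 + \<epsilon>" using L_le by linarith
      then show ?thesis using int_g by blast
    qed
    have "(LINT t|M. g t) \<le> 0"
    proof (rule field_le_epsilon)
      fix \<epsilon> :: real assume "0 < \<epsilon>"
      then show "(LINT t|M. g t) \<le> 0 + \<epsilon>" using approx by blast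
    qed
    moreover have "0 \<le> (LINT t|M. g t)" using g0 by (rule Bochner_Integration.integral_nonneg)
    ultimately have "(LINT t|M. g t) = 0" by simp
    moreover have "integrable M g" using approx[OF zero_less_one] by blast
    ultimately have "AE t in M. g t = 0" using integral_nonneg_eq_0_iff_AE[of M g] g0 by auto
    then have "AE t in M. \<not> cis t \<notin> E"
      using in_closed_iff_infdist_zero[OF E(2,3)] by (auto simp: g_def elim!: eventually_mono)
    then have "emeasure M {t \<in> space M. cis t \<notin> E} = 0" by (rule emeasure_eq_0_AE)
    moreover have "emeasure \<mu> (- E \<inter> circle) = emeasure M (cis -` (- E \<inter> circle) \<inter> space M)"
    proof -
      have "- E \<inter> circle \<in> sets circle_borel"
        unfolding circle_borel_def sets_restrict_space using E(2) by auto
      then show ?thesis unfolding \<mu>_def by (rule emeasure_distr[OF cis_circle])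
    qed
    moreover have "cis -` (- E \<inter> circle) \<inter> space M = {t \<in> space M. cis t \<notin> E}" by auto
    ultimately have "emeasure \<mu> (- E \<inter> circle) = 0" by simp
    moreover have "open (- E)" using E(2) by auto
    ultimately show ?thesis unfolding measure_support_def by blast
  qed
  ultimately show ?thesis using that by blast
qed

theorem theorem2p1:
  fixes W :: "real \<Rightarrow> real"
    and E :: "complex set"
    and S :: "(complex \<Rightarrow> complex) \<Rightarrow> complex"
  assumes "weight W" and "cond_C1 W" and "cond_C2 W" and "cond_C3 W"
    and "compact E" and "E \<subseteq> circle"
    and "distribution S" and "nontrivial_distribution S"
    and "distribution_support S \<subseteq> E"
    and "distribution_fourier S \<in> weighted_l2 (moment W)"
  shows "\<exists>\<mu>. prob_space \<mu> \<and> sets \<mu> = sets circle_borel \<and> measure_support \<mu> \<subseteq> E \<and>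
           measure_fourier \<mu> \<in> weighted_l2 (moment W)"
proof -
  obtain \<theta> where "doubling_weight (moment W) \<theta>"
    using doubling_weight_moment[OF assms(1,3,4)] .
  then interpret doubling_weight "moment W" \<theta> .
  obtain d where d: "0 < d" "\<And>a. finite_support a \<Longrightarrow>
      (\<And>z. z \<in> E \<Longrightarrow> 1 \<le> Re (trig_poly a z)) \<Longrightarrow> d \<le> coeff_norm a"
    using coeff_norm_lower_bound[OF assms(7-10)] by metis
  \<comment> \<open>For empty \<open>E\<close> the constraint is vacuous and a = 0 would violate the
    lower bound \<open>d\<close>. Nonemptiness matters later because \<open>infdist\<close> to the
    empty set is 0.\<close>
  have "E \<noteq> {}"
  proof
    assume "E = {}"
    then have "d \<le> coeff_norm (\<lambda>_. 0)" by (intro d(2)) (auto simp: finite_support_def)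
    then show False using d(1) by (simp add: coeff_norm_def)
  qed
  obtain b M where b: "positive_on E b" "b 0 = 1"
    "\<And>A. finite A \<Longrightarrow> (\<Sum>n\<in>A. (norm (b n))\<^sup>2 / (1 + lam n)) \<le> M"
    using positive_functional[OF d assms(6)] by metis
  obtain \<mu> where \<mu>: "prob_space \<mu>" "sets \<mu> = sets circle_borel" "measure_support \<mu> \<subseteq> E"
    "\<And>n. measure_fourier \<mu> n = b (- n)"
    using measure_on_circle[OF b(1,2) assms(6) compact_imp_closed[OF assms(5)] \<open>E \<noteq> {}\<close>] by metis
  obtain C where C: "0 < C" "\<And>n. (1 + lam n) * moment W (nat \<bar>n\<bar>) \<le> C"
    using ker_comparison by metis
  define f where "f = (\<lambda>n. (norm (measure_fourier \<mu> n))\<^sup>2 * moment W (nat \<bar>n\<bar>))"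
  \<comment> \<open>The reflection n to -n comes from the z^(-n) in \<open>measure_fourier\<close>
    and leaves the weight unchanged.\<close>
  have f_le: "f n \<le> C * ((norm (b (- n)))\<^sup>2 / (1 + lam (- n)))" for n
  proof -
    have pos: "0 < 1 + lam (- n)" using lam_nonneg[of "- n"] by simp
    have "moment W (nat \<bar>n\<bar>) \<le> C / (1 + lam (- n))"
      using C(2)[of "- n"] pos by (simp add: pos_le_divide_eq mult.commute)
    then have "(norm (b (- n)))\<^sup>2 * moment W (nat \<bar>n\<bar>) \<le> (norm (b (- n)))\<^sup>2 * (C / (1 + lam (- n)))"
      by (rule mult_left_mono) simp
    then show ?thesis by (simp add: f_def \<mu>(4) mult_ac)
  qed
  have "sum f F \<le> C * M" if F: "finite F" for F
  proof -
    have "sum f F \<le> (\<Sum>n\<in>F. C * ((norm (b (- n)))\<^sup>2 / (1 + lam (- n))))" by (intro sum_mono f_le)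
    also have "\<dots> = C * (\<Sum>n\<in>uminus ` F. (norm (b n))\<^sup>2 / (1 + lam n))"
      by (subst sum.reindex) (auto simp: sum_distrib_left)
    also have "\<dots> \<le> C * M" using F C(1) by (intro mult_left_mono b(3)) auto
    finally show ?thesis .
  qed
  then have bdd: "bdd_above (sum f ` {F. F \<subseteq> UNIV \<and> finite F})"
    by (intro bdd_aboveI2[of _ _ "C * M"]) simp
  have "0 \<le> f n" for n using w_pos[of "nat \<bar>n\<bar>"] by (simp add: f_def)
  from nonneg_bdd_above_summable_on[OF this bdd] have "f summable_on UNIV" .
  then have "measure_fourier \<mu> \<in> weighted_l2 (moment W)" by (simp add: weighted_l2_def f_def)
  then show ?thesis using \<mu> by blast
qed

end
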